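(* Let $V$ be a smooth manifold, $(f,Z)$ a Morse datum on $V$, $c\in\Sigma(f)$ a critical point, and $W=c_{\searrow}(Z)$ its nappe. Let $u'<u<f(c)$ be real numbers such that $f$ is $W$-proper above $u'$. Then for every neighbourhood $\mathcal U$ in $V$ of ${}_uW=\{x\in W:f(x)\ge u\}$ there are a path $(f_\sigma)_{\sigma\in\mathbb R}$ of smooth functions with support in $\mathcal U$ and a neighbourhood $\mathcal C$ of $c$ such that, for $0\le\sigma\le\sigma'$, $$f_\infty\le f_{\sigma'}\le f_\sigma\le f_0=f,\qquad f_\infty|_{\mathcal C}=f|_{\mathcal C}-f(c)+u,$$ and every $(f_\sigma,Z)$ is a Morse datum (i.e. $(f_\sigma,Z)$ is a path of $Z$-modifications of $(f,Z)$).
   Context: Manifolds are smooth and paracompact; $\Sigma(f)$ is the critical set of $f$. A Morse datum $(f,Z)$ is a Morse function $f$ (all critical points non-degenerate) with a pseudo-gradient $Z$. This is a smooth vector field with $Z(f)>0$ off $\Sigma(f)$ such that near each $c\in\Sigma(f)$ there is a Morse parametrization in which $Z$ is the gradient of $f$ for an adapted metric. That is, there are a splitting $T_cV=N\oplus P$, orthogonal for the Hessian form $q_c(X)=\frac12X(X(f))(c)$, with $q_c|_N$ negative definite and $q_c|_P$ positive definite, and a diffeomorphism $\psi$ from $U=U_N+U_P$ ($U_N\subset N$ and $U_P\subset P$ star-shaped neighbourhoods of $0$) onto a neighbourhood of $c$, with $\psi(0)=c$, $T_0\psi=\mathrm{Id}$, $f\circ\psi-f(c)=q_c|_U$ and $\psi_*^{-1}Z$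 the linear field $n+p\mapsto -n+p$. A datum $(f',Z)$ with the same field $Z$ is called a $Z$-modification of $(f,Z)$. With $\Phi_t$ the (maximal) flow of $Z$, the nappe of $c$ is $c_{\searrow}(Z)=\{x\in V:\exists\, b\in[0,+\infty],\ \lim_{t\to b}\Phi_t(x)=c\}$. $f$ is $F$-proper above $u'$ (for $F\subset V$) if $f|:F\cap f^{-1}(]u',+\infty[)\to\,]u',+\infty[$ is continuous and proper. A path of functions is a family $(f_\sigma)_{\sigma\in\mathbb R}$, smooth in $(\sigma,v)$, with, for some $a<b$, $f_\sigma=f_a=:f_{-\infty}$ for $\sigma\le a$ and $f_\sigma=f_b=:f_\infty$ for $\sigma\ge b$; it has support in $\mathcal U$ if the closure of $\{v:\exists\sigma,\ f_\sigma(v)\neq f_{-\infty}(v)\}$ lies in $\mathcal U$; here it starts at $f_{-\infty}=f$. *)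

theory Defs
  imports "HOL-Analysis.Analysis"
begin

section \<open>Smooth maps\<close>

primrec Ck_on :: "nat \<Rightarrow> 'a::real_normed_vector set \<Rightarrow> ('a \<Rightarrow> 'b::real_normed_vector) \<Rightarrow> bool" where
  "Ck_on 0 S f \<longleftrightarrow> continuous_on S f"
| "Ck_on (Suc k) S f \<longleftrightarrow>
     f differentiable_on S \<and> (\<forall>v. Ck_on k S (\<lambda>x. frechet_derivative f (at x) v))"

text \<open>Smoothness on an arbitrary subset: local extendability to a smooth map on an open set.
  It is used for relatively open subsets of linear subspaces.\<close>

definition smooth_on :: "'a::real_normed_vector set \<Rightarrow> ('a \<Rightarrow> 'b::real_normed_vector) \<Rightarrow> bool" where
  "smooth_on S f \<longleftrightarrow>
     (\<forall>x\<in>S. \<exists>T g. open T \<and> x \<in> T \<and> (\<forall>k. Ck_on k T g) \<and> (\<forall>y\<in>S \<inter> T. g y = f y))"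

definition dir_deriv :: "('a::real_normed_vector \<Rightarrow> 'b::real_normed_vector) \<Rightarrow> 'a \<Rightarrow> 'a \<Rightarrow> 'b" where
  "dir_deriv f x v = vector_derivative (\<lambda>t. f (x + t *\<^sub>R v)) (at 0)"


section \<open>Manifolds\<close>

text \<open>The underlying set of the manifold is the whole type \<open>'v\<close>. A chart takes its values in a
  linear subspace of \<open>'e\<close> which may depend on the chart, so that dimension \<open>0\<close> and components of
  different dimensions are allowed. Values of \<open>coord\<close> outside \<open>domain\<close> are irrelevant.\<close>

record ('v, 'e) chart =
  domain :: "'v set"
  model :: "'e set"
  coord :: "'v \<Rightarrow> 'e"

definition codomain :: "('v, 'e) chart \<Rightarrow> 'e set" where
  "codomain \<kappa> = coord \<kappa> ` domain \<kappa>"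

definition chart_inv :: "('v, 'e) chart \<Rightarrow> 'e \<Rightarrow> 'v" where
  "chart_inv \<kappa> = inv_into (domain \<kappa>) (coord \<kappa>)"

definition is_chart :: "('v::topological_space, 'e::euclidean_space) chart \<Rightarrow> bool" where
  "is_chart \<kappa> \<longleftrightarrow>
     open (domain \<kappa>) \<and> subspace (model \<kappa>) \<and>
     openin (top_of_set (model \<kappa>)) (codomain \<kappa>) \<and>
     homeomorphism (domain \<kappa>) (codomain \<kappa>) (coord \<kappa>) (chart_inv \<kappa>)"

definition smooth_transition :: "('v, 'e::euclidean_space) chart \<Rightarrow> ('v, 'e) chart \<Rightarrow> bool" where
  "smooth_transition \<kappa> \<kappa>' \<longleftrightarrow>
     smooth_on (coord \<kappa> ` (domain \<kappa> \<inter> domain \<kappa>')) (coord \<kappa>' \<circ> chart_inv \<kappa>)"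

definition compatible_chart ::
    "('v::topological_space, 'e::euclidean_space) chart set \<Rightarrow> ('v, 'e) chart \<Rightarrow> bool" where
  "compatible_chart A \<kappa> \<longleftrightarrow>
     is_chart \<kappa> \<and> (\<forall>\<kappa>'\<in>A. smooth_transition \<kappa> \<kappa>' \<and> smooth_transition \<kappa>' \<kappa>)"

definition paracompact_space :: "'v::topological_space itself \<Rightarrow> bool" where
  "paracompact_space _ \<longleftrightarrow>
     (\<forall>\<U>::'v set set. (\<forall>U\<in>\<U>. open U) \<and> \<Union>\<U> = UNIV \<longrightarrow>
        (\<exists>\<V>. (\<forall>V\<in>\<V>. open V \<and> (\<exists>U\<in>\<U>. V \<subseteq> U)) \<and> \<Union>\<V> = UNIV \<and>
             locally_finite_in euclidean \<V>))"

definition smooth_manifold :: "('v::t2_space, 'e::euclidean_space) chart set \<Rightarrow> bool" where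
  "smooth_manifold A \<longleftrightarrow>
     (\<forall>\<kappa>\<in>A. compatible_chart A \<kappa>) \<and> (\<Union>\<kappa>\<in>A. domain \<kappa>) = UNIV \<and>
     paracompact_space TYPE('v)"

definition smooth_function ::
    "('v, 'e::euclidean_space) chart set \<Rightarrow> ('v \<Rightarrow> real) \<Rightarrow> bool" where
  "smooth_function A f \<longleftrightarrow> (\<forall>\<kappa>\<in>A. smooth_on (codomain \<kappa>) (f \<circ> chart_inv \<kappa>))"

text \<open>A tangent vector at \<open>x\<close> is the family of its components in the charts at \<open>x\<close>, related by
  the differentials of the transition maps; its values at the other charts are irrelevant.\<close>

definition tangent_vector ::
    "('v, 'e::euclidean_space) chart set \<Rightarrow> 'v \<Rightarrow> (('v, 'e) chart \<Rightarrow> 'e) \<Rightarrow> bool" where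
  "tangent_vector A x \<xi> \<longleftrightarrow>
     (\<forall>\<kappa>\<in>A. x \<in> domain \<kappa> \<longrightarrow> \<xi> \<kappa> \<in> model \<kappa>) \<and>
     (\<forall>\<kappa>\<in>A. \<forall>\<kappa>'\<in>A. x \<in> domain \<kappa> \<inter> domain \<kappa>' \<longrightarrow>
        \<xi> \<kappa>' = dir_deriv (coord \<kappa>' \<circ> chart_inv \<kappa>) (coord \<kappa> x) (\<xi> \<kappa>))"

definition smooth_vector_field ::
    "('v, 'e::euclidean_space) chart set \<Rightarrow> ('v \<Rightarrow> ('v, 'e) chart \<Rightarrow> 'e) \<Rightarrow> bool" where
  "smooth_vector_field A Z \<longleftrightarrow>
     (\<forall>x. tangent_vector A x (Z x)) \<and>
     (\<forall>\<kappa>\<in>A. smooth_on (codomain \<kappa>) (\<lambda>y. Z (chart_inv \<kappa> y) \<kappa>))"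


section \<open>Morse data\<close>

text \<open>Differential of \<open>f\<close> at \<open>x\<close>, on the vector with component \<open>X\<close> in the chart \<open>\<kappa>\<close>.\<close>

definition chart_deriv ::
    "('v, 'e::euclidean_space) chart \<Rightarrow> ('v \<Rightarrow> real) \<Rightarrow> 'v \<Rightarrow> 'e \<Rightarrow> real" where
  "chart_deriv \<kappa> f x X = dir_deriv (f \<circ> chart_inv \<kappa>) (coord \<kappa> x) X"

definition critical_set ::
    "('v, 'e::euclidean_space) chart set \<Rightarrow> ('v \<Rightarrow> real) \<Rightarrow> 'v set" where
  "critical_set A f =
     {x. \<forall>\<kappa>\<in>A. x \<in> domain \<kappa> \<longrightarrow> (\<forall>X\<in>model \<kappa>. chart_deriv \<kappa> f x X = 0)}"

text \<open>The number \<open>X (Y f) (c)\<close>, where the vectors \<open>X\<close> and \<open>Y\<close> are extended to vector fields that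
  are constant in the chart \<open>\<kappa>\<close>; at a critical point the extension does not matter.\<close>

definition hessian ::
    "('v, 'e::euclidean_space) chart \<Rightarrow> ('v \<Rightarrow> real) \<Rightarrow> 'v \<Rightarrow> 'e \<Rightarrow> 'e \<Rightarrow> real" where
  "hessian \<kappa> f c X Y = chart_deriv \<kappa> (\<lambda>x. chart_deriv \<kappa> f x Y) c X"

definition hessian_form ::
    "('v, 'e::euclidean_space) chart \<Rightarrow> ('v \<Rightarrow> real) \<Rightarrow> 'v \<Rightarrow> 'e \<Rightarrow> real" where
  "hessian_form \<kappa> f c X = hessian \<kappa> f c X X / 2"

definition nondegenerate_at ::
    "('v, 'e::euclidean_space) chart set \<Rightarrow> ('v \<Rightarrow> real) \<Rightarrow> 'v \<Rightarrow> bool" where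
  "nondegenerate_at A f c \<longleftrightarrow>
     (\<forall>\<kappa>\<in>A. c \<in> domain \<kappa> \<longrightarrow>
        (\<forall>X\<in>model \<kappa>. (\<forall>Y\<in>model \<kappa>. hessian \<kappa> f c X Y = 0) \<longrightarrow> X = 0))"

definition morse_function ::
    "('v, 'e::euclidean_space) chart set \<Rightarrow> ('v \<Rightarrow> real) \<Rightarrow> bool" where
  "morse_function A f \<longleftrightarrow>
     smooth_function A f \<and> (\<forall>c\<in>critical_set A f. nondegenerate_at A f c)"

definition star_shaped_nhd_0 :: "'e::euclidean_space set \<Rightarrow> 'e set \<Rightarrow> bool" where
  "star_shaped_nhd_0 E U \<longleftrightarrow>
     openin (top_of_set E) U \<and> 0 \<in> U \<and> (\<forall>x\<in>U. closed_segment 0 x \<subseteq> U)"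

text \<open>\<open>\<psi>\<close> is a diffeomorphism from the relatively open subset \<open>U\<close> of \<open>E\<close> onto an open subset
  of the manifold.\<close>

definition smooth_parametrization ::
    "('v::topological_space, 'e::euclidean_space) chart set \<Rightarrow> 'e set \<Rightarrow> 'e set \<Rightarrow> ('e \<Rightarrow> 'v) \<Rightarrow> bool"
  where
  "smooth_parametrization A E U \<psi> \<longleftrightarrow>
     inj_on \<psi> U \<and> compatible_chart A \<lparr>domain = \<psi> ` U, model = E, coord = inv_into U \<psi>\<rparr>"

text \<open>Here the tangent space at \<open>c\<close> is identified with \<open>model \<kappa>\<close> by the differential of the
  chart \<open>\<kappa>\<close>.\<close>

definition adapted_parametrization ::
    "('v::topological_space, 'e::euclidean_space) chart set \<Rightarrow> ('v \<Rightarrow> real) \<Rightarrow>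
     ('v \<Rightarrow> ('v, 'e) chart \<Rightarrow> 'e) \<Rightarrow> 'v \<Rightarrow> ('v, 'e) chart \<Rightarrow>
     'e set \<Rightarrow> 'e set \<Rightarrow> 'e set \<Rightarrow> 'e set \<Rightarrow> ('e \<Rightarrow> 'v) \<Rightarrow> bool" where
  "adapted_parametrization A f Z c \<kappa> N P U\<^sub>N U\<^sub>P \<psi> \<longleftrightarrow>
     subspace N \<and> subspace P \<and> N \<inter> P = {0} \<and> {n + p |n p. n \<in> N \<and> p \<in> P} = model \<kappa> \<and>
     (\<forall>n\<in>N. \<forall>p\<in>P. hessian \<kappa> f c n p = 0) \<and>
     (\<forall>n\<in>N - {0}. hessian_form \<kappa> f c n < 0) \<and>
     (\<forall>p\<in>P - {0}. hessian_form \<kappa> f c p > 0) \<and>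
     star_shaped_nhd_0 N U\<^sub>N \<and> star_shaped_nhd_0 P U\<^sub>P \<and>
     smooth_parametrization A (model \<kappa>) {n + p |n p. n \<in> U\<^sub>N \<and> p \<in> U\<^sub>P} \<psi> \<and>
     \<psi> 0 = c \<and> (\<forall>X\<in>model \<kappa>. dir_deriv (coord \<kappa> \<circ> \<psi>) 0 X = X) \<and>
     (\<forall>n\<in>U\<^sub>N. \<forall>p\<in>U\<^sub>P. f (\<psi> (n + p)) - f c = hessian_form \<kappa> f c (n + p)) \<and>
     (\<forall>n\<in>U\<^sub>N. \<forall>p\<in>U\<^sub>P. \<forall>\<kappa>'\<in>A. \<psi> (n + p) \<in> domain \<kappa>' \<longrightarrow>
        dir_deriv (coord \<kappa>' \<circ> \<psi>) (n + p) (- n + p) = Z (\<psi> (n + p)) \<kappa>')"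

definition pseudo_gradient ::
    "('v::topological_space, 'e::euclidean_space) chart set \<Rightarrow> ('v \<Rightarrow> real) \<Rightarrow>
     ('v \<Rightarrow> ('v, 'e) chart \<Rightarrow> 'e) \<Rightarrow> bool" where
  "pseudo_gradient A f Z \<longleftrightarrow>
     smooth_vector_field A Z \<and>
     (\<forall>x. x \<notin> critical_set A f \<longrightarrow>
        (\<forall>\<kappa>\<in>A. x \<in> domain \<kappa> \<longrightarrow> chart_deriv \<kappa> f x (Z x \<kappa>) > 0)) \<and>
     (\<forall>c\<in>critical_set A f. \<exists>\<kappa>\<in>A. c \<in> domain \<kappa> \<and>
        (\<exists>N P U\<^sub>N U\<^sub>P \<psi>. adapted_parametrization A f Z c \<kappa> N P U\<^sub>N U\<^sub>P \<psi>))"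

definition morse_datum ::
    "('v::topological_space, 'e::euclidean_space) chart set \<Rightarrow> ('v \<Rightarrow> real) \<Rightarrow>
     ('v \<Rightarrow> ('v, 'e) chart \<Rightarrow> 'e) \<Rightarrow> bool" where
  "morse_datum A f Z \<longleftrightarrow> morse_function A f \<and> pseudo_gradient A f Z"


section \<open>Flow and nappes\<close>

definition integral_curve ::
    "('v::topological_space, 'e::euclidean_space) chart set \<Rightarrow> ('v \<Rightarrow> ('v, 'e) chart \<Rightarrow> 'e) \<Rightarrow>
     'v \<Rightarrow> real set \<Rightarrow> (real \<Rightarrow> 'v) \<Rightarrow> bool" where
  "integral_curve A Z x I \<gamma> \<longleftrightarrow>
     open I \<and> is_interval I \<and> 0 \<in> I \<and> \<gamma> 0 = x \<and> continuous_on I \<gamma> \<and>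
     (\<forall>t\<in>I. \<forall>\<kappa>\<in>A. \<gamma> t \<in> domain \<kappa> \<longrightarrow>
        ((coord \<kappa> \<circ> \<gamma>) has_vector_derivative Z (\<gamma> t) \<kappa>) (at t))"

text \<open>The maximal flow: \<open>flow A Z t x\<close> is meaningful for \<open>t \<in> flow_domain A Z x\<close>.\<close>

definition flow_domain ::
    "('v::topological_space, 'e::euclidean_space) chart set \<Rightarrow> ('v \<Rightarrow> ('v, 'e) chart \<Rightarrow> 'e) \<Rightarrow>
     'v \<Rightarrow> real set" where
  "flow_domain A Z x = \<Union>{I. \<exists>\<gamma>. integral_curve A Z x I \<gamma>}"

definition flow ::
    "('v::topological_space, 'e::euclidean_space) chart set \<Rightarrow> ('v \<Rightarrow> ('v, 'e) chart \<Rightarrow> 'e) \<Rightarrow>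
     real \<Rightarrow> 'v \<Rightarrow> 'v" where
  "flow A Z t x = (THE y. \<exists>I \<gamma>. integral_curve A Z x I \<gamma> \<and> t \<in> I \<and> \<gamma> t = y)"

text \<open>The limit is taken along the times at which the flow is defined, of which \<open>b\<close> has to be a
  limit point in the extended reals.\<close>

definition nappe ::
    "('v::topological_space, 'e::euclidean_space) chart set \<Rightarrow> ('v \<Rightarrow> ('v, 'e) chart \<Rightarrow> 'e) \<Rightarrow>
     'v \<Rightarrow> 'v set" where
  "nappe A Z c =
     {x. \<exists>b::ereal. 0 \<le> b \<and> at b within ereal ` flow_domain A Z x \<noteq> bot \<and>
         ((\<lambda>t. flow A Z (real_of_ereal t) x) \<longlongrightarrow> c) (at b within ereal ` flow_domain A Z x)}"


section \<open>Relative properness and paths of functions\<close>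

definition proper_above :: "'v::topological_space set \<Rightarrow> ('v \<Rightarrow> real) \<Rightarrow> real \<Rightarrow> bool" where
  "proper_above F f u' \<longleftrightarrow>
     continuous_map (top_of_set (F \<inter> f -` {u'<..})) (top_of_set {u'<..}) f \<and>
     proper_map (top_of_set (F \<inter> f -` {u'<..})) (top_of_set {u'<..}) f"

text \<open>The initial function is \<open>F a\<close> and the final one is \<open>F b\<close>.\<close>

definition path_of_functions ::
    "('v, 'e::euclidean_space) chart set \<Rightarrow> (real \<Rightarrow> 'v \<Rightarrow> real) \<Rightarrow> real \<Rightarrow> real \<Rightarrow> bool" where
  "path_of_functions A F a b \<longleftrightarrow>
     (\<forall>\<kappa>\<in>A. smooth_on (UNIV \<times> codomain \<kappa>) (\<lambda>(\<sigma>, y). F \<sigma> (chart_inv \<kappa> y))) \<and>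
     a < b \<and> (\<forall>\<sigma>\<le>a. F \<sigma> = F a) \<and> (\<forall>\<sigma>\<ge>b. F \<sigma> = F b)"

definition path_support ::
    "(real \<Rightarrow> 'v::topological_space \<Rightarrow> real) \<Rightarrow> real \<Rightarrow> 'v set" where
  "path_support F a = closure {x. \<exists>\<sigma>. F \<sigma> x \<noteq> F a x}"

end

theory Submission
  imports Defs
begin

text \<open>
  Lowering \<open>f\<close> near the nappe while keeping \<open>Z\<close> as a pseudo-gradient only requires
  functions \<open>h\<close> with \<open>Z(h) > 0\<close> off the critical points, and this condition survives taking
  minima, if the minimum is smoothed in such a way that its derivative is a convex combination of the two derivatives.
  With \<open>\<Lambda>(t) = t exp (- 1 / t)\<close> for \<open>t > 0\<close> and \<open>\<Lambda>(t) = 0\<close> otherwise, the function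
  \<open>a - d \<Lambda>((a - b) / d)\<close> (the smooth minimum \<open>smin\<close> below) has this property, since \<open>0 \<le> \<Lambda>' \<le> 1\<close>. It equals \<open>a\<close> where
  \<open>a \<le> b\<close> and is at most \<open>b + d\<close>. So a function \<open>h\<close> can be lowered inside a box by any \<open>k\<close> that increases along \<open>Z\<close> in
  the box and exceeds \<open>h\<close> on the boundary of the box (lemma \<open>lower_on\<close>).

  Away from critical points the box is a tube around one trajectory (lemma \<open>tube\<close>). Parametrized by the
  values of \<open>f\<close>, it is a smooth curve \<open>\<eta>\<close>, and the squared distance from a point \<open>y\<close> to \<open>\<eta>(f y)\<close>, multiplied by the exponential of a multiple
  of \<open>f\<close>, does not decrease along \<open>Z\<close>. A large multiple of this function is a barrier on the sides of the tube;
  along the trajectory the barrier is almost constant. Hence a value that lowered functions attain at the lower end of the tube is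
  attained, up to an arbitrarily small loss, at its upper end.

  The nappe is invariant under going backwards along trajectories, and properness makes its part between two
  levels above \<open>u'\<close> and below \<open>f c\<close> compact; it contains no critical point. By properness there is also a level \<open>v < u\<close> above which the nappe
  is contained in the open set \<open>U\<close>, where \<open>U\<close> is the interior of the given neighbourhood. Finitely many tubes lead from any point of the
  nappe down to the level \<open>v\<close>, where \<open>f\<close> itself is low (lemma \<open>lowering_on_nappe\<close>). On a compact subset of the nappe below \<open>f c\<close>, a
  finite smooth minimum lowers \<open>f\<close> by any amount \<open>H'\<close> for which some \<open>H > H'\<close> satisfies \<open>f - H > v\<close> there.

  Such a subset is the small sphere bounding the stable disc of \<open>c\<close> in the Morse chart. On it the lowered
  function lies below \<open>f - f c + u\<close>, because the sphere is close to the level of \<open>c\<close> and \<open>v < u\<close>. Therefore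
  \<open>f - f c + u\<close>, increased away from the stable disc, can take over in the interior of a box around \<open>c\<close> (lemma
  \<open>lowered_function\<close>). The path is the segment from \<open>f\<close> to the resulting function.
\<close>

section \<open>Calculus of smooth maps\<close>

definition Cinf_on :: "'a::real_normed_vector set \<Rightarrow> ('a \<Rightarrow> 'b::real_normed_vector) \<Rightarrow> bool" where
  "Cinf_on S g \<longleftrightarrow> (\<forall>k. Ck_on k S g)"

declare Ck_on.simps(2) [simp del]

lemma Ck_on_Suc_iff:
  assumes "open S"
  shows "Ck_on (Suc k) S f \<longleftrightarrow>
    (\<exists>f'. (\<forall>x\<in>S. (f has_derivative f' x) (at x)) \<and> (\<forall>v. Ck_on k S (\<lambda>x. f' x v)))"
    (is "_ \<longleftrightarrow> ?R")
  and Ck_on_cong_open: "(\<And>x. x \<in> S \<Longrightarrow> f x = g x) \<Longrightarrow> Ck_on k S f \<longleftrightarrow> Ck_on k S g"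
proof -
  have cong: "Ck_on k S f \<longleftrightarrow> Ck_on k S g" if "\<And>x. x \<in> S \<Longrightarrow> f x = g x" for k and f g :: "'a \<Rightarrow> 'b"
    using that
  proof (induction k arbitrary: f g)
    case 0
    then show ?case by (simp cong: continuous_on_cong)
  next
    case (Suc k)
    have D: "(f has_derivative D) (at x) \<longleftrightarrow> (g has_derivative D) (at x)" if "x \<in> S" for x D
      using Suc.prems that assms
      by (metis has_derivative_transform_within_open)
    have F: "frechet_derivative f (at x) = frechet_derivative g (at x)" if "x \<in> S" for x
      unfolding frechet_derivative_def using D[OF that] by simp
    have "f differentiable_on S \<longleftrightarrow> g differentiable_on S"
      using D by (simp add: differentiable_on_eq_differentiable_at[OF assms] differentiable_def)
    moreover have "Ck_on k S (\<lambda>x. frechet_derivative f (at x) v) \<longleftrightarrow> Ck_on k S (\<lambda>x. frechet_derivative g (at x) v)" for v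
      by (rule Suc.IH) (simp add: F)
    ultimately show ?case by (simp add: Ck_on.simps(2))
  qed
  show "(\<And>x. x \<in> S \<Longrightarrow> f x = g x) \<Longrightarrow> Ck_on k S f \<longleftrightarrow> Ck_on k S g" by (rule cong)
  show "Ck_on (Suc k) S f \<longleftrightarrow> ?R"
  proof
    assume "Ck_on (Suc k) S f"
    then show ?R
      by (intro exI[of _ "\<lambda>x. frechet_derivative f (at x)"])
         (simp add: Ck_on.simps(2) differentiable_on_eq_differentiable_at[OF assms] frechet_derivative_works[symmetric])
  next
    assume ?R
    then obtain f' where f': "\<And>x. x \<in> S \<Longrightarrow> (f has_derivative f' x) (at x)" "\<And>v. Ck_on k S (\<lambda>x. f' x v)" by blast
    have "f differentiable_on S"
      using f' by (auto simp: differentiable_on_eq_differentiable_at[OF assms] differentiable_def)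
    moreover have "Ck_on k S (\<lambda>x. frechet_derivative f (at x) v)" for v
      using f'(2)[of v] cong[of "\<lambda>x. frechet_derivative f (at x) v" "\<lambda>x. f' x v" k]
        frechet_derivative_at[OF f'(1)] by simp
    ultimately show "Ck_on (Suc k) S f" by (simp add: Ck_on.simps(2))
  qed
qed

lemma Ck_on_SucI:
  assumes "open S" "\<And>x. x \<in> S \<Longrightarrow> (f has_derivative f' x) (at x)" "\<And>v. Ck_on k S (\<lambda>x. f' x v)"
  shows "Ck_on (Suc k) S f"
  unfolding Ck_on_Suc_iff[OF assms(1)] using assms(2,3) by (intro exI[of _ f']) blast

lemma Ck_on_SucE:
  assumes "open S" "Ck_on (Suc k) S f"
  obtains f' where "\<And>x. x \<in> S \<Longrightarrow> (f has_derivative f' x) (at x)" "\<And>v. Ck_on k S (\<lambda>x. f' x v)"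
  using assms(2) unfolding Ck_on_Suc_iff[OF assms(1)] by blast

lemma Ck_on_SucD: "open S \<Longrightarrow> Ck_on (Suc k) S f \<Longrightarrow> Ck_on k S f"
proof (induction k arbitrary: f)
  case 0
  then show ?case by (simp add: Ck_on.simps(2) differentiable_imp_continuous_on)
next
  case (Suc k)
  then obtain f' where "\<And>x. x \<in> S \<Longrightarrow> (f has_derivative f' x) (at x)" "\<And>v. Ck_on (Suc k) S (\<lambda>x. f' x v)"
    using Ck_on_SucE by metis
  then show ?case using Suc by (intro Ck_on_SucI[where f' = f']) auto
qed

lemma Ck_on_imp_continuous_on: "open S \<Longrightarrow> Ck_on k S f \<Longrightarrow> continuous_on S f"
  by (induction k) (auto dest: Ck_on_SucD)

lemma Ck_on_open_subset: "open S \<Longrightarrow> Ck_on k S f \<Longrightarrow> open T \<Longrightarrow> T \<subseteq> S \<Longrightarrow> Ck_on k T f"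
proof (induction k arbitrary: f)
  case 0
  then show ?case using continuous_on_subset by auto
next
  case (Suc k)
  from Suc.prems(1,2) obtain f' where "\<And>x. x \<in> S \<Longrightarrow> (f has_derivative f' x) (at x)" "\<And>v. Ck_on k S (\<lambda>x. f' x v)"
    using Ck_on_SucE by metis
  then show ?case using Suc by (intro Ck_on_SucI[where f' = f']) auto
qed

lemma Ck_on_const: "open S \<Longrightarrow> Ck_on k S (\<lambda>x. c)"
  by (induction k arbitrary: c) (auto intro!: Ck_on_SucI[where f' = "\<lambda>x v. 0"])

lemma Ck_on_bounded_linear:
  assumes "open S" "bounded_linear f"
  shows "Ck_on k S f"
proof (cases k)
  case 0
  then show ?thesis using assms by (simp add: linear_continuous_on)
next
  case (Suc k')
  then show ?thesis using assms
    by (auto intro!: Ck_on_SucI[where f' = "\<lambda>x. f"] Ck_on_const bounded_linear_imp_has_derivative)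
qed

lemma
  fixes f :: "'a::real_normed_vector \<Rightarrow> 'b::real_normed_vector" and g :: "'a \<Rightarrow> 'c::real_normed_vector"
    and p :: "'b \<Rightarrow> 'c \<Rightarrow> 'd::real_normed_vector"
  assumes S: "open S"
  shows Ck_on_add: "Ck_on k S h \<Longrightarrow> Ck_on k S h' \<Longrightarrow> Ck_on k S (\<lambda>x. h x + h' x :: 'd)"
    and Ck_on_bilinear: "bounded_bilinear p \<Longrightarrow> Ck_on k S f \<Longrightarrow> Ck_on k S g \<Longrightarrow> Ck_on k S (\<lambda>x. p (f x) (g x))"
proof -
  have add: "Ck_on k S h \<Longrightarrow> Ck_on k S h' \<Longrightarrow> Ck_on k S (\<lambda>x. h x + h' x)" for k and h h' :: "'a \<Rightarrow> 'd"
  proof (induction k arbitrary: h h')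
    case 0
    then show ?case by (auto intro: continuous_intros)
  next
    case (Suc k)
    from Suc.prems(1) obtain D where D: "\<And>x. x \<in> S \<Longrightarrow> (h has_derivative D x) (at x)" "\<And>v. Ck_on k S (\<lambda>x. D x v)"
      using Ck_on_SucE[OF S] by metis
    from Suc.prems(2) obtain D' where D': "\<And>x. x \<in> S \<Longrightarrow> (h' has_derivative D' x) (at x)" "\<And>v. Ck_on k S (\<lambda>x. D' x v)"
      using Ck_on_SucE[OF S] by metis
    show ?case
      by (rule Ck_on_SucI[OF S, where f' = "\<lambda>x v. D x v + D' x v"])
         (auto intro: has_derivative_add D D' Suc.IH)
  qed
  then show "Ck_on k S h \<Longrightarrow> Ck_on k S h' \<Longrightarrow> Ck_on k S (\<lambda>x. h x + h' x :: 'd)" .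
  assume p: "bounded_bilinear p"
  show "Ck_on k S f \<Longrightarrow> Ck_on k S g \<Longrightarrow> Ck_on k S (\<lambda>x. p (f x) (g x))"
  proof (induction k arbitrary: f g)
    case 0
    then show ?case by (auto intro: bounded_bilinear.continuous_on[OF p])
  next
    case (Suc k)
    from Suc.prems(1) obtain D where D: "\<And>x. x \<in> S \<Longrightarrow> (f has_derivative D x) (at x)" "\<And>v. Ck_on k S (\<lambda>x. D x v)"
      using Ck_on_SucE[OF S] by metis
    from Suc.prems(2) obtain D' where D': "\<And>x. x \<in> S \<Longrightarrow> (g has_derivative D' x) (at x)" "\<And>v. Ck_on k S (\<lambda>x. D' x v)"
      using Ck_on_SucE[OF S] by metis
    show ?case
      by (rule Ck_on_SucI[OF S, where f' = "\<lambda>x v. p (f x) (D' x v) + p (D x v) (g x)"])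
         (auto intro!: bounded_bilinear.FDERIV[OF p] D D' Suc.IH add intro: Ck_on_SucD[OF S] Suc.prems)
  qed
qed

lemma Ck_on_sum:
  assumes "open S" "\<And>i. i \<in> I \<Longrightarrow> Ck_on k S (f i)"
  shows "Ck_on k S (\<lambda>x. \<Sum>i\<in>I. f i x)"
  using assms(2) by (induction I rule: infinite_finite_induct) (auto intro: Ck_on_const Ck_on_add assms(1))

text \<open>In the chain rule the differential of the outer map is applied to a varying vector; expanding
  this vector in a basis turns the derivative into a sum of products of maps of lower order.\<close>

lemma Ck_on_compose:
  fixes f :: "'a::real_normed_vector \<Rightarrow> 'b::euclidean_space" and g :: "'b \<Rightarrow> 'c::real_normed_vector"
  assumes S: "open S" and T: "open T" and sub: "f ` S \<subseteq> T"
  shows "Ck_on k S f \<Longrightarrow> Ck_on k T g \<Longrightarrow> Ck_on k S (\<lambda>x. g (f x))"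
proof (induction k arbitrary: g)
  case 0
  then show ?case using continuous_on_compose2[of T g S f] sub by auto
next
  case (Suc k)
  from Suc.prems(1) obtain D where D: "\<And>x. x \<in> S \<Longrightarrow> (f has_derivative D x) (at x)" "\<And>v. Ck_on k S (\<lambda>x. D x v)"
    using Ck_on_SucE[OF S] by metis
  from Suc.prems(2) obtain D' where D': "\<And>x. x \<in> T \<Longrightarrow> (g has_derivative D' x) (at x)" "\<And>v. Ck_on k T (\<lambda>x. D' x v)"
    using Ck_on_SucE[OF T] by metis
  have fS: "f x \<in> T" if "x \<in> S" for x using that sub by auto
  have eq: "D' (f x) w = (\<Sum>b\<in>Basis. (w \<bullet> b) *\<^sub>R D' (f x) b)" if "x \<in> S" for x w
  proof -
    have lin: "linear (D' (f x))" using D'(1)[OF fS[OF that]] by (simp add: has_derivative_linear)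
    have "D' (f x) w = D' (f x) (\<Sum>b\<in>Basis. (w \<bullet> b) *\<^sub>R b)" by (simp add: euclidean_representation)
    then show ?thesis by (simp add: linear_sum[OF lin] linear_scale[OF lin])
  qed
  show ?case
  proof (rule Ck_on_SucI[OF S, where f' = "\<lambda>x v. D' (f x) (D x v)"])
    show "((\<lambda>x. g (f x)) has_derivative (\<lambda>v. D' (f x) (D x v))) (at x)" if "x \<in> S" for x
      using has_derivative_compose[OF D(1)[OF that], of g "D' (f x)"] D'(1)[OF fS[OF that]] by simp
    fix v
    have "Ck_on k S (\<lambda>x. \<Sum>b\<in>Basis. (D x v \<bullet> b) *\<^sub>R D' (f x) b)"
      by (intro Ck_on_sum S Ck_on_bilinear[OF S bounded_bilinear_scaleR] Suc.IH
          Ck_on_bilinear[OF S bounded_bilinear_inner] D D' Ck_on_const Ck_on_SucD[OF S Suc.prems(1)])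
    then show "Ck_on k S (\<lambda>x. D' (f x) (D x v))"
      by (subst Ck_on_cong_open[OF S]) (use eq in auto)
  qed
qed

lemma Ck_on_SucI_real:
  fixes f :: "real \<Rightarrow> 'b::real_normed_vector"
  assumes S: "open S" and "\<And>x. x \<in> S \<Longrightarrow> (f has_vector_derivative f' x) (at x)" "Ck_on k S f'"
  shows "Ck_on (Suc k) S f"
  by (rule Ck_on_SucI[OF S, where f' = "\<lambda>x v. v *\<^sub>R f' x"])
     (use assms in \<open>auto simp: has_vector_derivative_def intro: Ck_on_bilinear[OF S bounded_bilinear_scaleR] Ck_on_const\<close>)

subsection \<open>Infinitely differentiable maps\<close>

lemma Cinf_on_cong: "open S \<Longrightarrow> (\<And>x. x \<in> S \<Longrightarrow> f x = g x) \<Longrightarrow> Cinf_on S f \<Longrightarrow> Cinf_on S g"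
  using Ck_on_cong_open unfolding Cinf_on_def by blast

lemma Cinf_on_subset: "open S \<Longrightarrow> Cinf_on S f \<Longrightarrow> open T \<Longrightarrow> T \<subseteq> S \<Longrightarrow> Cinf_on T f"
  using Ck_on_open_subset unfolding Cinf_on_def by blast

lemma Cinf_on_const: "open S \<Longrightarrow> Cinf_on S (\<lambda>x. c)"
  and Cinf_on_linear: "open S \<Longrightarrow> bounded_linear l \<Longrightarrow> Cinf_on S l"
  and Cinf_on_add: "open S \<Longrightarrow> Cinf_on S h \<Longrightarrow> Cinf_on S h' \<Longrightarrow> Cinf_on S (\<lambda>x. h x + h' x)"
  and Cinf_on_bilinear: "open S \<Longrightarrow> bounded_bilinear p \<Longrightarrow> Cinf_on S f \<Longrightarrow> Cinf_on S g \<Longrightarrow> Cinf_on S (\<lambda>x. p (f x) (g x))"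
  unfolding Cinf_on_def by (auto intro: Ck_on_const Ck_on_bounded_linear Ck_on_add Ck_on_bilinear)

lemma Cinf_on_compose:
  fixes f :: "'a::real_normed_vector \<Rightarrow> 'b::euclidean_space"
  shows "open S \<Longrightarrow> open T \<Longrightarrow> f ` S \<subseteq> T \<Longrightarrow> Cinf_on S f \<Longrightarrow> Cinf_on T g \<Longrightarrow> Cinf_on S (\<lambda>x. g (f x))"
  unfolding Cinf_on_def by (auto intro: Ck_on_compose)

lemma Cinf_on_linear_compose:
  assumes "open S" "bounded_linear l" "Cinf_on S f"
  shows "Cinf_on S (\<lambda>x. l (f x))"
proof -
  have "bounded_bilinear (\<lambda>(a::real) x. a *\<^sub>R l x)"
    using bounded_bilinear.comp[OF bounded_bilinear_scaleR bounded_linear_ident assms(2)] by simp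
  from Cinf_on_bilinear[OF assms(1) this Cinf_on_const[OF assms(1), of 1] assms(3)] show ?thesis by simp
qed

lemma Cinf_on_minus: "open S \<Longrightarrow> Cinf_on S h \<Longrightarrow> Cinf_on S (\<lambda>x. - h x)"
  by (rule Cinf_on_linear_compose[OF _ bounded_linear_minus[OF bounded_linear_ident]])

lemma Cinf_on_diff: "open S \<Longrightarrow> Cinf_on S h \<Longrightarrow> Cinf_on S h' \<Longrightarrow> Cinf_on S (\<lambda>x. h x - h' x)"
  using Cinf_on_add[of S h "\<lambda>x. - h' x"] Cinf_on_minus[of S h'] by simp

lemmas Cinf_on_mult = Cinf_on_bilinear[OF _ bounded_bilinear_mult]
lemmas Cinf_on_scaleR = Cinf_on_bilinear[OF _ bounded_bilinear_scaleR]
lemmas Cinf_on_inner = Cinf_on_bilinear[OF _ bounded_bilinear_inner]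

lemma Cinf_on_Pair:
  fixes f :: "'a::real_normed_vector \<Rightarrow> 'b::real_normed_vector" and g :: "'a \<Rightarrow> 'c::real_normed_vector"
  assumes S: "open S" and f: "Cinf_on S f" and g: "Cinf_on S g"
  shows "Cinf_on S (\<lambda>x. (f x, g x))"
proof -
  have l1: "bounded_linear (\<lambda>x::'b. (x, 0::'c))" and l2: "bounded_linear (\<lambda>x::'c. (0::'b, x))"
    by (auto intro: bounded_linear_Pair bounded_linear_ident bounded_linear_zero)
  have "Cinf_on S (\<lambda>x. (f x, 0) + (0, g x))"
    by (intro Cinf_on_add S Cinf_on_linear_compose[OF S l1 f] Cinf_on_linear_compose[OF S l2 g])
  then show ?thesis by simp
qed

lemma Cinf_on_continuous_on: "open S \<Longrightarrow> Cinf_on S f \<Longrightarrow> continuous_on S f"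
  unfolding Cinf_on_def using Ck_on_imp_continuous_on by blast

lemma Cinf_on_has_derivative:
  "open S \<Longrightarrow> Cinf_on S f \<Longrightarrow> x \<in> S \<Longrightarrow> (f has_derivative frechet_derivative f (at x)) (at x)"
  unfolding Cinf_on_def using Ck_on.simps(2)[of 0 S f]
  by (metis differentiable_on_eq_differentiable_at frechet_derivative_works)

lemma Cinf_on_frechet_derivative:
  "Cinf_on S f \<Longrightarrow> Cinf_on S (\<lambda>x. frechet_derivative f (at x) v)"
  unfolding Cinf_on_def by (metis Ck_on.simps(2))

lemma Cinf_on_frechet_derivative_apply:
  fixes f :: "'a::euclidean_space \<Rightarrow> 'b::real_normed_vector"
  assumes S: "open S" and f: "Cinf_on S f" and v: "Cinf_on S v"
  shows "Cinf_on S (\<lambda>x. frechet_derivative f (at x) (v x))"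
proof (rule Cinf_on_cong[OF S])
  have "Ck_on k S (\<lambda>x. \<Sum>b\<in>Basis. (v x \<bullet> b) *\<^sub>R frechet_derivative f (at x) b)" for k
    using Cinf_on_scaleR[OF S Cinf_on_inner[OF S v Cinf_on_const[OF S]] Cinf_on_frechet_derivative[OF f]]
    by (intro Ck_on_sum S) (simp add: Cinf_on_def)
  then show "Cinf_on S (\<lambda>x. \<Sum>b\<in>Basis. (v x \<bullet> b) *\<^sub>R frechet_derivative f (at x) b)"
    by (simp add: Cinf_on_def)
  fix x assume "x \<in> S"
  then have lin: "linear (frechet_derivative f (at x))"
    using Cinf_on_has_derivative[OF S f] has_derivative_linear by blast
  have "frechet_derivative f (at x) (v x) = frechet_derivative f (at x) (\<Sum>b\<in>Basis. (v x \<bullet> b) *\<^sub>R b)"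
    by (simp add: euclidean_representation)
  then show "(\<Sum>b\<in>Basis. (v x \<bullet> b) *\<^sub>R frechet_derivative f (at x) b) = frechet_derivative f (at x) (v x)"
    by (simp add: linear_sum[OF lin] linear_scale[OF lin])
qed

text \<open>Bootstrapping: \<open>Y \<circ> \<eta>\<close> is as often differentiable as \<open>\<eta>\<close>, and it is the derivative of \<open>\<eta>\<close>.\<close>

lemma Cinf_on_integral_curve:
  fixes \<eta> :: "real \<Rightarrow> 'a::euclidean_space"
  assumes S: "open S" and T: "open T" and "\<eta> ` S \<subseteq> T" and Y: "Cinf_on T Y"
    and ode: "\<And>s. s \<in> S \<Longrightarrow> (\<eta> has_vector_derivative Y (\<eta> s)) (at s)"
  shows "Cinf_on S \<eta>"
proof -
  have "Ck_on k S \<eta>" for k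
  proof (induction k)
    case 0
    then show ?case
      using ode by (auto intro!: continuous_at_imp_continuous_on has_vector_derivative_continuous)
  next
    case (Suc k)
    have "Ck_on k S (\<lambda>s. Y (\<eta> s))"
      using Ck_on_compose[OF S T assms(3) Suc, of Y] Y unfolding Cinf_on_def by blast
    then show ?case using Ck_on_SucI_real[OF S ode] by blast
  qed
  then show ?thesis by (simp add: Cinf_on_def)
qed

lemma Cinf_on_exp: "open S \<Longrightarrow> Cinf_on S (exp :: real \<Rightarrow> real)"
proof -
  assume S: "open S"
  have "Ck_on k S (exp :: real \<Rightarrow> real)" for k
    by (induction k)
       (auto intro!: Ck_on_SucI_real[OF S] continuous_intros DERIV_exp simp: has_real_derivative_iff_has_vector_derivative[symmetric])
  then show ?thesis by (simp add: Cinf_on_def)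
qed

lemma Cinf_on_inverse: "Cinf_on (- {0}) (inverse :: real \<Rightarrow> real)"
proof -
  have S: "open (- {0::real})" by auto
  have "Ck_on k (- {0}) (inverse :: real \<Rightarrow> real)" for k
  proof (induction k)
    case 0
    then show ?case by (auto intro!: continuous_intros)
  next
    case (Suc k)
    have "Ck_on k (- {0}) (\<lambda>x::real. (-1) * (inverse x * inverse x))"
      by (intro Ck_on_bilinear[OF S bounded_bilinear_mult] Ck_on_const[OF S] Suc)
    then have "Ck_on k (- {0}) (\<lambda>x::real. - (inverse x ^ Suc (Suc 0)))" by (simp add: power2_eq_square)
    then show ?case
      by (rule Ck_on_SucI_real[OF S, rotated])
         (auto intro!: DERIV_inverse simp: has_real_derivative_iff_has_vector_derivative[symmetric] simp del: power_Suc)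
  qed
  then show ?thesis by (simp add: Cinf_on_def)
qed

section \<open>A smooth minimum\<close>

definition flat :: "real \<Rightarrow> real" where
  "flat t = (if t \<le> 0 then 0 else exp (- inverse t))"

text \<open>The functions below are closed under differentiation, which gives the smoothness of
  \<^const>\<open>flat\<close> at \<open>0\<close>.\<close>

definition flat_pow :: "nat \<Rightarrow> real \<Rightarrow> real" where
  "flat_pow n t = (if t \<le> 0 then 0 else inverse t ^ n * exp (- inverse t))"

lemma flat_pow_0: "flat_pow 0 = flat"
  by (auto simp: flat_pow_def flat_def fun_eq_iff)

lemma flat_pow_tendsto_0: "(flat_pow n \<longlongrightarrow> 0) (at_right 0)"
proof -
  have "((\<lambda>x::real. x ^ n / exp x) \<longlongrightarrow> 0) at_top" by (rule tendsto_power_div_exp_0)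
  then have "((\<lambda>t::real. inverse t ^ n / exp (inverse t)) \<longlongrightarrow> 0) (at_right 0)"
    using filterlim_compose[OF _ filterlim_inverse_at_top_right] by blast
  moreover have "\<forall>\<^sub>F t in at_right 0. inverse t ^ n / exp (inverse t) = flat_pow n t"
    by (auto simp: eventually_at_filter flat_pow_def exp_minus field_simps)
  ultimately show ?thesis by (rule Lim_transform_eventually)
qed

lemma flat_pow_deriv:
  "(flat_pow n has_real_derivative (flat_pow (n + 2) t - n * flat_pow (n + 1) t)) (at t)"
proof -
  consider "t < 0" | "t = 0" | "t > 0" by linarith
  then show ?thesis
  proof cases
    case 1
    have "((\<lambda>_. 0) has_real_derivative 0) (at t)" by simp
    then have "(flat_pow n has_real_derivative 0) (at t)"
      by (rule DERIV_cong_ev[THEN iffD1, rotated -1, OF _ refl _ refl])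
         (use 1 in \<open>auto simp: flat_pow_def intro!: eventually_mono[OF eventually_nhds_in_open[of "{..<0}"]]\<close>)
    then show ?thesis using 1 by (simp add: flat_pow_def)
  next
    case 2
    have "((\<lambda>h. (flat_pow n h - flat_pow n 0) / (h - 0)) \<longlongrightarrow> 0) (at_left 0)"
      by (rule tendsto_eventually) (auto simp: eventually_at_filter flat_pow_def)
    moreover have "((\<lambda>h. (flat_pow n h - flat_pow n 0) / (h - 0)) \<longlongrightarrow> 0) (at_right 0)"
      by (rule Lim_transform_eventually[OF flat_pow_tendsto_0[of "Suc n"]])
         (auto simp: eventually_at_filter flat_pow_def field_simps)
    ultimately show ?thesis
      using 2 by (auto simp: has_field_derivative_iff filterlim_split_at flat_pow_def)
  next
    case 3
    have "((\<lambda>t. inverse t ^ n * exp (- inverse t)) has_real_derivative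
        (flat_pow (n + 2) t - n * flat_pow (n + 1) t)) (at t)"
    proof (cases n)
      case 0
      then show ?thesis
        using 3 by (auto intro!: derivative_eq_intros simp: flat_pow_def power2_eq_square)
    next
      case (Suc m)
      have "((\<lambda>t. inverse t ^ Suc m * exp (- inverse t)) has_real_derivative
          inverse t ^ Suc m * (exp (- inverse t) * inverse t ^ 2)
          + (real (Suc m) * inverse t ^ m * - (inverse t ^ 2)) * exp (- inverse t)) (at t)"
      proof -
        have i: "(inverse has_real_derivative - (inverse t ^ 2)) (at t)"
          using DERIV_inverse[of t] 3 by (simp add: numeral_2_eq_2)
        have "((\<lambda>t. exp (- inverse t)) has_real_derivative exp (- inverse t) * inverse t ^ 2) (at t)"
          using DERIV_fun_exp[OF DERIV_minus[OF i]] by simp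
        from DERIV_mult[OF DERIV_power_Suc[OF i] this] show ?thesis by (simp add: algebra_simps)
      qed
      then show ?thesis using 3 Suc by (simp add: flat_pow_def algebra_simps power2_eq_square)
    qed
    then show ?thesis
      by (rule DERIV_cong_ev[THEN iffD1, rotated -1, OF _ refl _ refl])
         (use 3 in \<open>auto simp: flat_pow_def intro!: eventually_mono[OF eventually_nhds_in_open[of "{0<..}"]]\<close>)
  qed
qed

lemma Cinf_on_flat: "Cinf_on UNIV flat"
proof -
  have "Ck_on k UNIV (flat_pow n)" for k n
  proof (induction k arbitrary: n)
    case 0
    have "isCont (flat_pow n) t" for t using flat_pow_deriv by (rule DERIV_isCont)
    then show ?case by (simp add: continuous_at_imp_continuous_on)
  next
    case (Suc k)
    have "Ck_on k UNIV (\<lambda>t. flat_pow (n + 2) t + (- real n) * flat_pow (n + 1) t)"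
      by (intro Ck_on_add Ck_on_bilinear[OF _ bounded_bilinear_mult] Ck_on_const open_UNIV Suc)
    then show ?case
      by (rule Ck_on_SucI_real[OF open_UNIV, rotated])
         (use flat_pow_deriv in \<open>auto simp: has_real_derivative_iff_has_vector_derivative[symmetric]\<close>)
  qed
  then show ?thesis by (metis Cinf_on_def flat_pow_0)
qed

lemma flat_nonneg: "0 \<le> flat t" and flat_pos: "0 < t \<Longrightarrow> 0 < flat t" and flat_eq_0: "t \<le> 0 \<Longrightarrow> flat t = 0"
  by (auto simp: flat_def)

lemma flat_mono: "s \<le> t \<Longrightarrow> flat s \<le> flat t"
  by (auto simp: flat_def)

text \<open>A smooth substitute for the positive part, chosen because its slope lies between \<open>0\<close> and \<open>1\<close>:
  for \<open>x = 1 / t\<close> the slope is \<open>(1 + x) exp (- x)\<close>.\<close>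

definition ramp :: "real \<Rightarrow> real" where
  "ramp t = t * flat t"

definition ramp_slope :: "real \<Rightarrow> real" where
  "ramp_slope t = (if t \<le> 0 then 0 else (1 + inverse t) * exp (- inverse t))"

lemma Cinf_on_ramp: "Cinf_on UNIV ramp"
  unfolding ramp_def by (intro Cinf_on_mult open_UNIV Cinf_on_flat Cinf_on_linear bounded_linear_ident)

lemma ramp_eq_0: "t \<le> 0 \<Longrightarrow> ramp t = 0"
  by (simp add: ramp_def flat_def)

lemma ramp_deriv: "(ramp has_real_derivative ramp_slope t) (at t)"
proof -
  have "(flat has_real_derivative flat_pow 2 t) (at t)"
    using flat_pow_deriv[of 0 t] by (simp add: flat_pow_0 numeral_2_eq_2)
  from DERIV_mult[OF DERIV_ident this]
  have "((\<lambda>t. t * flat t) has_real_derivative 1 * flat t + flat_pow 2 t * t) (at t)" .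
  moreover have "1 * flat t + flat_pow 2 t * t = ramp_slope t"
    by (auto simp: ramp_slope_def flat_def flat_pow_def power2_eq_square algebra_simps)
  ultimately have "((\<lambda>t. t * flat t) has_real_derivative ramp_slope t) (at t)" by simp
  then show ?thesis by (simp add: ramp_def[abs_def])
qed

lemma ramp_slope_bounds: "0 \<le> ramp_slope t" "ramp_slope t \<le> 1"
proof -
  show "0 \<le> ramp_slope t" by (auto simp: ramp_slope_def)
  have "(1 + inverse t) * exp (- inverse t) \<le> exp (inverse t) * exp (- inverse t)"
    by (intro mult_right_mono exp_ge_add_one_self) auto
  then show "ramp_slope t \<le> 1" by (auto simp: ramp_slope_def exp_minus_inverse)
qed

lemma ramp_nonneg: "0 \<le> ramp t"
  by (auto simp: ramp_def flat_def)

lemma ramp_lower: "t - 1 \<le> ramp t"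
proof (cases "t \<le> 0")
  case False
  then have "t * (1 - inverse t) \<le> t * exp (- inverse t)"
    using exp_ge_add_one_self[of "- inverse t"] by (intro mult_left_mono) auto
  with False show ?thesis by (simp add: ramp_def flat_def algebra_simps)
qed (simp add: ramp_eq_0)

lemma ramp_mono: "s \<le> t \<Longrightarrow> ramp s \<le> ramp t"
  by (rule DERIV_nonneg_imp_nondecreasing) (use ramp_deriv ramp_slope_bounds in blast)+

lemma ramp_pos: "0 < t \<Longrightarrow> 0 < ramp t"
  by (simp add: ramp_def flat_pos)

definition smin :: "real \<Rightarrow> real \<Rightarrow> real \<Rightarrow> real" where
  "smin d a b = a - d * ramp ((a - b) / d)"

lemma smin_eq_left: "0 < d \<Longrightarrow> a \<le> b \<Longrightarrow> smin d a b = a"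
  by (simp add: smin_def ramp_eq_0 divide_nonpos_pos)

lemma smin_le_left: "0 < d \<Longrightarrow> smin d a b \<le> a"
  by (simp add: smin_def ramp_nonneg)

lemma smin_le_right:
  assumes "0 < d"
  shows "smin d a b \<le> b + d"
proof -
  have "d * ((a - b) / d - 1) \<le> d * ramp ((a - b) / d)"
    using assms by (intro mult_left_mono ramp_lower) auto
  moreover have "d * ((a - b) / d - 1) = a - b - d" using assms by (simp add: field_simps)
  ultimately show ?thesis by (simp add: smin_def)
qed

text \<open>The smooth minimum of \<open>a\<close> and \<open>a - H'\<close> is \<open>a - H' exp (- d / H')\<close>, so \<open>d\<close> can be tuned to any
  smaller drop \<open>H\<close>.\<close>

lemma smin_shift:
  assumes "0 < H" "H < H'"
  shows "0 < H' * ln (H' / H)" and "smin (H' * ln (H' / H)) a (a - H') = a - H"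
proof -
  have pos: "0 < ln (H' / H)" using assms by simp
  then show "0 < H' * ln (H' / H)" using assms by simp
  have "ln (H' / H) * ramp (1 / ln (H' / H)) = H / H'"
    using pos assms by (simp add: ramp_def flat_def exp_minus)
  then show "smin (H' * ln (H' / H)) a (a - H') = a - H"
    using assms by (simp add: smin_def field_simps)
qed

definition smooth_step :: "real \<Rightarrow> real" where
  "smooth_step t = flat t * inverse (flat t + flat (1 - t))"

lemma smooth_step_denom: "0 < flat t + flat (1 - t)"
  using flat_pos[of t] flat_pos[of "1 - t"] flat_nonneg[of t] flat_nonneg[of "1 - t"] by linarith

lemma Cinf_on_smooth_step: "Cinf_on UNIV smooth_step"
proof -
  have "Cinf_on UNIV (\<lambda>t. flat (1 - t))"
    by (intro Cinf_on_compose[OF _ _ _ _ Cinf_on_flat] Cinf_on_diff Cinf_on_const Cinf_on_linear bounded_linear_ident) auto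
  then have "Cinf_on UNIV (\<lambda>t. flat t + flat (1 - t))"
    by (intro Cinf_on_add Cinf_on_flat open_UNIV)
  then have "Cinf_on UNIV (\<lambda>t. inverse (flat t + flat (1 - t)))"
    by (intro Cinf_on_compose[where T = "- {0::real}", OF _ _ _ _ Cinf_on_inverse])
       (use smooth_step_denom in \<open>auto simp: less_le\<close>)
  then show ?thesis unfolding smooth_step_def by (intro Cinf_on_mult Cinf_on_flat open_UNIV)
qed

lemma smooth_step_eq_0: "t \<le> 0 \<Longrightarrow> smooth_step t = 0"
  and smooth_step_eq_1: "1 \<le> t \<Longrightarrow> smooth_step t = 1"
  using smooth_step_denom[of t] by (auto simp: smooth_step_def flat_eq_0)

lemma smooth_step_bounds: "0 \<le> smooth_step t" "smooth_step t \<le> 1"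
proof -
  show "0 \<le> smooth_step t"
    unfolding smooth_step_def by (intro mult_nonneg_nonneg flat_nonneg less_imp_le[OF positive_imp_inverse_positive] smooth_step_denom)
  have "flat t / (flat t + flat (1 - t)) \<le> 1"
    using smooth_step_denom[of t] flat_nonneg[of "1 - t"] by (subst pos_divide_le_eq) auto
  then show "smooth_step t \<le> 1" unfolding smooth_step_def divide_inverse .
qed

lemma smooth_step_mono:
  assumes "s \<le> t"
  shows "smooth_step s \<le> smooth_step t"
proof -
  have "flat s * flat (1 - t) \<le> flat t * flat (1 - s)"
    using assms by (intro mult_mono flat_mono flat_nonneg) auto
  then have "flat s * (flat t + flat (1 - t)) \<le> flat t * (flat s + flat (1 - s))"
    by (simp add: distrib_left mult.commute)
  then have "flat s / (flat s + flat (1 - s)) \<le> flat t / (flat t + flat (1 - t))"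
    by (subst frac_le_eq) (use smooth_step_denom[of s] smooth_step_denom[of t] in \<open>auto simp: less_le divide_le_0_iff mult_le_0_iff zero_le_mult_iff\<close>)
  then show ?thesis unfolding smooth_step_def divide_inverse .
qed

section \<open>Smooth functions in charts\<close>

lemma is_chartD:
  assumes "is_chart \<kappa>"
  shows "open (domain \<kappa>)" "subspace (model \<kappa>)" "openin (top_of_set (model \<kappa>)) (codomain \<kappa>)"
    "continuous_on (domain \<kappa>) (coord \<kappa>)" "continuous_on (codomain \<kappa>) (chart_inv \<kappa>)"
    "x \<in> domain \<kappa> \<Longrightarrow> coord \<kappa> x \<in> codomain \<kappa>" "x \<in> domain \<kappa> \<Longrightarrow> chart_inv \<kappa> (coord \<kappa> x) = x"
    "y \<in> codomain \<kappa> \<Longrightarrow> chart_inv \<kappa> y \<in> domain \<kappa>" "y \<in> codomain \<kappa> \<Longrightarrow> coord \<kappa> (chart_inv \<kappa> y) = y"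
    "codomain \<kappa> \<subseteq> model \<kappa>"
proof -
  have h: "homeomorphism (domain \<kappa>) (codomain \<kappa>) (coord \<kappa>) (chart_inv \<kappa>)"
    and o: "openin (top_of_set (model \<kappa>)) (codomain \<kappa>)"
    using assms by (simp_all add: is_chart_def)
  show "open (domain \<kappa>)" "subspace (model \<kappa>)" "openin (top_of_set (model \<kappa>)) (codomain \<kappa>)"
    using assms by (simp_all add: is_chart_def)
  show "codomain \<kappa> \<subseteq> model \<kappa>" using openin_imp_subset[OF o] .
  show "x \<in> domain \<kappa> \<Longrightarrow> coord \<kappa> x \<in> codomain \<kappa>" by (simp add: codomain_def)
  show "continuous_on (domain \<kappa>) (coord \<kappa>)" "continuous_on (codomain \<kappa>) (chart_inv \<kappa>)"
    "x \<in> domain \<kappa> \<Longrightarrow> chart_inv \<kappa> (coord \<kappa> x) = x" "y \<in> codomain \<kappa> \<Longrightarrow> coord \<kappa> (chart_inv \<kappa> y) = y"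
    "y \<in> codomain \<kappa> \<Longrightarrow> chart_inv \<kappa> y \<in> domain \<kappa>"
    using h unfolding homeomorphism_def by blast+
qed

lemma codomain_eq_model_Int:
  assumes "is_chart \<kappa>"
  obtains T where "open T" "codomain \<kappa> = model \<kappa> \<inter> T"
  using is_chartD(3)[OF assms] by (auto simp: openin_open)

lemma chart_inv_preimage_open:
  assumes "is_chart \<kappa>" "open G"
  obtains T where "open T" "\<And>y. y \<in> codomain \<kappa> \<Longrightarrow> y \<in> T \<longleftrightarrow> chart_inv \<kappa> y \<in> G"
proof -
  from is_chartD(5)[OF assms(1)] assms(2) obtain T where "open T" "T \<inter> codomain \<kappa> = chart_inv \<kappa> -` G \<inter> codomain \<kappa>"
    unfolding continuous_on_open_invariant by blast
  then show thesis using that[of T] by blast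
qed

lemma coord_preimage_open:
  assumes "is_chart \<kappa>" "open T"
  shows "open {x \<in> domain \<kappa>. coord \<kappa> x \<in> T}"
proof -
  have "open (coord \<kappa> -` T \<inter> domain \<kappa>)"
    using is_chartD(4)[OF assms(1)] is_chartD(1)[OF assms(1)] assms(2) continuous_on_open_vimage by blast
  then show ?thesis by (simp add: vimage_def Int_def conj_commute)
qed

definition smooth_in :: "('v::topological_space, 'e::euclidean_space) chart \<Rightarrow> ('v \<Rightarrow> 'b::real_normed_vector) \<Rightarrow> 'v \<Rightarrow> bool" where
  "smooth_in \<kappa> h x \<longleftrightarrow> (\<exists>T g. open T \<and> coord \<kappa> x \<in> T \<and> Cinf_on T g \<and>
     (\<forall>y\<in>codomain \<kappa> \<inter> T. g y = h (chart_inv \<kappa> y)))"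

lemma smooth_function_iff:
  assumes "\<And>\<kappa>. \<kappa> \<in> A \<Longrightarrow> is_chart \<kappa>"
  shows "smooth_function A h \<longleftrightarrow> (\<forall>\<kappa>\<in>A. \<forall>x\<in>domain \<kappa>. smooth_in \<kappa> h x)"
  unfolding smooth_function_def smooth_on_def smooth_in_def Cinf_on_def codomain_def by simp

lemma smooth_inE:
  assumes "smooth_in \<kappa> h x"
  obtains T g where "open T" "coord \<kappa> x \<in> T" "Cinf_on T g" "\<And>y. y \<in> codomain \<kappa> \<Longrightarrow> y \<in> T \<Longrightarrow> g y = h (chart_inv \<kappa> y)"
  using assms unfolding smooth_in_def by blast

lemma smooth_in_cong:
  assumes \<kappa>: "is_chart \<kappa>" and x: "x \<in> domain \<kappa>" and G: "open G" "x \<in> G"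
    and eq: "\<And>y. y \<in> G \<Longrightarrow> h y = k y" and h: "smooth_in \<kappa> h x"
  shows "smooth_in \<kappa> k x"
proof -
  obtain S where S: "open S" "\<And>y. y \<in> codomain \<kappa> \<Longrightarrow> y \<in> S \<longleftrightarrow> chart_inv \<kappa> y \<in> G"
    using chart_inv_preimage_open[OF \<kappa> G(1)] by blast
  obtain T g where g: "open T" "coord \<kappa> x \<in> T" "Cinf_on T g" "\<And>y. y \<in> codomain \<kappa> \<Longrightarrow> y \<in> T \<Longrightarrow> g y = h (chart_inv \<kappa> y)"
    using smooth_inE[OF h] by blast
  show ?thesis
    unfolding smooth_in_def
    by (rule exI[of _ "T \<inter> S"], rule exI[of _ g])
       (use S g G eq is_chartD[OF \<kappa>] x in \<open>auto intro: Cinf_on_subset\<close>)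
qed

lemma smooth_in_const: "smooth_in \<kappa> (\<lambda>x. c) x"
  unfolding smooth_in_def by (rule exI[of _ UNIV], rule exI[of _ "\<lambda>x. c"]) (auto intro: Cinf_on_const)

lemma smooth_in_Pair:
  assumes "smooth_in \<kappa> h x" "smooth_in \<kappa> k x"
  shows "smooth_in \<kappa> (\<lambda>x. (h x, k x)) x"
proof -
  obtain T g where g: "open T" "coord \<kappa> x \<in> T" "Cinf_on T g" "\<And>y. y \<in> codomain \<kappa> \<Longrightarrow> y \<in> T \<Longrightarrow> g y = h (chart_inv \<kappa> y)"
    using smooth_inE[OF assms(1)] by blast
  obtain T' g' where g': "open T'" "coord \<kappa> x \<in> T'" "Cinf_on T' g'" "\<And>y. y \<in> codomain \<kappa> \<Longrightarrow> y \<in> T' \<Longrightarrow> g' y = k (chart_inv \<kappa> y)"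
    using smooth_inE[OF assms(2)] by blast
  have "Cinf_on (T \<inter> T') (\<lambda>y. (g y, g' y))"
    using g g' by (intro Cinf_on_Pair) (auto intro: Cinf_on_subset)
  then show ?thesis
    unfolding smooth_in_def
    by (intro exI[of _ "T \<inter> T'"] exI[of _ "\<lambda>y. (g y, g' y)"]) (use g g' in auto)
qed

lemma smooth_in_compose:
  fixes h :: "'v::topological_space \<Rightarrow> 'b::euclidean_space"
  assumes "smooth_in \<kappa> h x" and S: "open S" "Cinf_on S \<phi>" and hx: "x \<in> domain \<kappa>" "h x \<in> S" and \<kappa>: "is_chart \<kappa>"
  shows "smooth_in \<kappa> (\<lambda>x. \<phi> (h x)) x"
proof -
  obtain T g where g: "open T" "coord \<kappa> x \<in> T" "Cinf_on T g" "\<And>y. y \<in> codomain \<kappa> \<Longrightarrow> y \<in> T \<Longrightarrow> g y = h (chart_inv \<kappa> y)"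
    using smooth_inE[OF assms(1)] by blast
  have o: "open (g -` S \<inter> T)"
    using continuous_on_open_vimage[OF g(1)] Cinf_on_continuous_on[OF g(1,3)] S(1) by blast
  have "Cinf_on (g -` S \<inter> T) (\<lambda>y. \<phi> (g y))"
    by (rule Cinf_on_compose[OF o S(1) _ _ S(2)]) (use g o in \<open>auto intro: Cinf_on_subset\<close>)
  moreover have "g (coord \<kappa> x) = h x" using g(2,4) is_chartD[OF \<kappa>] hx by simp
  ultimately show ?thesis
    unfolding smooth_in_def
    by (intro exI[of _ "g -` S \<inter> T"] exI[of _ "\<lambda>y. \<phi> (g y)"]) (use g hx o in auto)
qed

lemma smooth_in_compose2:
  fixes h k :: "'v::topological_space \<Rightarrow> real"
  assumes "smooth_in \<kappa> h x" "smooth_in \<kappa> k x" and "Cinf_on UNIV (\<lambda>(a, b). \<phi> a b)" "x \<in> domain \<kappa>" "is_chart \<kappa>"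
  shows "smooth_in \<kappa> (\<lambda>x. \<phi> (h x) (k x)) x"
  using smooth_in_compose[OF smooth_in_Pair[OF assms(1,2)] open_UNIV assms(3,4) UNIV_I assms(5)] by simp

lemma Cinf_on_fst: "open S \<Longrightarrow> Cinf_on S fst" and Cinf_on_snd: "open S \<Longrightarrow> Cinf_on S snd"
  by (auto intro: Cinf_on_linear bounded_linear_fst bounded_linear_snd)

lemma smooth_in_arith:
  fixes h k :: "'v::topological_space \<Rightarrow> real"
  assumes "smooth_in \<kappa> h x" "smooth_in \<kappa> k x" "x \<in> domain \<kappa>" "is_chart \<kappa>"
  shows "smooth_in \<kappa> (\<lambda>x. h x + k x) x" and "smooth_in \<kappa> (\<lambda>x. h x * k x) x"
    and "smooth_in \<kappa> (\<lambda>x. h x - k x) x"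
proof -
  note c = smooth_in_compose2[OF assms(1,2) _ assms(3,4)]
  note s = case_prod_unfold Cinf_on_add Cinf_on_mult Cinf_on_diff Cinf_on_fst Cinf_on_snd
  show "smooth_in \<kappa> (\<lambda>x. h x + k x) x" by (rule c) (simp add: s)
  show "smooth_in \<kappa> (\<lambda>x. h x * k x) x" by (rule c) (simp add: s)
  show "smooth_in \<kappa> (\<lambda>x. h x - k x) x" by (rule c) (simp add: s)
qed

lemma smooth_in_smin:
  fixes h k :: "'v::topological_space \<Rightarrow> real"
  assumes "smooth_in \<kappa> h x" "smooth_in \<kappa> k x" "x \<in> domain \<kappa>" "is_chart \<kappa>"
  shows "smooth_in \<kappa> (\<lambda>x. smin d (h x) (k x)) x"
proof (rule smooth_in_compose2[OF assms(1,2) _ assms(3,4)])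
  have "Cinf_on UNIV (\<lambda>x::real \<times> real. (fst x - snd x) * inverse d)"
    by (intro Cinf_on_mult Cinf_on_diff Cinf_on_const Cinf_on_fst Cinf_on_snd open_UNIV)
  then have "Cinf_on UNIV (\<lambda>x::real \<times> real. ramp ((fst x - snd x) * inverse d))"
    by (intro Cinf_on_compose[OF _ _ _ _ Cinf_on_ramp]) auto
  then have "Cinf_on UNIV (\<lambda>x::real \<times> real. fst x - d * ramp ((fst x - snd x) * inverse d))"
    by (intro Cinf_on_mult Cinf_on_diff Cinf_on_const Cinf_on_fst open_UNIV)
  then show "Cinf_on UNIV (\<lambda>(a, b). smin d a b)" by (simp add: smin_def case_prod_unfold divide_inverse)
qed

subsection \<open>Directional derivatives\<close>

lemma line_eventually_in_codomain:
  assumes \<kappa>: "is_chart \<kappa>" and x: "x \<in> domain \<kappa>" and X: "X \<in> model \<kappa>" and T: "open T" "coord \<kappa> x \<in> T"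
  shows "\<forall>\<^sub>F t in nhds (0::real). coord \<kappa> x + t *\<^sub>R X \<in> codomain \<kappa> \<inter> T"
proof -
  obtain S where S: "open S" "codomain \<kappa> = model \<kappa> \<inter> S" using codomain_eq_model_Int[OF \<kappa>] by blast
  have "((\<lambda>t::real. coord \<kappa> x + t *\<^sub>R X) \<longlongrightarrow> coord \<kappa> x + 0 *\<^sub>R X) (nhds 0)"
    by (intro tendsto_intros filterlim_ident)
  then have "\<forall>\<^sub>F t in nhds (0::real). coord \<kappa> x + t *\<^sub>R X \<in> S \<inter> T"
    by (rule topological_tendstoD) (use S T is_chartD(6)[OF \<kappa> x] in auto)
  moreover have "coord \<kappa> x + t *\<^sub>R X \<in> model \<kappa>" for t
    using is_chartD(2)[OF \<kappa>] is_chartD(6)[OF \<kappa> x] S X by (auto intro: subspace_add subspace_scale)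
  ultimately show ?thesis using S by (auto elim: eventually_mono)
qed

lemma has_dir_deriv:
  assumes \<kappa>: "is_chart \<kappa>" and x: "x \<in> domain \<kappa>" and X: "X \<in> model \<kappa>"
    and g: "open T" "coord \<kappa> x \<in> T" "Cinf_on T g" "\<And>y. y \<in> codomain \<kappa> \<Longrightarrow> y \<in> T \<Longrightarrow> g y = h (chart_inv \<kappa> y)"
  shows "((\<lambda>t. (h \<circ> chart_inv \<kappa>) (coord \<kappa> x + t *\<^sub>R X)) has_vector_derivative frechet_derivative g (at (coord \<kappa> x)) X) (at 0)"
    and "dir_deriv (h \<circ> chart_inv \<kappa>) (coord \<kappa> x) X = frechet_derivative g (at (coord \<kappa> x)) X"
proof -
  have "((\<lambda>t. coord \<kappa> x + t *\<^sub>R X) has_vector_derivative X) (at 0)"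
    by (auto intro!: derivative_eq_intros)
  then have "(g \<circ> (\<lambda>t. coord \<kappa> x + t *\<^sub>R X) has_vector_derivative frechet_derivative g (at (coord \<kappa> x)) X) (at 0)"
    using vector_derivative_diff_chain_within[of _ X 0 UNIV g "frechet_derivative g (at (coord \<kappa> x))"]
      Cinf_on_has_derivative[OF g(1,3,2)] has_derivative_at_withinI by fastforce
  moreover have "\<forall>\<^sub>F t in nhds (0::real). (g \<circ> (\<lambda>t. coord \<kappa> x + t *\<^sub>R X)) t = (h \<circ> chart_inv \<kappa>) (coord \<kappa> x + t *\<^sub>R X)"
    using line_eventually_in_codomain[OF \<kappa> x X g(1,2)] by (rule eventually_mono) (use g(4) in auto)
  ultimately show *: "((\<lambda>t. (h \<circ> chart_inv \<kappa>) (coord \<kappa> x + t *\<^sub>R X)) has_vector_derivative frechet_derivative g (at (coord \<kappa> x)) X) (at 0)"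
    unfolding eventually_nhds by (blast intro: has_vector_derivative_transform_within_open)
  then show "dir_deriv (h \<circ> chart_inv \<kappa>) (coord \<kappa> x) X = frechet_derivative g (at (coord \<kappa> x)) X"
    unfolding dir_deriv_def by (rule vector_derivative_at)
qed

lemma has_chart_deriv:
  assumes "is_chart \<kappa>" "x \<in> domain \<kappa>" "X \<in> model \<kappa>" "smooth_in \<kappa> h x"
  shows "((\<lambda>t. h (chart_inv \<kappa> (coord \<kappa> x + t *\<^sub>R X))) has_real_derivative chart_deriv \<kappa> h x X) (at 0)"
proof -
  obtain T g where g: "open T" "coord \<kappa> x \<in> T" "Cinf_on T g" "\<And>y. y \<in> codomain \<kappa> \<Longrightarrow> y \<in> T \<Longrightarrow> g y = h (chart_inv \<kappa> y)"
    using smooth_inE[OF assms(4)] by blast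
  from has_dir_deriv[OF assms(1-3) g] show ?thesis
    by (simp add: chart_deriv_def has_real_derivative_iff_has_vector_derivative)
qed

lemma chart_deriv_cong:
  assumes \<kappa>: "is_chart \<kappa>" and x: "x \<in> domain \<kappa>" and X: "X \<in> model \<kappa>" and G: "open G" "x \<in> G"
    and eq: "\<And>y. y \<in> G \<Longrightarrow> h y = k y"
  shows "chart_deriv \<kappa> h x X = chart_deriv \<kappa> k x X"
proof -
  obtain S where S: "open S" "\<And>y. y \<in> codomain \<kappa> \<Longrightarrow> y \<in> S \<longleftrightarrow> chart_inv \<kappa> y \<in> G"
    using chart_inv_preimage_open[OF \<kappa> G(1)] by blast
  have "coord \<kappa> x \<in> S" using S(2) is_chartD[OF \<kappa>] x G by simp
  from line_eventually_in_codomain[OF \<kappa> x X S(1) this]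
  have ev: "\<forall>\<^sub>F t in nhds (0::real). (h \<circ> chart_inv \<kappa>) (coord \<kappa> x + t *\<^sub>R X) = (k \<circ> chart_inv \<kappa>) (coord \<kappa> x + t *\<^sub>R X)"
    by (rule eventually_mono) (use S eq in auto)
  show ?thesis
    unfolding chart_deriv_def dir_deriv_def
    by (rule vector_derivative_cong_eq) (use ev in auto)
qed

lemma chart_deriv_compose:
  assumes "is_chart \<kappa>" "x \<in> domain \<kappa>" "X \<in> model \<kappa>" "smooth_in \<kappa> h x" "(\<phi> has_real_derivative d) (at (h x))"
  shows "chart_deriv \<kappa> (\<lambda>x. \<phi> (h x)) x X = d * chart_deriv \<kappa> h x X"
proof -
  have "((\<lambda>t. \<phi> (h (chart_inv \<kappa> (coord \<kappa> x + t *\<^sub>R X)))) has_real_derivative d * chart_deriv \<kappa> h x X) (at 0)"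
    by (rule DERIV_chain2[OF _ has_chart_deriv[OF assms(1-4)]]) (use assms is_chartD[OF assms(1)] in simp)
  then show ?thesis
    by (simp add: chart_deriv_def dir_deriv_def has_real_derivative_iff_has_vector_derivative o_def vector_derivative_at)
qed

lemma chart_deriv_arith:
  assumes "is_chart \<kappa>" "x \<in> domain \<kappa>" "X \<in> model \<kappa>" "smooth_in \<kappa> h x" "smooth_in \<kappa> k x"
  shows "chart_deriv \<kappa> (\<lambda>x. h x + k x) x X = chart_deriv \<kappa> h x X + chart_deriv \<kappa> k x X"
    and "chart_deriv \<kappa> (\<lambda>x. h x - k x) x X = chart_deriv \<kappa> h x X - chart_deriv \<kappa> k x X"
  using DERIV_add[OF has_chart_deriv[OF assms(1-4)] has_chart_deriv[OF assms(1-3,5)]]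
    DERIV_diff[OF has_chart_deriv[OF assms(1-4)] has_chart_deriv[OF assms(1-3,5)]] is_chartD[OF assms(1)] assms(2)
  by (auto simp: chart_deriv_def[of _ "\<lambda>x. h x + k x"] chart_deriv_def[of _ "\<lambda>x. h x - k x"]
      dir_deriv_def has_real_derivative_iff_has_vector_derivative o_def vector_derivative_at)

text \<open>The coefficients are nonnegative with sum \<open>1\<close>; hence positivity of the derivative along a vector field passes to
  smooth minima.\<close>

lemma chart_deriv_smin:
  assumes "is_chart \<kappa>" "x \<in> domain \<kappa>" "X \<in> model \<kappa>" "smooth_in \<kappa> h x" "smooth_in \<kappa> k x" "0 < d"
  shows "chart_deriv \<kappa> (\<lambda>x. smin d (h x) (k x)) x X =
    (1 - ramp_slope ((h x - k x) / d)) * chart_deriv \<kappa> h x X + ramp_slope ((h x - k x) / d) * chart_deriv \<kappa> k x X"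
proof -
  note D = has_chart_deriv[OF assms(1-4)] has_chart_deriv[OF assms(1-3,5)]
  let ?c = "\<lambda>t. chart_inv \<kappa> (coord \<kappa> x + t *\<^sub>R X)"
  have "((\<lambda>t. (h (?c t) - k (?c t)) / d) has_real_derivative (chart_deriv \<kappa> h x X - chart_deriv \<kappa> k x X) / d) (at 0)"
    by (intro DERIV_cdivide DERIV_diff D)
  from DERIV_chain2[OF ramp_deriv this]
  have D': "((\<lambda>t. h (?c t) - d * ramp ((h (?c t) - k (?c t)) / d)) has_real_derivative
      chart_deriv \<kappa> h x X - d * (ramp_slope ((h (?c 0) - k (?c 0)) / d) * ((chart_deriv \<kappa> h x X - chart_deriv \<kappa> k x X) / d))) (at 0)"
    by (intro DERIV_diff D(1) DERIV_cmult)
  then have "((\<lambda>t. smin d (h (?c t)) (k (?c t))) has_real_derivative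
     (1 - ramp_slope ((h x - k x) / d)) * chart_deriv \<kappa> h x X + ramp_slope ((h x - k x) / d) * chart_deriv \<kappa> k x X) (at 0)"
  proof -
    have "a - d * (r * ((a - b) / d)) = (1 - r) * a + r * b" for a b r :: real
    proof -
      have "d * (r * ((a - b) / d)) = r * (a - b)" using assms(6) by simp
      then show ?thesis by (simp add: algebra_simps)
    qed
    then show ?thesis using D' is_chartD(7)[OF assms(1,2)] by (simp add: smin_def)
  qed
  then show ?thesis
    by (simp add: chart_deriv_def[of _ "\<lambda>x. smin d (h x) (k x)"] dir_deriv_def has_real_derivative_iff_has_vector_derivative o_def vector_derivative_at)
qed

subsection \<open>Change of charts\<close>

lemma smooth_in_coord:
  fixes \<kappa> \<kappa>' :: "('v::topological_space, 'e::euclidean_space) chart"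
  assumes "is_chart \<kappa>" "is_chart \<kappa>'" "smooth_transition \<kappa> \<kappa>'" "x \<in> domain \<kappa>" "x \<in> domain \<kappa>'"
  shows "smooth_in \<kappa> (coord \<kappa>') x"
proof -
  have "coord \<kappa> x \<in> coord \<kappa> ` (domain \<kappa> \<inter> domain \<kappa>')" using assms by auto
  then obtain T g where g: "open T" "coord \<kappa> x \<in> T" "\<forall>k. Ck_on k T g"
    "\<And>y. y \<in> coord \<kappa> ` (domain \<kappa> \<inter> domain \<kappa>') \<inter> T \<Longrightarrow> g y = (coord \<kappa>' \<circ> chart_inv \<kappa>) y"
    using assms(3) unfolding smooth_transition_def smooth_on_def by metis
  obtain S where S: "open S" "\<And>y. y \<in> codomain \<kappa> \<Longrightarrow> y \<in> S \<longleftrightarrow> chart_inv \<kappa> y \<in> domain \<kappa>'"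
    using chart_inv_preimage_open[OF assms(1) is_chartD(1)[OF assms(2)]] by blast
  have "y \<in> coord \<kappa> ` (domain \<kappa> \<inter> domain \<kappa>')" if "y \<in> codomain \<kappa>" "y \<in> S" for y
    using S(2) that is_chartD[OF assms(1)] by (metis IntI image_eqI)
  then show ?thesis
    unfolding smooth_in_def
    by (intro exI[of _ "T \<inter> S"] exI[of _ g])
       (use g S assms is_chartD[OF assms(1)] in \<open>auto simp: Cinf_on_def intro: Ck_on_open_subset\<close>)
qed

lemma change_of_charts:
  fixes \<kappa> \<kappa>' :: "('v::topological_space, 'e::euclidean_space) chart" and h :: "'v \<Rightarrow> 'b::real_normed_vector"
  assumes \<kappa>: "is_chart \<kappa>" and \<kappa>': "is_chart \<kappa>'" and tr: "smooth_transition \<kappa> \<kappa>'" and x: "x \<in> domain \<kappa>" and x': "x \<in> domain \<kappa>'"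
    and h: "smooth_in \<kappa>' h x"
  shows "smooth_in \<kappa> h x"
    and "X \<in> model \<kappa> \<Longrightarrow> dir_deriv (coord \<kappa>' \<circ> chart_inv \<kappa>) (coord \<kappa> x) X \<in> model \<kappa>' \<Longrightarrow>
      dir_deriv (h \<circ> chart_inv \<kappa>) (coord \<kappa> x) X =
      dir_deriv (h \<circ> chart_inv \<kappa>') (coord \<kappa>' x) (dir_deriv (coord \<kappa>' \<circ> chart_inv \<kappa>) (coord \<kappa> x) X)"
proof -
  obtain T g where g: "open T" "coord \<kappa>' x \<in> T" "Cinf_on T g" "\<And>y. y \<in> codomain \<kappa>' \<Longrightarrow> y \<in> T \<Longrightarrow> g y = h (chart_inv \<kappa>' y)"
    using smooth_inE[OF h] by blast
  obtain S \<tau> where \<tau>: "open S" "coord \<kappa> x \<in> S" "Cinf_on S \<tau>" "\<And>y. y \<in> codomain \<kappa> \<Longrightarrow> y \<in> S \<Longrightarrow> \<tau> y = coord \<kappa>' (chart_inv \<kappa> y)"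
    using smooth_inE[OF smooth_in_coord[OF \<kappa> \<kappa>' tr x x']] by blast
  obtain R where R: "open R" "\<And>y. y \<in> codomain \<kappa> \<Longrightarrow> y \<in> R \<longleftrightarrow> chart_inv \<kappa> y \<in> domain \<kappa>'"
    using chart_inv_preimage_open[OF \<kappa> is_chartD(1)[OF \<kappa>']] by blast
  define Q where "Q = (\<tau> -` T \<inter> S) \<inter> R"
  have "open (\<tau> -` T \<inter> S)"
    using continuous_on_open_vimage[OF \<tau>(1)] Cinf_on_continuous_on[OF \<tau>(1,3)] g(1) by blast
  then have Q: "open Q" using R by (simp add: Q_def open_Int)
  have \<tau>x: "\<tau> (coord \<kappa> x) = coord \<kappa>' x" using \<tau> is_chartD[OF \<kappa>] x by simp
  then have xQ: "coord \<kappa> x \<in> Q" using R \<tau> g is_chartD[OF \<kappa>] x x' by (simp add: Q_def)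
  have CQ: "Cinf_on Q \<tau>" using Cinf_on_subset[OF \<tau>(1,3) Q] by (auto simp: Q_def)
  have C: "Cinf_on Q (\<lambda>y. g (\<tau> y))"
    by (rule Cinf_on_compose[OF Q g(1) _ CQ g(3)]) (auto simp: Q_def)
  have eq: "g (\<tau> y) = h (chart_inv \<kappa> y)" if "y \<in> codomain \<kappa>" "y \<in> Q" for y
    using that g(4)[of "\<tau> y"] \<tau>(4)[of y] R(2)[of y] is_chartD[OF \<kappa>'] by (simp add: Q_def)
  from Q xQ C eq show "smooth_in \<kappa> h x" unfolding smooth_in_def by blast
  assume X: "X \<in> model \<kappa>" and X': "dir_deriv (coord \<kappa>' \<circ> chart_inv \<kappa>) (coord \<kappa> x) X \<in> model \<kappa>'"
  have "frechet_derivative (\<lambda>y. g (\<tau> y)) (at (coord \<kappa> x)) =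
      frechet_derivative g (at (\<tau> (coord \<kappa> x))) \<circ> frechet_derivative \<tau> (at (coord \<kappa> x))"
    unfolding o_def
    by (rule frechet_derivative_at[symmetric], rule has_derivative_compose[of \<tau>])
       (use Cinf_on_has_derivative[OF \<tau>(1,3,2)] Cinf_on_has_derivative[OF g(1,3,2)] \<tau>x in auto)
  then show "dir_deriv (h \<circ> chart_inv \<kappa>) (coord \<kappa> x) X =
      dir_deriv (h \<circ> chart_inv \<kappa>') (coord \<kappa>' x) (dir_deriv (coord \<kappa>' \<circ> chart_inv \<kappa>) (coord \<kappa> x) X)"
    using has_dir_deriv(2)[OF \<kappa> x X Q xQ C, of h] eq has_dir_deriv(2)[OF \<kappa> x X \<tau>]
      has_dir_deriv(2)[OF \<kappa>' x' X' g] \<tau>x by simp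
qed

section \<open>Ordinary differential equations\<close>

lemma Cinf_on_locally_lipschitz:
  fixes g :: "'a::euclidean_space \<Rightarrow> 'b::real_normed_vector"
  assumes T: "open T" and g: "Cinf_on T g" and y: "y \<in> T"
  obtains R L where "0 < R" "0 \<le> L" "cball y R \<subseteq> T"
    "\<And>a b. a \<in> cball y R \<Longrightarrow> b \<in> cball y R \<Longrightarrow> norm (g a - g b) \<le> L * norm (a - b)"
proof -
  obtain R where R: "0 < R" "cball y R \<subseteq> T" using T y open_contains_cball by blast
  let ?g' = "\<lambda>x. frechet_derivative g (at x)"
  have "\<exists>B. \<forall>x\<in>cball y R. norm (?g' x b) \<le> B" for b
  proof -
    have "continuous_on (cball y R) (\<lambda>x. ?g' x b)"
      using Cinf_on_continuous_on[OF T Cinf_on_frechet_derivative[OF g]] R(2) continuous_on_subset by blast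
    then have "bounded ((\<lambda>x. ?g' x b) ` cball y R)"
      by (intro compact_imp_bounded compact_continuous_image compact_cball)
    then show ?thesis by (auto simp: bounded_iff)
  qed
  then obtain B where B: "\<And>b x. x \<in> cball y R \<Longrightarrow> norm (?g' x b) \<le> B b" by metis
  define L where "L = (\<Sum>b\<in>Basis. B b)"
  have B0: "0 \<le> B b" for b using B[of y b] R norm_ge_zero order_trans by (metis centre_in_cball less_imp_le)
  have on: "onorm (?g' x) \<le> L" if "x \<in> cball y R" for x
  proof (rule onorm_bound)
    show "0 \<le> L" unfolding L_def by (intro sum_nonneg B0)
    fix v
    have lin: "linear (?g' x)" using Cinf_on_has_derivative[OF T g] that R has_derivative_linear by blast
    have "?g' x v = ?g' x (\<Sum>b\<in>Basis. (v \<bullet> b) *\<^sub>R b)" by (simp add: euclidean_representation)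
    also have "\<dots> = (\<Sum>b\<in>Basis. (v \<bullet> b) *\<^sub>R ?g' x b)" by (simp add: linear_sum[OF lin] linear_scale[OF lin])
    also have "norm \<dots> \<le> (\<Sum>b\<in>Basis. norm v * B b)"
      by (rule sum_norm_le) (auto intro!: mult_mono B[OF that] Basis_le_norm B0)
    finally show "norm (?g' x v) \<le> L * norm v" by (simp add: L_def sum_distrib_left mult.commute)
  qed
  have "norm (g a - g b) \<le> L * norm (a - b)" if "a \<in> cball y R" "b \<in> cball y R" for a b
    by (rule differentiable_bound[OF convex_cball _ on that(1) that(2)])
       (use Cinf_on_has_derivative[OF T g] R in \<open>blast intro: has_derivative_at_withinI\<close>)
  moreover have "0 \<le> L" unfolding L_def by (intro sum_nonneg B0)
  ultimately show thesis using that R by blast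
qed

text \<open>Picard iteration with a time of existence that is uniform in the initial value. Composing the
  field with the nearest-point retraction onto the ball makes it globally Lipschitz, so that the
  integral operator is a contraction on all bounded continuous curves.\<close>

lemma picard_uniform:
  fixes Y :: "'a::euclidean_space \<Rightarrow> 'a"
  assumes R: "0 < R" and L: "0 \<le> L"
    and lip: "\<And>a b. a \<in> cball y R \<Longrightarrow> b \<in> cball y R \<Longrightarrow> norm (Y a - Y b) \<le> L * norm (a - b)"
  obtains \<tau> where "0 < \<tau>"
    "\<And>w. w \<in> cball y (R / 2) \<Longrightarrow> \<exists>\<gamma>. \<gamma> 0 = w \<and> (\<forall>t\<in>{-\<tau><..<\<tau>}. \<gamma> t \<in> cball y R \<and> (\<gamma> has_vector_derivative Y (\<gamma> t)) (at t))"
proof -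
  define r where "r = closest_point (cball y R)"
  have r_in: "r a \<in> cball y R" for a
    unfolding r_def using R by (intro closest_point_in_set) auto
  have r_id: "r a = a" if "a \<in> cball y R" for a
    unfolding r_def using that by (rule closest_point_self)
  have r_lip: "norm (r a - r b) \<le> norm (a - b)" for a b
    unfolding r_def using closest_point_lipschitz[of "cball y R" a b] R by (auto simp: dist_norm)
  define X where "X a = Y (r a)" for a
  have X_lip: "norm (X a - X b) \<le> L * norm (a - b)" for a b
    unfolding X_def using lip[OF r_in r_in, of a b] mult_left_mono[OF r_lip L] by (rule order_trans)
  have X_cont: "continuous_on UNIV X"
  proof (rule continuous_on_iff[THEN iffD2], intro ballI allI impI)
    fix a and e :: real assume "0 < e"
    then show "\<exists>d>0. \<forall>b\<in>UNIV. dist b a < d \<longrightarrow> dist (X b) (X a) < e"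
    proof (intro exI[of _ "e / (L + 1)"] conjI ballI impI)
      fix b assume *: "dist b a < e / (L + 1)"
      have "dist (X b) (X a) \<le> L * dist b a" using X_lip by (simp add: dist_norm)
      also have "\<dots> \<le> (L + 1) * dist b a" by (simp add: mult_right_mono)
      also have "\<dots> < e" using * L by (simp add: pos_less_divide_eq mult.commute)
      finally show "dist (X b) (X a) < e" .
    qed (use L in auto)
  qed
  define B where "B = norm (Y y) + L * R"
  have B0: "0 \<le> B" using L R by (simp add: B_def)
  have X_bd: "norm (X a) \<le> B" for a
  proof -
    have "norm (Y (r a)) \<le> norm (Y y) + norm (Y (r a) - Y y)" by (rule norm_triangle_sub)
    moreover have "norm (Y (r a) - Y y) \<le> L * norm (r a - y)" using r_in R by (intro lip) auto
    moreover have "L * norm (r a - y) \<le> L * R"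
      using r_in[of a] L by (intro mult_left_mono) (auto simp: dist_norm norm_minus_commute)
    ultimately show ?thesis by (simp add: X_def B_def)
  qed
  define \<tau> where "\<tau> = min (1 / (2 * (L + 1))) (R / (2 * (B + 1)))"
  have \<tau>: "0 < \<tau>" using L B0 R by (simp add: \<tau>_def)
  have "\<tau> * L \<le> 1 / (2 * (L + 1)) * L" using L by (intro mult_right_mono) (simp_all add: \<tau>_def)
  also have "\<dots> \<le> 1 / 2" using L by (simp add: field_simps)
  finally have \<tau>L: "\<tau> * L \<le> 1 / 2" .
  have "\<tau> * B \<le> R / (2 * (B + 1)) * B" using B0 by (intro mult_right_mono) (simp_all add: \<tau>_def)
  also have "\<dots> \<le> R / 2" using B0 R by (simp add: field_simps)
  finally have \<tau>B: "\<tau> * B \<le> R / 2" .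
  show thesis
  proof (rule that[OF \<tau>])
    fix w assume w: "w \<in> cball y (R / 2)"
    define F where "F \<eta> t = w + integral {-\<tau>..t} (\<lambda>s. X (\<eta> s)) - integral {-\<tau>..0} (\<lambda>s. X (\<eta> s))" for \<eta> t
    have F0: "F \<eta> 0 = w" for \<eta> by (simp add: F_def)
    have F_der: "(F \<eta> has_vector_derivative X (\<eta> t)) (at t within {-\<tau>..\<tau>})"
      if "continuous_on UNIV \<eta>" "t \<in> {-\<tau>..\<tau>}" for \<eta> t
    proof -
      have "continuous_on {-\<tau>..\<tau>} (\<lambda>s. X (\<eta> s))"
        using continuous_on_compose2[OF X_cont continuous_on_subset[OF that(1)]] by auto
      from integral_has_vector_derivative[OF this that(2)]
      show ?thesis unfolding F_def by (auto intro!: derivative_eq_intros)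
    qed
    have F_cont: "continuous_on {-\<tau>..\<tau>} (F \<eta>)" if "continuous_on UNIV \<eta>" for \<eta>
      using F_der[OF that] has_vector_derivative_continuous continuous_on_eq_continuous_within by blast
    define c where "c t = max (-\<tau>) (min \<tau> t)" for t :: real
    have c_in: "c t \<in> {-\<tau>..\<tau>}" for t using \<tau> by (auto simp: c_def)
    have c_cont: "continuous_on UNIV c" unfolding c_def by (intro continuous_intros)
    have c_id: "c t = t" if "t \<in> {-\<tau>..\<tau>}" for t using that by (auto simp: c_def)
    have FB: "(\<lambda>t. F \<eta> (c t)) \<in> bcontfun" if "continuous_on UNIV \<eta>" for \<eta>
    proof -
      have "continuous_on UNIV (\<lambda>t. F \<eta> (c t))"
        by (rule continuous_on_compose2[OF F_cont[OF that] c_cont]) (use c_in in blast)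
      moreover have "bounded (F \<eta> ` {-\<tau>..\<tau>})"
        using F_cont[OF that] by (intro compact_imp_bounded compact_continuous_image) auto
      then have "bounded (range (\<lambda>t. F \<eta> (c t)))"
        by (rule bounded_subset) (use c_in in auto)
      ultimately show ?thesis by (simp add: bcontfun_def)
    qed
    define P where "P \<eta> = Bcontfun (\<lambda>t. F (apply_bcontfun \<eta>) (c t))" for \<eta> :: "real \<Rightarrow>\<^sub>C 'a"
    have bc: "continuous_on UNIV (apply_bcontfun \<eta>)" for \<eta> :: "real \<Rightarrow>\<^sub>C 'a"
      using apply_bcontfun[of \<eta>] by (simp add: bcontfun_def)
    have P: "apply_bcontfun (P \<eta>) t = F (apply_bcontfun \<eta>) (c t)" for \<eta> t
      unfolding P_def using FB[OF bc] by (simp add: Bcontfun_inverse)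
    have contr: "dist (P \<eta>) (P \<xi>) \<le> 1 / 2 * dist \<eta> \<xi>" for \<eta> \<xi>
    proof (rule dist_bound)
      fix t
      let ?D = "\<lambda>t. F (apply_bcontfun \<eta>) t - F (apply_bcontfun \<xi>) t"
      have "norm (?D (c t) - ?D 0) \<le> L * dist \<eta> \<xi> * norm (c t - 0)"
      proof (rule differentiable_bound[where S = "{-\<tau>..\<tau>}" and f' = "\<lambda>t h. h *\<^sub>R (X (\<eta> t) - X (\<xi> t))"])
        fix s assume "s \<in> {-\<tau>..\<tau>}"
        from has_vector_derivative_diff[OF F_der[OF bc this] F_der[OF bc this]]
        show "(?D has_derivative (\<lambda>h. h *\<^sub>R (X (\<eta> s) - X (\<xi> s)))) (at s within {-\<tau>..\<tau>})"
          by (simp add: has_vector_derivative_def)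
        have "norm (X (\<eta> s) - X (\<xi> s)) \<le> L * dist \<eta> \<xi>"
          using X_lip[of "\<eta> s" "\<xi> s"] mult_left_mono[OF dist_bounded[of \<eta> s \<xi>] L] by (simp add: dist_norm)
        then show "onorm (\<lambda>h::real. h *\<^sub>R (X (\<eta> s) - X (\<xi> s))) \<le> L * dist \<eta> \<xi>"
          by (intro onorm_bound) (use L in \<open>auto simp: mult.commute intro: mult_left_mono\<close>)
      qed (use c_in \<tau> in auto)
      also have "\<dots> \<le> L * dist \<eta> \<xi> * \<tau>"
        using c_in[of t] L by (intro mult_left_mono) auto
      also have "\<dots> \<le> 1 / 2 * dist \<eta> \<xi>"
        using mult_right_mono[OF \<tau>L, of "dist \<eta> \<xi>"] by (simp add: ac_simps)
      finally show "dist (apply_bcontfun (P \<eta>) t) (apply_bcontfun (P \<xi>) t) \<le> 1 / 2 * dist \<eta> \<xi>"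
        by (simp add: P dist_norm F0)
    qed
    have "\<exists>!\<eta>. P \<eta> = \<eta>" by (rule banach_fix_type[of "1/2"]) (use contr in auto)
    then obtain \<eta> where \<eta>: "P \<eta> = \<eta>" by blast
    define \<gamma> where "\<gamma> = apply_bcontfun \<eta>"
    have \<gamma>F: "\<gamma> t = F \<gamma> t" if "t \<in> {-\<tau>..\<tau>}" for t
      using P[of \<eta> t] \<eta> c_id[OF that] by (simp add: \<gamma>_def)
    have \<gamma>c: "continuous_on UNIV \<gamma>" unfolding \<gamma>_def by (rule bc)
    have \<gamma>0: "\<gamma> 0 = w" using \<gamma>F[of 0] \<tau> F0 by simp
    have der: "(\<gamma> has_vector_derivative X (\<gamma> t)) (at t within {-\<tau>..\<tau>})" if "t \<in> {-\<tau>..\<tau>}" for t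
      by (rule has_vector_derivative_transform[OF that _ F_der[OF \<gamma>c that]]) (use \<gamma>F in auto)
    have "\<gamma> t \<in> cball y R" if t: "t \<in> {-\<tau>..\<tau>}" for t
    proof -
      have "norm (\<gamma> t - \<gamma> 0) \<le> B * norm (t - 0)"
      proof (rule differentiable_bound[where S = "{-\<tau>..\<tau>}" and f' = "\<lambda>t h. h *\<^sub>R X (\<gamma> t)"])
        show "onorm (\<lambda>h::real. h *\<^sub>R X (\<gamma> s)) \<le> B" for s
          by (intro onorm_bound) (use B0 X_bd[of "\<gamma> s"] in \<open>auto simp: mult.commute[of B] intro: mult_left_mono\<close>)
      qed (use der t \<tau> in \<open>auto simp: has_vector_derivative_def\<close>)
      also have "\<dots> \<le> B * \<tau>" using t B0 by (intro mult_left_mono) auto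
      also have "\<dots> \<le> R / 2" using \<tau>B by (simp add: mult.commute)
      finally have "dist (\<gamma> t) w \<le> R / 2" by (simp add: \<gamma>0 dist_norm)
      moreover have "dist y (\<gamma> t) \<le> dist y w + dist (\<gamma> t) w" by (simp add: dist_triangle2)
      ultimately show ?thesis using w by simp
    qed
    moreover have "(\<gamma> has_vector_derivative X (\<gamma> t)) (at t)" if "t \<in> {-\<tau><..<\<tau>}" for t
      using der[of t] that by (simp add: at_within_Icc_at)
    ultimately show "\<exists>\<gamma>. \<gamma> 0 = w \<and> (\<forall>t\<in>{-\<tau><..<\<tau>}. \<gamma> t \<in> cball y R \<and> (\<gamma> has_vector_derivative Y (\<gamma> t)) (at t))"
      using \<gamma>0 r_id by (intro exI[of _ \<gamma>]) (auto simp: X_def)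
  qed
qed

lemma ode_unique:
  fixes \<gamma> \<delta> :: "real \<Rightarrow> 'a::real_inner"
  assumes I: "is_interval I" and "t0 \<in> I" "t \<in> I" and eq: "\<gamma> t0 = \<delta> t0"
    and \<gamma>: "\<And>s. s \<in> I \<Longrightarrow> \<gamma> s \<in> S \<and> (\<gamma> has_vector_derivative Y (\<gamma> s)) (at s)"
    and \<delta>: "\<And>s. s \<in> I \<Longrightarrow> \<delta> s \<in> S \<and> (\<delta> has_vector_derivative Y (\<delta> s)) (at s)"
    and lip: "\<And>a b. a \<in> S \<Longrightarrow> b \<in> S \<Longrightarrow> norm (Y a - Y b) \<le> L * norm (a - b)"
  shows "\<gamma> t = \<delta> t"
proof -
  define u where "u s = (\<gamma> s - \<delta> s) \<bullet> (\<gamma> s - \<delta> s)" for s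
  have du: "(u has_real_derivative 2 * ((\<gamma> s - \<delta> s) \<bullet> (Y (\<gamma> s) - Y (\<delta> s)))) (at s)" if "s \<in> I" for s
  proof -
    have d: "((\<lambda>s. \<gamma> s - \<delta> s) has_derivative (\<lambda>h. h *\<^sub>R (Y (\<gamma> s) - Y (\<delta> s)))) (at s)"
      using has_vector_derivative_diff[of \<gamma> _ "at s" \<delta>] \<gamma>[OF that] \<delta>[OF that] unfolding has_vector_derivative_def by blast
    from has_derivative_inner[OF d d] show ?thesis
      unfolding u_def has_field_derivative_def by (rule has_derivative_eq_rhs) (auto simp: inner_commute)
  qed
  have bd: "\<bar>2 * ((\<gamma> s - \<delta> s) \<bullet> (Y (\<gamma> s) - Y (\<delta> s)))\<bar> \<le> 2 * L * u s" if "s \<in> I" for s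
  proof -
    have "\<bar>(\<gamma> s - \<delta> s) \<bullet> (Y (\<gamma> s) - Y (\<delta> s))\<bar> \<le> norm (\<gamma> s - \<delta> s) * norm (Y (\<gamma> s) - Y (\<delta> s))"
      by (rule Cauchy_Schwarz_ineq2)
    also have "\<dots> \<le> norm (\<gamma> s - \<delta> s) * (L * norm (\<gamma> s - \<delta> s))"
      using lip \<gamma>[OF that] \<delta>[OF that] by (intro mult_left_mono) auto
    also have "\<dots> = L * u s" by (simp add: u_def dot_square_norm power2_eq_square)
    finally show ?thesis by (simp add: abs_mult)
  qed
  have de: "((\<lambda>s. u s * exp (k * s)) has_real_derivative
      (2 * ((\<gamma> s - \<delta> s) \<bullet> (Y (\<gamma> s) - Y (\<delta> s))) + k * u s) * exp (k * s)) (at s)" if "s \<in> I" for s k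
    by (rule derivative_eq_intros du[OF that] refl)+ (simp only: algebra_simps)
  have u0: "u t0 = 0" using eq by (simp add: u_def)
  have "u t \<le> 0"
  proof (cases "t0 \<le> t")
    case True
    have "u t * exp (- (2 * L) * t) \<le> u t0 * exp (- (2 * L) * t0)"
    proof (rule DERIV_nonpos_imp_nonincreasing[OF True])
      fix s assume "t0 \<le> s" "s \<le> t"
      then have s: "s \<in> I" using I assms(2,3) by (meson mem_is_interval_1_I)
      show "\<exists>d. ((\<lambda>s. u s * exp (- (2 * L) * s)) has_real_derivative d) (at s) \<and> d \<le> 0"
        by (rule exI, rule conjI, rule de[OF s], rule mult_nonpos_nonneg) (use bd[OF s] in auto)
    qed
    then show ?thesis by (simp add: u0 mult_le_0_iff)
  next
    case False
    have "u t * exp (2 * L * t) \<le> u t0 * exp (2 * L * t0)"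
    proof (rule DERIV_nonneg_imp_nondecreasing[of t t0 "\<lambda>s. u s * exp (2 * L * s)"])
      show "t \<le> t0" using False by simp
      fix s assume "t \<le> s" "s \<le> t0"
      then have s: "s \<in> I" using I assms(2,3) by (meson mem_is_interval_1_I)
      show "\<exists>d. ((\<lambda>s. u s * exp (2 * L * s)) has_real_derivative d) (at s) \<and> 0 \<le> d"
        by (rule exI, rule conjI, rule de[OF s], rule mult_nonneg_nonneg) (use bd[OF s] in auto)
    qed
    then show ?thesis by (simp add: u0 mult_le_0_iff)
  qed
  then have "(\<gamma> t - \<delta> t) \<bullet> (\<gamma> t - \<delta> t) = 0"
    using inner_ge_zero[of "\<gamma> t - \<delta> t"] by (simp add: u_def del: inner_ge_zero)
  then show ?thesis by simp
qed

section \<open>Integral curves and nappes\<close>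

locale manifold_field =
  fixes A :: "('v::t2_space, 'e::euclidean_space) chart set" and Z :: "'v \<Rightarrow> ('v, 'e) chart \<Rightarrow> 'e"
  assumes manifold: "smooth_manifold A" and field: "smooth_vector_field A Z"
begin

lemma chart: "\<kappa> \<in> A \<Longrightarrow> is_chart \<kappa>"
  and transition: "\<kappa> \<in> A \<Longrightarrow> \<kappa>' \<in> A \<Longrightarrow> smooth_transition \<kappa> \<kappa>'"
  using manifold by (auto simp: smooth_manifold_def compatible_chart_def)

lemma chart_at: obtains \<kappa> where "\<kappa> \<in> A" "x \<in> domain \<kappa>"
  using manifold unfolding smooth_manifold_def by blast

lemma Z_model: "\<kappa> \<in> A \<Longrightarrow> x \<in> domain \<kappa> \<Longrightarrow> Z x \<kappa> \<in> model \<kappa>"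
  using field unfolding smooth_vector_field_def tangent_vector_def by blast

lemma Z_transition:
  "\<kappa> \<in> A \<Longrightarrow> \<kappa>' \<in> A \<Longrightarrow> x \<in> domain \<kappa> \<Longrightarrow> x \<in> domain \<kappa>' \<Longrightarrow>
    Z x \<kappa>' = dir_deriv (coord \<kappa>' \<circ> chart_inv \<kappa>) (coord \<kappa> x) (Z x \<kappa>)"
  using field unfolding smooth_vector_field_def tangent_vector_def by blast

lemma smooth_in_Z:
  assumes "\<kappa> \<in> A" "x \<in> domain \<kappa>"
  shows "smooth_in \<kappa> (\<lambda>x. Z x \<kappa>) x"
  using field assms is_chartD(6)[OF chart[OF assms(1)] assms(2)]
  unfolding smooth_vector_field_def smooth_on_def smooth_in_def Cinf_on_def by blast

lemma smooth_function_iff: "smooth_function A h \<longleftrightarrow> (\<forall>\<kappa>\<in>A. \<forall>x\<in>domain \<kappa>. smooth_in \<kappa> h x)"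
  by (rule smooth_function_iff) (rule chart)

lemma integral_curves_locally_unique:
  assumes \<gamma>: "integral_curve A Z x I \<gamma>" and \<delta>: "integral_curve A Z y J \<delta>" and t: "t \<in> I" "t \<in> J" and eq: "\<gamma> t = \<delta> t"
  obtains e where "0 < e" "\<And>s. \<bar>s - t\<bar> < e \<Longrightarrow> s \<in> I \<inter> J \<and> \<gamma> s = \<delta> s"
proof -
  obtain \<kappa> where \<kappa>: "\<kappa> \<in> A" "\<gamma> t \<in> domain \<kappa>" using chart_at by blast
  note ch = is_chartD[OF chart[OF \<kappa>(1)]]
  obtain T Y where Y: "open T" "coord \<kappa> (\<gamma> t) \<in> T" "Cinf_on T Y" "\<And>y. y \<in> codomain \<kappa> \<Longrightarrow> y \<in> T \<Longrightarrow> Y y = Z (chart_inv \<kappa> y) \<kappa>"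
    using smooth_inE[OF smooth_in_Z[OF \<kappa>]] by blast
  obtain R L where R: "0 < R" "cball (coord \<kappa> (\<gamma> t)) R \<subseteq> T"
    "\<And>a b. a \<in> cball (coord \<kappa> (\<gamma> t)) R \<Longrightarrow> b \<in> cball (coord \<kappa> (\<gamma> t)) R \<Longrightarrow> norm (Y a - Y b) \<le> L * norm (a - b)"
    using Cinf_on_locally_lipschitz[OF Y(1,3,2)] by metis
  define G where "G = {x \<in> domain \<kappa>. coord \<kappa> x \<in> ball (coord \<kappa> (\<gamma> t)) R}"
  have G: "open G" "\<gamma> t \<in> G" unfolding G_def using coord_preimage_open[OF chart[OF \<kappa>(1)] open_ball] R \<kappa> by auto
  have "open I" "continuous_on I \<gamma>" "open J" "continuous_on J \<delta>"
    using \<gamma> \<delta> by (simp_all add: integral_curve_def)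
  then have "open (\<gamma> -` G \<inter> I)" "open (\<delta> -` G \<inter> J)"
    using G(1) continuous_on_open_vimage by blast+
  then have "open ((\<gamma> -` G \<inter> I) \<inter> (\<delta> -` G \<inter> J))" by (rule open_Int)
  moreover have "t \<in> (\<gamma> -` G \<inter> I) \<inter> (\<delta> -` G \<inter> J)" using t eq G by auto
  ultimately obtain e where e: "0 < e" "ball t e \<subseteq> (\<gamma> -` G \<inter> I) \<inter> (\<delta> -` G \<inter> J)"
    using openE by blast
  have *: "coord \<kappa> (\<gamma> s) = coord \<kappa> (\<delta> s)" if s: "s \<in> ball t e" for s
  proof (rule ode_unique[of "ball t e" t s "\<lambda>s. coord \<kappa> (\<gamma> s)" "\<lambda>s. coord \<kappa> (\<delta> s)" "cball (coord \<kappa> (\<gamma> t)) R" Y L])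
    show "is_interval (ball t e)" by (simp add: is_interval_convex_1)
    fix r assume "r \<in> ball t e"
    then have r: "\<gamma> r \<in> G" "\<delta> r \<in> G" "r \<in> I" "r \<in> J" using e by auto
    have D: "coord \<kappa> p \<in> cball (coord \<kappa> (\<gamma> t)) R" "Y (coord \<kappa> p) = Z p \<kappa>" if "p \<in> G" for p
    proof -
      have p: "p \<in> domain \<kappa>" "coord \<kappa> p \<in> ball (coord \<kappa> (\<gamma> t)) R" using that by (auto simp: G_def)
      then show b: "coord \<kappa> p \<in> cball (coord \<kappa> (\<gamma> t)) R" by auto
      with Y(4)[OF ch(6)[OF p(1)]] R(2) show "Y (coord \<kappa> p) = Z p \<kappa>" by (auto simp: ch(7)[OF p(1)])
    qed
    show "coord \<kappa> (\<gamma> r) \<in> cball (coord \<kappa> (\<gamma> t)) R \<and> ((\<lambda>s. coord \<kappa> (\<gamma> s)) has_vector_derivative Y (coord \<kappa> (\<gamma> r))) (at r)"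
      using D[OF r(1)] \<gamma> r \<kappa>(1) by (auto simp: integral_curve_def o_def G_def)
    show "coord \<kappa> (\<delta> r) \<in> cball (coord \<kappa> (\<gamma> t)) R \<and> ((\<lambda>s. coord \<kappa> (\<delta> s)) has_vector_derivative Y (coord \<kappa> (\<delta> r))) (at r)"
      using D[OF r(2)] \<delta> r \<kappa>(1) by (auto simp: integral_curve_def o_def G_def)
  qed (use s e R eq in auto)
  show thesis
  proof (rule that[OF e(1)])
    fix s assume "\<bar>s - t\<bar> < e"
    then have s: "s \<in> ball t e" by (simp add: dist_real_def)
    with e have "\<gamma> s \<in> domain \<kappa>" "\<delta> s \<in> domain \<kappa>" "s \<in> I \<inter> J" by (auto simp: G_def)
    with *[OF s] show "s \<in> I \<inter> J \<and> \<gamma> s = \<delta> s" by (metis ch(7))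
  qed
qed

lemma integral_curve_unique:
  assumes \<gamma>: "integral_curve A Z x I \<gamma>" and \<delta>: "integral_curve A Z x J \<delta>" and t: "t \<in> I" "t \<in> J"
  shows "\<gamma> t = \<delta> t"
proof (rule ccontr)
  assume neq: "\<gamma> t \<noteq> \<delta> t"
  have I: "open I" "is_interval I" "0 \<in> I" "\<gamma> 0 = x" "continuous_on I \<gamma>"
    and J: "open J" "is_interval J" "0 \<in> J" "\<delta> 0 = x" "continuous_on J \<delta>"
    using \<gamma> \<delta> by (auto simp: integral_curve_def)
  define E where "E = {s \<in> I \<inter> J. \<gamma> s = \<delta> s}"
  define E' where "E' = {s \<in> I \<inter> J. \<gamma> s \<noteq> \<delta> s}"
  have "open E"
  proof (rule openI)
    fix s assume "s \<in> E"
    then have "s \<in> I" "s \<in> J" "\<gamma> s = \<delta> s" by (auto simp: E_def)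
    then obtain e where "0 < e" "\<And>r. \<bar>r - s\<bar> < e \<Longrightarrow> r \<in> I \<inter> J \<and> \<gamma> r = \<delta> r"
      using integral_curves_locally_unique[OF \<gamma> \<delta>] by metis
    then show "\<exists>e>0. ball s e \<subseteq> E" by (intro exI[of _ e]) (auto simp: E_def dist_real_def abs_minus_commute)
  qed
  moreover have "open E'"
  proof (subst open_subopen, intro ballI)
    fix s assume "s \<in> E'"
    then have s: "s \<in> I" "s \<in> J" "\<gamma> s \<noteq> \<delta> s" by (auto simp: E'_def)
    then obtain P Q where PQ: "open P" "open Q" "\<gamma> s \<in> P" "\<delta> s \<in> Q" "P \<inter> Q = {}"
      using hausdorff by metis
    have "open (\<gamma> -` P \<inter> I)" "open (\<delta> -` Q \<inter> J)"
      using I J PQ continuous_on_open_vimage by blast+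
    then show "\<exists>T. open T \<and> s \<in> T \<and> T \<subseteq> E'"
      using s PQ by (intro exI[of _ "(\<gamma> -` P \<inter> I) \<inter> (\<delta> -` Q \<inter> J)"]) (auto simp: E'_def)
  qed
  moreover have "connected (I \<inter> J)"
    using I(2) J(2) by (simp add: is_interval_Int is_interval_connected)
  moreover have "I \<inter> J \<subseteq> E \<union> E'" "E \<inter> E' \<inter> (I \<inter> J) = {}" by (auto simp: E_def E'_def)
  ultimately have "E \<inter> (I \<inter> J) = {} \<or> E' \<inter> (I \<inter> J) = {}"
    using connectedD[of "I \<inter> J" E E'] by blast
  moreover have "0 \<in> E \<inter> (I \<inter> J)" using I J by (auto simp: E_def)
  moreover have "t \<in> E' \<inter> (I \<inter> J)" using t neq by (auto simp: E'_def)
  ultimately show False by blast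
qed

lemma flow_eq:
  assumes "integral_curve A Z x I \<gamma>" "t \<in> I"
  shows "flow A Z t x = \<gamma> t"
  unfolding flow_def using assms integral_curve_unique by (intro the_equality) blast+

lemma integral_curve_shift:
  assumes "integral_curve A Z x I \<gamma>" "T \<in> I"
  shows "integral_curve A Z (\<gamma> T) {t. t + T \<in> I} (\<lambda>t. \<gamma> (t + T))"
proof -
  have I: "open I" "is_interval I" "continuous_on I \<gamma>"
    "\<And>t \<kappa>. t \<in> I \<Longrightarrow> \<kappa> \<in> A \<Longrightarrow> \<gamma> t \<in> domain \<kappa> \<Longrightarrow> ((coord \<kappa> \<circ> \<gamma>) has_vector_derivative Z (\<gamma> t) \<kappa>) (at t)"
    using assms by (auto simp: integral_curve_def)
  have eq: "{t. t + T \<in> I} = (\<lambda>t. t + T) -` I" by auto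
  have "open {t. t + T \<in> I}" unfolding eq by (intro open_vimage I continuous_intros)
  moreover have "is_interval {t. t + T \<in> I}"
    using I(2) unfolding is_interval_1 by (metis (no_types, lifting) add_le_cancel_right mem_Collect_eq)
  moreover have "continuous_on {t. t + T \<in> I} (\<lambda>t. \<gamma> (t + T))"
    by (rule continuous_on_compose2[OF I(3)]) (auto intro: continuous_intros)
  moreover have "((coord \<kappa> \<circ> (\<lambda>t. \<gamma> (t + T))) has_vector_derivative Z (\<gamma> (t + T)) \<kappa>) (at t)"
    if "t + T \<in> I" "\<kappa> \<in> A" "\<gamma> (t + T) \<in> domain \<kappa>" for t \<kappa>
  proof -
    have "((\<lambda>t. t + T) has_vector_derivative 1) (at t)" by (auto intro!: derivative_eq_intros)
    from vector_diff_chain_at[OF this I(4)[OF that]] show ?thesis by (simp add: o_def)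
  qed
  ultimately show ?thesis using assms(2) by (simp add: integral_curve_def)
qed

lemma integral_curve_glue:
  assumes \<gamma>: "integral_curve A Z x I \<gamma>" and \<delta>: "integral_curve A Z x J \<delta>"
  shows "integral_curve A Z x (I \<union> J) (\<lambda>t. if t \<in> I then \<gamma> t else \<delta> t)"
proof -
  let ?g = "\<lambda>t. if t \<in> I then \<gamma> t else \<delta> t"
  have I: "open I" "is_interval I" "0 \<in> I" "\<gamma> 0 = x" "continuous_on I \<gamma>"
    "\<And>t \<kappa>. t \<in> I \<Longrightarrow> \<kappa> \<in> A \<Longrightarrow> \<gamma> t \<in> domain \<kappa> \<Longrightarrow> ((coord \<kappa> \<circ> \<gamma>) has_vector_derivative Z (\<gamma> t) \<kappa>) (at t)"
    using \<gamma> by (auto simp: integral_curve_def)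
  have J: "open J" "is_interval J" "0 \<in> J" "\<delta> 0 = x" "continuous_on J \<delta>"
    "\<And>t \<kappa>. t \<in> J \<Longrightarrow> \<kappa> \<in> A \<Longrightarrow> \<delta> t \<in> domain \<kappa> \<Longrightarrow> ((coord \<kappa> \<circ> \<delta>) has_vector_derivative Z (\<delta> t) \<kappa>) (at t)"
    using \<delta> by (auto simp: integral_curve_def)
  have eq: "?g t = \<gamma> t" if "t \<in> I" for t using that by simp
  have eq': "?g t = \<delta> t" if "t \<in> J" for t
    using that integral_curve_unique[OF \<gamma> \<delta>] by auto
  have "is_interval (I \<union> J)"
    using I(2,3) J(2,3) connected_Un[of I J] by (auto simp: is_interval_connected_1)
  moreover have "continuous_on (I \<union> J) ?g"
  proof (rule continuous_on_open_Un)
    show "continuous_on I ?g" by (subst continuous_on_cong[OF refl eq]) (simp_all add: I(5))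
    show "continuous_on J ?g" by (subst continuous_on_cong[OF refl eq']) (simp_all add: J(5))
  qed (use I J in auto)
  moreover have "((coord \<kappa> \<circ> ?g) has_vector_derivative Z (?g t) \<kappa>) (at t)"
    if t: "t \<in> I \<union> J" "\<kappa> \<in> A" "?g t \<in> domain \<kappa>" for t \<kappa>
  proof (cases "t \<in> I")
    case True
    from I(6)[OF True t(2)] t(3) True have "((coord \<kappa> \<circ> \<gamma>) has_vector_derivative Z (?g t) \<kappa>) (at t)" by simp
    then show ?thesis
      by (rule has_vector_derivative_transform_within_open[OF _ I(1) True]) (simp add: eq)
  next
    case False
    then have tJ: "t \<in> J" using t by simp
    from J(6)[OF tJ t(2)] t(3) eq'[OF tJ] have "((coord \<kappa> \<circ> \<delta>) has_vector_derivative Z (?g t) \<kappa>) (at t)" by simp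
    then show ?thesis
      by (rule has_vector_derivative_transform_within_open[OF _ J(1) tJ]) (simp add: eq')
  qed
  ultimately show ?thesis using I J by (simp add: integral_curve_def open_Un)
qed

lemma flow_shift:
  assumes \<gamma>: "integral_curve A Z x I \<gamma>" and T: "T \<in> I" and t: "t + T \<in> flow_domain A Z x"
  shows "t \<in> flow_domain A Z (\<gamma> T)" "flow A Z t (\<gamma> T) = flow A Z (t + T) x"
proof -
  obtain J \<delta> where J: "integral_curve A Z x J \<delta>" "t + T \<in> J"
    using t by (auto simp: flow_domain_def)
  note g = integral_curve_glue[OF \<gamma> J(1)]
  from integral_curve_shift[OF g, of T] T
  have s: "integral_curve A Z (\<gamma> T) {t. t + T \<in> I \<union> J} (\<lambda>t. if t + T \<in> I then \<gamma> (t + T) else \<delta> (t + T))"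
    by simp
  then show "t \<in> flow_domain A Z (\<gamma> T)" using J(2) unfolding flow_domain_def by blast
  from flow_eq[OF s, of t] flow_eq[OF g, of "t + T"] J(2)
  show "flow A Z t (\<gamma> T) = flow A Z (t + T) x" by auto
qed

text \<open>The maximal flows of \<open>x\<close> and \<open>\<gamma> T\<close> agree up to a time shift by \<open>T\<close>, so the time \<open>b\<close> at which the limit \<open>c\<close>
  is reached is only replaced by \<open>b + T\<close>.\<close>

lemma nappe_backward:
  assumes \<gamma>: "integral_curve A Z x I \<gamma>" and T: "T \<in> I" "0 \<le> T" and W: "\<gamma> T \<in> nappe A Z c"
  shows "x \<in> nappe A Z c"
proof -
  define J where "J = flow_domain A Z (\<gamma> T)"
  define J' where "J' = flow_domain A Z x"
  obtain b :: ereal where b: "0 \<le> b" "at b within ereal ` J \<noteq> bot"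
    "((\<lambda>t. flow A Z (real_of_ereal t) (\<gamma> T)) \<longlongrightarrow> c) (at b within ereal ` J)"
    using W by (auto simp: nappe_def J_def)
  have \<gamma>0: "\<gamma> 0 = x" "0 \<in> I" using \<gamma> by (auto simp: integral_curve_def)
  have fwd: "t - T \<in> J" "flow A Z (t - T) (\<gamma> T) = flow A Z t x" if "t \<in> J'" for t
    using flow_shift[OF \<gamma> T(1), of "t - T"] that by (auto simp: J_def J'_def)
  have bwd: "t + T \<in> J'" if "t \<in> J" for t
    using flow_shift(1)[OF integral_curve_shift[OF \<gamma> T(1)], of "- T" "t + T"] \<gamma>0 that by (simp add: J_def J'_def)
  let ?b = "b + ereal T"
  have lim1: "filterlim (\<lambda>t. t + ereal T) (at ?b within ereal ` J') (at b within ereal ` J)"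
    unfolding filterlim_at
  proof
    have "((\<lambda>t. t + ereal T) \<longlongrightarrow> ?b) (at b within ereal ` J)"
      by (rule tendsto_add_ereal_general1) (auto intro: tendsto_intros)
    moreover have "s + ereal T \<in> ereal ` J' \<and> s + ereal T \<noteq> ?b" if s: "s \<in> ereal ` J" "s \<noteq> b" for s
    proof -
      obtain t where t: "t \<in> J" "s = ereal t" using s by auto
      show ?thesis using bwd[OF t(1)] s t by (cases b) auto
    qed
    then have "\<forall>\<^sub>F t in at b within ereal ` J. t + ereal T \<in> ereal ` J' \<and> t + ereal T \<noteq> ?b"
      unfolding eventually_at_filter by (intro always_eventually) auto
    ultimately show "((\<lambda>t. t + ereal T) \<longlongrightarrow> ?b) (at b within ereal ` J)"
      "\<forall>\<^sub>F t in at b within ereal ` J. t + ereal T \<in> ereal ` J' \<and> t + ereal T \<noteq> ?b" by auto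
  qed
  have lim2: "filterlim (\<lambda>t. t - ereal T) (at b within ereal ` J) (at ?b within ereal ` J')"
    unfolding filterlim_at
  proof
    have "((\<lambda>t. t + (- ereal T)) \<longlongrightarrow> ?b + (- ereal T)) (at ?b within ereal ` J')"
      by (rule tendsto_add_ereal_general1) (auto intro: tendsto_intros)
    moreover have "?b + (- ereal T) = b" by (cases b) auto
    ultimately show "((\<lambda>t. t - ereal T) \<longlongrightarrow> b) (at ?b within ereal ` J')"
      by (simp only: minus_ereal_def)
    have "s - ereal T \<in> ereal ` J \<and> s - ereal T \<noteq> b" if s: "s \<in> ereal ` J'" "s \<noteq> ?b" for s
    proof -
      obtain t where t: "t \<in> J'" "s = ereal t" using s by auto
      show ?thesis using fwd(1)[OF t(1)] s t by (cases b) auto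
    qed
    then show "\<forall>\<^sub>F t in at ?b within ereal ` J'. t - ereal T \<in> ereal ` J \<and> t - ereal T \<noteq> b"
      unfolding eventually_at_filter by (intro always_eventually) auto
  qed
  have "at ?b within ereal ` J' \<noteq> bot"
  proof
    assume "at ?b within ereal ` J' = bot"
    with lim1 have "at b within ereal ` J = bot"
      by (simp add: filterlim_def filtermap_bot_iff bot_unique)
    with b show False by blast
  qed
  moreover have "((\<lambda>t. flow A Z (real_of_ereal t) x) \<longlongrightarrow> c) (at ?b within ereal ` J')"
  proof (rule Lim_transform_eventually)
    show "((\<lambda>t. flow A Z (real_of_ereal (t - ereal T)) (\<gamma> T)) \<longlongrightarrow> c) (at ?b within ereal ` J')"
      using filterlim_compose[OF b(3) lim2] .
    have "flow A Z (real_of_ereal (t - ereal T)) (\<gamma> T) = flow A Z (real_of_ereal t) x" if "t \<in> ereal ` J'" for t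
      using that fwd(2) by auto
    then show "\<forall>\<^sub>F t in at ?b within ereal ` J'. flow A Z (real_of_ereal (t - ereal T)) (\<gamma> T) = flow A Z (real_of_ereal t) x"
      unfolding eventually_at_filter by (intro always_eventually) auto
  qed
  moreover have "0 \<le> ?b" using b(1) T(2) by simp
  ultimately show ?thesis unfolding nappe_def J'_def by blast
qed

lemma nappe_zero:
  assumes "x \<in> nappe A Z c" and zero: "\<And>\<kappa>. \<kappa> \<in> A \<Longrightarrow> x \<in> domain \<kappa> \<Longrightarrow> Z x \<kappa> = 0"
  shows "x = c"
proof -
  have ic: "integral_curve A Z x UNIV (\<lambda>t. x)"
    using zero by (auto simp: integral_curve_def o_def)
  obtain b :: ereal where b: "at b within ereal ` flow_domain A Z x \<noteq> bot"
    "((\<lambda>t. flow A Z (real_of_ereal t) x) \<longlongrightarrow> c) (at b within ereal ` flow_domain A Z x)"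
    using assms(1) by (auto simp: nappe_def)
  from b(2) have "((\<lambda>t. x) \<longlongrightarrow> c) (at b within ereal ` flow_domain A Z x)"
    using flow_eq[OF ic] by simp
  then show ?thesis using b(1) by (simp add: tendsto_const_iff)
qed

lemma nappe_forwardI:
  assumes ic: "integral_curve A Z x I \<gamma>" and I: "{0..} \<subseteq> I" and lim: "(\<gamma> \<longlongrightarrow> c) at_top"
  shows "x \<in> nappe A Z c"
proof -
  define J where "J = flow_domain A Z x"
  have J: "{0..} \<subseteq> J" using ic I unfolding J_def flow_domain_def by blast
  have "\<infinity> islimpt (ereal ` J)"
  proof (rule islimptI)
    fix T :: "ereal set" assume "\<infinity> \<in> T" "open T"
    then obtain m where m: "{ereal m<..} \<subseteq> T" using open_PInfty by blast
    have "max 0 (m + 1) \<in> J" "ereal (max 0 (m + 1)) \<in> {ereal m<..}"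
      using J by (auto simp del: ereal_max)
    then have "ereal (max 0 (m + 1)) \<in> ereal ` J" "ereal (max 0 (m + 1)) \<in> T"
      using m by blast+
    then show "\<exists>y\<in>ereal ` J. y \<in> T \<and> y \<noteq> \<infinity>" by (metis PInfty_neq_ereal(1))
  qed
  then have "at \<infinity> within ereal ` J \<noteq> bot" by (simp add: trivial_limit_within)
  moreover have "((\<lambda>t. flow A Z (real_of_ereal t) x) \<longlongrightarrow> c) (at \<infinity> within ereal ` J)"
  proof (rule topological_tendstoI)
    fix S assume S: "open S" "c \<in> S"
    obtain M where M: "\<And>t. M \<le> t \<Longrightarrow> \<gamma> t \<in> S"
      using topological_tendstoD[OF lim S] by (auto simp: eventually_at_top_linorder)
    have "flow A Z (real_of_ereal s) x \<in> S" if s: "s \<in> {ereal (max 0 M)<..}" "s \<in> ereal ` J" for s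
    proof -
      obtain t where t: "s = ereal t" using s(2) by auto
      then have "0 \<le> t" "M \<le> t" using s(1) by auto
      then show ?thesis using flow_eq[OF ic, of t] I M t by auto
    qed
    note key = this
    have ev: "\<forall>\<^sub>F s in nhds \<infinity>. s \<in> {ereal (max 0 M)<..}"
      by (rule eventually_nhds_in_open) (auto simp del: ereal_max)
    show "\<forall>\<^sub>F s in at \<infinity> within ereal ` J. flow A Z (real_of_ereal s) x \<in> S"
      unfolding eventually_at_filter
    proof (rule eventually_mono[OF ev])
      fix s assume "s \<in> {ereal (max 0 M)<..}"
      then show "s \<noteq> \<infinity> \<longrightarrow> s \<in> ereal ` J \<longrightarrow> flow A Z (real_of_ereal s) x \<in> S"
        using key by blast
    qed
  qed
  ultimately show ?thesis unfolding nappe_def J_def by (intro CollectI exI[of _ \<infinity>]) auto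
qed

end

section \<open>Lowering a function by a smooth minimum\<close>

lemma smooth_in_isCont:
  assumes \<kappa>: "is_chart \<kappa>" and x: "x \<in> domain \<kappa>" and h: "smooth_in \<kappa> h x"
  shows "isCont h x"
proof -
  obtain T g where g: "open T" "coord \<kappa> x \<in> T" "Cinf_on T g" "\<And>y. y \<in> codomain \<kappa> \<Longrightarrow> y \<in> T \<Longrightarrow> g y = h (chart_inv \<kappa> y)"
    using smooth_inE[OF h] by blast
  define G where "G = {x \<in> domain \<kappa>. coord \<kappa> x \<in> T}"
  have G: "open G" "x \<in> G" using coord_preimage_open[OF \<kappa> g(1)] x g by (auto simp: G_def)
  have "continuous_on G (\<lambda>x. g (coord \<kappa> x))"
    by (rule continuous_on_compose2[OF Cinf_on_continuous_on[OF g(1,3)] continuous_on_subset[OF is_chartD(4)[OF \<kappa>]]])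
       (auto simp: G_def)
  moreover have "g (coord \<kappa> y) = h y" if "y \<in> G" for y
    using that g(4)[of "coord \<kappa> y"] is_chartD(6,7)[OF \<kappa>] by (simp add: G_def)
  ultimately have "continuous_on G h" by (simp cong: continuous_on_cong)
  then show ?thesis using G continuous_on_eq_continuous_at by blast
qed

locale morse =
  fixes A :: "('v::t2_space, 'e::euclidean_space) chart set" and f :: "'v \<Rightarrow> real" and Z :: "'v \<Rightarrow> ('v, 'e) chart \<Rightarrow> 'e"
  assumes manifold: "smooth_manifold A" and datum: "morse_datum A f Z"

sublocale morse \<subseteq> manifold_field A Z
  using manifold datum by unfold_locales (auto simp: morse_datum_def pseudo_gradient_def)

context morse
begin

abbreviation crit :: "'v set" where "crit \<equiv> critical_set A f"

lemma smooth_f: "smooth_function A f"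
  using datum by (simp add: morse_datum_def morse_function_def)

lemma smooth_in_f: "\<kappa> \<in> A \<Longrightarrow> x \<in> domain \<kappa> \<Longrightarrow> smooth_in \<kappa> f x"
  using smooth_f smooth_function_iff by blast

lemma Zf_pos: "x \<notin> crit \<Longrightarrow> \<kappa> \<in> A \<Longrightarrow> x \<in> domain \<kappa> \<Longrightarrow> 0 < chart_deriv \<kappa> f x (Z x \<kappa>)"
  using datum by (auto simp: morse_datum_def pseudo_gradient_def)

lemma smooth_continuous: "smooth_function A h \<Longrightarrow> continuous_on UNIV h"
  using smooth_in_isCont chart chart_at smooth_function_iff
  by (metis continuous_at_imp_continuous_on)

lemma dir_deriv_zero: "dir_deriv g y 0 = 0"
  by (simp add: dir_deriv_def)

lemma crit_zero:
  assumes "x \<in> crit" "\<kappa> \<in> A" "x \<in> domain \<kappa>"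
  shows "Z x \<kappa> = 0"
proof -
  obtain \<kappa>' N P U V \<psi> where "adapted_parametrization A f Z x \<kappa>' N P U V \<psi>"
    using datum assms(1) unfolding morse_datum_def pseudo_gradient_def by blast
  then have "\<psi> 0 = x" "0 \<in> U" "0 \<in> V" and
    "\<forall>n\<in>U. \<forall>p\<in>V. \<forall>\<kappa>\<in>A. \<psi> (n + p) \<in> domain \<kappa> \<longrightarrow> dir_deriv (coord \<kappa> \<circ> \<psi>) (n + p) (- n + p) = Z (\<psi> (n + p)) \<kappa>"
    unfolding adapted_parametrization_def star_shaped_nhd_0_def by blast+
  from this(4)[rule_format, of 0 0 \<kappa>] this(1-3) assms show ?thesis by (simp add: dir_deriv_zero)
qed

lemma crit_chart_deriv: "x \<in> crit \<Longrightarrow> \<kappa> \<in> A \<Longrightarrow> x \<in> domain \<kappa> \<Longrightarrow> chart_deriv \<kappa> h x (Z x \<kappa>) = 0"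
  by (simp add: crit_zero chart_deriv_def dir_deriv_zero)

text \<open>The field \<open>Z\<close> only has components in the charts of the atlas. To differentiate along it in other charts, such as
  a Morse parametrization, the component there is supplied as the vector \<open>\<zeta>\<close>.\<close>

lemma Z_deriv_change:
  assumes \<kappa>: "is_chart \<kappa>" "smooth_transition \<kappa> \<kappa>'" "x \<in> domain \<kappa>" and \<kappa>': "\<kappa>' \<in> A" "x \<in> domain \<kappa>'"
    and h: "smooth_in \<kappa>' h x" and \<zeta>: "\<zeta> \<in> model \<kappa>" "dir_deriv (coord \<kappa>' \<circ> chart_inv \<kappa>) (coord \<kappa> x) \<zeta> = Z x \<kappa>'"
  shows "chart_deriv \<kappa>' h x (Z x \<kappa>') = chart_deriv \<kappa> h x \<zeta>"
  using change_of_charts(2)[OF \<kappa>(1) chart[OF \<kappa>'(1)] \<kappa>(2,3) \<kappa>'(2) h \<zeta>(1)] \<zeta>(2) Z_model[OF \<kappa>']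
  by (simp add: chart_deriv_def)

definition increasing_on :: "'v set \<Rightarrow> ('v \<Rightarrow> real) \<Rightarrow> bool" where
  "increasing_on S h \<longleftrightarrow> (\<forall>x\<in>S - crit. \<forall>\<kappa>\<in>A. x \<in> domain \<kappa> \<longrightarrow> 0 < chart_deriv \<kappa> h x (Z x \<kappa>))"

lemma increasing_f: "increasing_on S f"
  by (auto simp: increasing_on_def Zf_pos)

definition smooth_near :: "'v set \<Rightarrow> ('v \<Rightarrow> real) \<Rightarrow> bool" where
  "smooth_near S h \<longleftrightarrow> (\<forall>x\<in>S. \<forall>\<kappa>\<in>A. x \<in> domain \<kappa> \<longrightarrow> smooth_in \<kappa> h x)"

lemma smooth_near_UNIV: "smooth_near UNIV h \<longleftrightarrow> smooth_function A h"
  unfolding smooth_near_def smooth_function_iff by blast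

definition lower_on :: "real \<Rightarrow> 'v set \<Rightarrow> ('v \<Rightarrow> real) \<Rightarrow> ('v \<Rightarrow> real) \<Rightarrow> 'v \<Rightarrow> real" where
  "lower_on d G k h x = (if x \<in> G then smin d (h x) (k x) else h x)"

text \<open>Replacing \<open>h\<close> by the smooth minimum of \<open>h\<close> and \<open>k\<close> inside a box \<open>G \<subseteq> Q\<close> creates no seam when
  \<open>k\<close> exceeds \<open>h\<close> on the boundary \<open>Q - G\<close>, because there the smooth minimum is \<open>h\<close>. The values
  drop to at most \<open>k + d\<close>, while the derivative along \<open>Z\<close> stays a convex combination of positive numbers.\<close>

lemma lower_on:
  assumes h: "smooth_function A h" and G: "open G" and Q: "closed Q" and sub: "G \<subseteq> Q" and k: "smooth_near Q k"
    and bd: "\<And>x. x \<in> Q - G \<Longrightarrow> h x < k x" and hZ: "increasing_on UNIV h" and kZ: "increasing_on G k" and d: "0 < d"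
  shows "smooth_function A (lower_on d G k h)" "increasing_on UNIV (lower_on d G k h)"
    "lower_on d G k h x \<le> h x" "x \<notin> G \<Longrightarrow> lower_on d G k h x = h x" "x \<in> G \<Longrightarrow> lower_on d G k h x \<le> k x + d"
proof -
  let ?h = "lower_on d G k h"
  have hs: "smooth_in \<kappa> h x" if "\<kappa> \<in> A" "x \<in> domain \<kappa>" for \<kappa> x
    using h that smooth_function_iff by blast
  have ks: "smooth_in \<kappa> k x" if "\<kappa> \<in> A" "x \<in> domain \<kappa>" "x \<in> Q" for \<kappa> x
    using k that by (auto simp: smooth_near_def)
  have inside: "?h y = smin d (h y) (k y)" if "y \<in> G" for y using that by (simp add: lower_on_def)
  have outside: "\<exists>S. open S \<and> x \<in> S \<and> (\<forall>y\<in>S. h y = ?h y)" if x: "x \<notin> G" for x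
  proof (cases "x \<in> Q")
    case False
    then show ?thesis using Q sub by (intro exI[of _ "- Q"]) (auto simp: lower_on_def)
  next
    case True
    obtain \<kappa> where \<kappa>: "\<kappa> \<in> A" "x \<in> domain \<kappa>" using chart_at by blast
    have "isCont h x" "isCont k x"
      using smooth_in_isCont[OF chart[OF \<kappa>(1)] \<kappa>(2)] hs[OF \<kappa>] ks[OF \<kappa> True] by auto
    then have "isCont (\<lambda>y. k y - h y) x" by simp
    then have "((\<lambda>y. k y - h y) \<longlongrightarrow> k x - h x) (nhds x)"
      using tendsto_at_iff_tendsto_nhds[of "\<lambda>y. k y - h y" x] by (simp add: isCont_def)
    moreover have "0 < k x - h x" using bd True x by simp
    ultimately have "\<forall>\<^sub>F y in nhds x. 0 < k y - h y"
      by (rule order_tendstoD(1))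
    then obtain S where S: "open S" "x \<in> S" "\<And>y. y \<in> S \<Longrightarrow> h y < k y" by (auto simp: eventually_nhds)
    then show ?thesis using d by (intro exI[of _ S]) (auto simp: lower_on_def smin_eq_left less_imp_le)
  qed
  show "smooth_function A ?h"
    unfolding smooth_function_iff
  proof (intro ballI)
    fix \<kappa> x assume \<kappa>: "\<kappa> \<in> A" "x \<in> domain \<kappa>"
    show "smooth_in \<kappa> ?h x"
    proof (cases "x \<in> G")
      case True
      then have "smooth_in \<kappa> (\<lambda>x. smin d (h x) (k x)) x"
        using sub by (intro smooth_in_smin hs ks \<kappa> chart) auto
      from smooth_in_cong[OF chart[OF \<kappa>(1)] \<kappa>(2) G True inside[symmetric] this] show ?thesis .
    next
      case False
      from outside[OF this] obtain S where "open S" "x \<in> S" "\<And>y. y \<in> S \<Longrightarrow> h y = ?h y" by blast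
      from smooth_in_cong[OF chart[OF \<kappa>(1)] \<kappa>(2) this hs[OF \<kappa>]] show ?thesis .
    qed
  qed
  show "increasing_on UNIV ?h"
    unfolding increasing_on_def
  proof (intro ballI impI)
    fix x \<kappa> assume x: "x \<in> UNIV - crit" and \<kappa>: "\<kappa> \<in> A" "x \<in> domain \<kappa>"
    note c = chart[OF \<kappa>(1)] and X = Z_model[OF \<kappa>]
    have hp: "0 < chart_deriv \<kappa> h x (Z x \<kappa>)" using hZ x \<kappa> by (auto simp: increasing_on_def)
    show "0 < chart_deriv \<kappa> ?h x (Z x \<kappa>)"
    proof (cases "x \<in> G")
      case True
      have kp: "0 < chart_deriv \<kappa> k x (Z x \<kappa>)" using kZ x \<kappa> True by (auto simp: increasing_on_def)
      have kx: "smooth_in \<kappa> k x" using ks[OF \<kappa>] True sub by auto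
      define r where "r = ramp_slope ((h x - k x) / d)"
      have r: "0 \<le> r" "r \<le> 1" using ramp_slope_bounds by (auto simp: r_def)
      have "chart_deriv \<kappa> ?h x (Z x \<kappa>) = chart_deriv \<kappa> (\<lambda>x. smin d (h x) (k x)) x (Z x \<kappa>)"
        by (rule chart_deriv_cong[OF c \<kappa>(2) X G True inside])
      also have "\<dots> = (1 - r) * chart_deriv \<kappa> h x (Z x \<kappa>) + r * chart_deriv \<kappa> k x (Z x \<kappa>)"
        using chart_deriv_smin[OF c \<kappa>(2) X hs[OF \<kappa>] kx d] by (simp add: r_def)
      also have "0 < \<dots>"
      proof (cases "r = 0")
        case False
        then have "0 < r * chart_deriv \<kappa> k x (Z x \<kappa>)" "0 \<le> (1 - r) * chart_deriv \<kappa> h x (Z x \<kappa>)"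
          using r kp hp by auto
        then show ?thesis by linarith
      qed (use hp in simp)
      finally show ?thesis .
    next
      case False
      from outside[OF this] obtain S where "open S" "x \<in> S" "\<And>y. y \<in> S \<Longrightarrow> h y = ?h y" by blast
      from chart_deriv_cong[OF c \<kappa>(2) X this] hp show ?thesis by simp
    qed
  qed
  show "lower_on d G k h x \<le> h x" "x \<notin> G \<Longrightarrow> lower_on d G k h x = h x" "x \<in> G \<Longrightarrow> lower_on d G k h x \<le> k x + d"
    using d by (auto simp: lower_on_def smin_le_left smin_le_right)
qed

text \<open>The closed set \<open>C\<close> keeps the support of the modification inside \<open>U\<close>, and its complement provides neighbourhoods of the
  critical points on which nothing has changed.\<close>

definition lowering :: "'v set \<Rightarrow> ('v \<Rightarrow> real) \<Rightarrow> bool" where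
  "lowering U h \<longleftrightarrow> smooth_function A h \<and> increasing_on UNIV h \<and> (\<forall>x. h x \<le> f x) \<and>
     (\<exists>C. closed C \<and> C \<subseteq> U \<and> C \<inter> crit = {} \<and> (\<forall>x. x \<notin> C \<longrightarrow> h x = f x))"

lemma lowering_f: "lowering U f"
  using smooth_f increasing_f by (auto simp: lowering_def intro: exI[of _ "{}"])

lemma lowering_lower_on:
  assumes h: "lowering U h" and G: "open G" and Q: "closed Q" "Q \<subseteq> U" "Q \<inter> crit = {}" and sub: "G \<subseteq> Q"
    and k: "smooth_near Q k" and bd: "\<And>x. x \<in> Q - G \<Longrightarrow> h x < k x" and kZ: "increasing_on G k" and d: "0 < d"
  shows "lowering U (lower_on d G k h)"
proof -
  obtain C where C: "closed C" "C \<subseteq> U" "C \<inter> crit = {}" "\<And>x. x \<notin> C \<Longrightarrow> h x = f x"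
    and hh: "smooth_function A h" "increasing_on UNIV h" "\<And>x. h x \<le> f x"
    using h unfolding lowering_def by blast
  note l = lower_on[OF hh(1) G Q(1) sub k bd hh(2) kZ d]
  have "lower_on d G k h x \<le> f x" for x using l(3)[of x] hh(3)[of x] by simp
  moreover have "\<exists>C. closed C \<and> C \<subseteq> U \<and> C \<inter> crit = {} \<and> (\<forall>x. x \<notin> C \<longrightarrow> lower_on d G k h x = f x)"
  proof (intro exI[of _ "C \<union> Q"] conjI allI impI)
    fix x assume "x \<notin> C \<union> Q"
    then have "x \<notin> G" "h x = f x" using sub C(4) by auto
    then show "lower_on d G k h x = f x" using l(4) by simp
  qed (use C Q in auto)
  ultimately show ?thesis using l(1,2) unfolding lowering_def by blast
qed

lemma lowering_smin:
  assumes h: "lowering U h" and k: "lowering U k" and d: "0 < d"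
  shows "lowering U (\<lambda>x. smin d (h x) (k x))"
proof -
  obtain C where C: "closed C" "C \<subseteq> U" "C \<inter> crit = {}" "\<And>x. x \<notin> C \<Longrightarrow> h x = f x"
    and hh: "smooth_function A h" "increasing_on UNIV h" "\<And>x. h x \<le> f x"
    using h unfolding lowering_def by blast
  obtain C' where C': "closed C'" "C' \<subseteq> U" "C' \<inter> crit = {}" "\<And>x. x \<notin> C' \<Longrightarrow> k x = f x"
    and kk: "smooth_function A k" "increasing_on UNIV k" "\<And>x. k x \<le> f x"
    using k unfolding lowering_def by blast
  have eq: "lower_on d UNIV k h = (\<lambda>x. smin d (h x) (k x))" by (auto simp: lower_on_def)
  have "smooth_near UNIV k" "increasing_on UNIV k" using kk by (simp_all add: smooth_near_UNIV)
  moreover have "\<And>x. x \<in> UNIV - UNIV \<Longrightarrow> h x < k x" by simp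
  ultimately have l: "smooth_function A (\<lambda>x. smin d (h x) (k x))" "increasing_on UNIV (\<lambda>x. smin d (h x) (k x))"
    using lower_on(1,2)[OF hh(1) open_UNIV closed_UNIV subset_UNIV _ _ hh(2) _ d, of k] unfolding eq by blast+
  have "smin d (h x) (k x) \<le> f x" for x using smin_le_left[OF d, of "h x" "k x"] hh(3)[of x] by simp
  moreover have "\<exists>C. closed C \<and> C \<subseteq> U \<and> C \<inter> crit = {} \<and> (\<forall>x. x \<notin> C \<longrightarrow> smin d (h x) (k x) = f x)"
    by (rule exI[of _ "C \<union> C'"]) (use C C' d in \<open>auto simp: smin_eq_left\<close>)
  ultimately show ?thesis using l(1,2) unfolding lowering_def by blast
qed

end

section \<open>Tubes around trajectories\<close>

lemma increasing_inverse_uniform: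
  fixes \<theta> :: "real \<Rightarrow> real"
  assumes T: "0 < T" and m: "0 < m"
    and d: "\<And>t. t \<in> {-T..T} \<Longrightarrow> (\<theta> has_real_derivative \<theta>' t) (at t) \<and> m \<le> \<theta>' t"
  obtains \<iota> where "\<And>s. s \<in> {\<theta> 0 - m * T<..<\<theta> 0 + m * T} \<Longrightarrow>
      \<iota> s \<in> {-T..T} \<and> \<theta> (\<iota> s) = s \<and> (\<iota> has_real_derivative inverse (\<theta>' (\<iota> s))) (at s)"
    "\<And>s. s \<in> {\<theta> 0 - m * T<..<\<theta> 0 + m * T} \<Longrightarrow> s \<le> \<theta> 0 \<Longrightarrow> \<iota> s \<le> 0" "\<iota> (\<theta> 0) = 0"
proof -
  have grow: "m * (b - a) \<le> \<theta> b - \<theta> a" if "a \<in> {-T..T}" "b \<in> {-T..T}" "a \<le> b" for a b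
  proof -
    have "\<theta> a - m * a \<le> \<theta> b - m * b"
    proof (rule DERIV_nonneg_imp_nondecreasing[of a b "\<lambda>t. \<theta> t - m * t", OF that(3)])
      fix t assume "a \<le> t" "t \<le> b"
      then have t: "t \<in> {-T..T}" using that by auto
      have "((\<lambda>t. \<theta> t - m * t) has_real_derivative \<theta>' t - m) (at t)"
        using d[OF t] by (auto intro!: derivative_eq_intros)
      then show "\<exists>y. ((\<lambda>t. \<theta> t - m * t) has_real_derivative y) (at t) \<and> 0 \<le> y"
        using d[OF t] by (intro exI[of _ "\<theta>' t - m"]) auto
    qed
    then show ?thesis by (simp add: algebra_simps)
  qed
  have inv: "\<exists>t\<in>{-T..T}. \<theta> t = s" if s: "s \<in> {\<theta> 0 - m * T<..<\<theta> 0 + m * T}" for s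
  proof -
    have "\<theta> (- T) \<le> s" "s \<le> \<theta> T" using grow[of "-T" 0] grow[of 0 T] T s by auto
    moreover have "isCont \<theta> t" if "t \<in> {-T..T}" for t using d[OF that] DERIV_isCont by blast
    ultimately obtain t where "-T \<le> t" "t \<le> T" "\<theta> t = s"
      using IVT[of \<theta> "-T" s T] T by auto
    then show ?thesis by auto
  qed
  define \<iota> where "\<iota> s = (SOME t. t \<in> {-T..T} \<and> \<theta> t = s)" for s
  have \<iota>: "\<iota> s \<in> {-T..T}" "\<theta> (\<iota> s) = s" if "s \<in> {\<theta> 0 - m * T<..<\<theta> 0 + m * T}" for s
  proof -
    have "\<exists>t. t \<in> {-T..T} \<and> \<theta> t = s" using inv[OF that] by blast
    from someI_ex[OF this] show "\<iota> s \<in> {-T..T}" "\<theta> (\<iota> s) = s" by (simp_all add: \<iota>_def)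
  qed
  have lip: "m * \<bar>a - b\<bar> \<le> \<bar>\<theta> a - \<theta> b\<bar>" if "a \<in> {-T..T}" "b \<in> {-T..T}" for a b
    using grow[of a b] grow[of b a] that by (cases "a \<le> b") (auto simp: abs_if)
  have cont: "isCont \<iota> s" if s: "s \<in> {\<theta> 0 - m * T<..<\<theta> 0 + m * T}" for s
  proof -
    have "continuous_on {\<theta> 0 - m * T<..<\<theta> 0 + m * T} \<iota>"
      unfolding continuous_on_iff
    proof (intro ballI allI impI)
      fix a and e :: real assume a: "a \<in> {\<theta> 0 - m * T<..<\<theta> 0 + m * T}" and e: "0 < e"
      show "\<exists>d>0. \<forall>b\<in>{\<theta> 0 - m * T<..<\<theta> 0 + m * T}. dist b a < d \<longrightarrow> dist (\<iota> b) (\<iota> a) < e"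
      proof (intro exI[of _ "m * e"] conjI ballI impI)
        fix b assume b: "b \<in> {\<theta> 0 - m * T<..<\<theta> 0 + m * T}" "dist b a < m * e"
        have "m * \<bar>\<iota> b - \<iota> a\<bar> < m * e"
          using lip[OF \<iota>(1)[OF b(1)] \<iota>(1)[OF a]] \<iota>(2)[OF a] \<iota>(2)[OF b(1)] b(2) by (simp add: dist_real_def)
        then show "dist (\<iota> b) (\<iota> a) < e" using m by (simp add: dist_real_def)
      qed (use m e in simp)
    qed
    then show ?thesis using s continuous_on_eq_continuous_at open_greaterThanLessThan by blast
  qed
  have der: "(\<iota> has_real_derivative inverse (\<theta>' (\<iota> s))) (at s)" if s: "s \<in> {\<theta> 0 - m * T<..<\<theta> 0 + m * T}" for s
    by (rule DERIV_inverse_function[of \<theta> _ _ _ "\<theta> 0 - m * T" "\<theta> 0 + m * T"])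
       (use d[OF \<iota>(1)[OF s]] m s \<iota>(2) cont[OF s] in auto)
  have z: "\<theta> 0 \<in> {\<theta> 0 - m * T<..<\<theta> 0 + m * T}" using m T by simp
  show thesis
  proof (rule that[of \<iota>])
    show "\<iota> s \<le> 0" if "s \<in> {\<theta> 0 - m * T<..<\<theta> 0 + m * T}" "s \<le> \<theta> 0" for s
    proof (rule ccontr)
      assume "\<not> \<iota> s \<le> 0"
      then have "m * (\<iota> s - 0) \<le> \<theta> (\<iota> s) - \<theta> 0" "0 < m * \<iota> s" using grow[of 0 "\<iota> s"] \<iota>[OF that(1)] T m by auto
      then show False using \<iota>(2)[OF that(1)] that(2) by simp
    qed
    show "\<iota> (\<theta> 0) = 0" using lip[OF \<iota>(1)[OF z], of 0] \<iota>(2)[OF z] T m by (auto simp: mult_le_0_iff)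
  qed (use \<iota> der in auto)
qed

text \<open>The speed \<open>g = V(\<phi>)\<close> is bounded below near \<open>y\<close>, so during the uniform time of existence of the trajectories \<open>\<gamma>\<close> the
  values of \<open>\<phi>\<close> sweep a range of uniform length \<open>\<tau>\<close>. On it the value of \<open>\<phi>\<close> can replace the time, which turns
  \<open>V\<close> into \<open>Y = V / V(\<phi>)\<close>.\<close>

lemma level_trajectories:
  fixes V :: "'a::euclidean_space \<Rightarrow> 'a" and \<phi> :: "'a \<Rightarrow> real"
  assumes T: "open T" and \<phi>: "Cinf_on T \<phi>" and V: "Cinf_on T V" and y: "y \<in> T"
    and g_def: "\<And>y. g y = frechet_derivative \<phi> (at y) (V y)" and pos: "\<And>y. y \<in> T \<Longrightarrow> 0 < g y"
    and Y_def: "\<And>y. Y y = inverse (g y) *\<^sub>R V y"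
  obtains R L \<tau> where "0 < R" "0 \<le> L" "0 < \<tau>" "cball y R \<subseteq> T" "Cinf_on T Y"
    "\<And>a b. a \<in> cball y R \<Longrightarrow> b \<in> cball y R \<Longrightarrow> norm (Y a - Y b) \<le> L * norm (a - b)"
    "\<And>w. w \<in> cball y (R / 4) \<Longrightarrow> \<exists>\<gamma> \<iota> T0. 0 < T0 \<and> \<gamma> 0 = w \<and>
       (\<forall>t\<in>{-T0<..<T0}. \<gamma> t \<in> cball y (R / 2) \<and> (\<gamma> has_vector_derivative V (\<gamma> t)) (at t)) \<and>
       (\<forall>s\<in>{\<phi> w - \<tau><..<\<phi> w + \<tau>}. \<iota> s \<in> {-T0<..<T0} \<and> \<phi> (\<gamma> (\<iota> s)) = s \<and> (s \<le> \<phi> w \<longrightarrow> \<iota> s \<le> 0) \<and>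
          ((\<lambda>s. \<gamma> (\<iota> s)) has_vector_derivative Y (\<gamma> (\<iota> s))) (at s)) \<and> \<iota> (\<phi> w) = 0"
proof -
  have gC: "Cinf_on T g"
    by (rule Cinf_on_cong[OF T g_def[symmetric] Cinf_on_frechet_derivative_apply[OF T \<phi> V]])
  have "Cinf_on T (\<lambda>y. inverse (g y))"
    by (rule Cinf_on_compose[OF T _ _ gC Cinf_on_inverse]) (use pos in force)+
  then have "Cinf_on T (\<lambda>y. inverse (g y) *\<^sub>R V y)" using V T by (intro Cinf_on_scaleR)
  then have YC: "Cinf_on T Y" by (rule Cinf_on_cong[OF T Y_def[symmetric]])
  obtain R1 L1 where R1: "0 < R1" "0 \<le> L1" "cball y R1 \<subseteq> T"
    "\<And>a b. a \<in> cball y R1 \<Longrightarrow> b \<in> cball y R1 \<Longrightarrow> norm (Y a - Y b) \<le> L1 * norm (a - b)"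
    using Cinf_on_locally_lipschitz[OF T YC y] by blast
  obtain R2 L2 where R2: "0 < R2" "0 \<le> L2" "cball y R2 \<subseteq> T"
    "\<And>a b. a \<in> cball y R2 \<Longrightarrow> b \<in> cball y R2 \<Longrightarrow> norm (V a - V b) \<le> L2 * norm (a - b)"
    using Cinf_on_locally_lipschitz[OF T V y] by blast
  define R where "R = min R1 R2"
  have R: "0 < R" "R \<le> R1" "R \<le> R2" using R1 R2 by (auto simp: R_def)
  have RT: "cball y R \<subseteq> T" using R R1(3) subset_cball[of R R1 y] by blast
  have "continuous_on (cball y R) g" using Cinf_on_continuous_on[OF T gC] RT continuous_on_subset by blast
  then obtain y1 where y1: "y1 \<in> cball y R" "\<And>x. x \<in> cball y R \<Longrightarrow> g y1 \<le> g x"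
    using continuous_attains_inf[of "cball y R" g] R by auto
  define m where "m = g y1"
  have m: "0 < m" using pos y1 RT by (auto simp: m_def)
  have R2': "0 < R / 2" using R by simp
  have lipV: "norm (V a - V b) \<le> L2 * norm (a - b)" if "a \<in> cball y (R / 2)" "b \<in> cball y (R / 2)" for a b
    using R2(4)[of a b] that R by auto
  obtain T0 where T0: "0 < T0" and pic: "\<And>w. w \<in> cball y (R / 2 / 2) \<Longrightarrow> \<exists>\<gamma>. \<gamma> 0 = w \<and>
      (\<forall>t\<in>{-T0<..<T0}. \<gamma> t \<in> cball y (R / 2) \<and> (\<gamma> has_vector_derivative V (\<gamma> t)) (at t))"
    using picard_uniform[OF R2' R2(2) lipV] by blast
  have loc: "\<exists>\<gamma> \<iota> T0. 0 < T0 \<and> \<gamma> 0 = w \<and>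
       (\<forall>t\<in>{-T0<..<T0}. \<gamma> t \<in> cball y (R / 2) \<and> (\<gamma> has_vector_derivative V (\<gamma> t)) (at t)) \<and>
       (\<forall>s\<in>{\<phi> w - m * (T0 / 2)<..<\<phi> w + m * (T0 / 2)}. \<iota> s \<in> {-T0<..<T0} \<and> \<phi> (\<gamma> (\<iota> s)) = s \<and> (s \<le> \<phi> w \<longrightarrow> \<iota> s \<le> 0) \<and>
          ((\<lambda>s. \<gamma> (\<iota> s)) has_vector_derivative Y (\<gamma> (\<iota> s))) (at s)) \<and> \<iota> (\<phi> w) = 0 \<and> T0 = T0'"
    if w: "w \<in> cball y (R / 4)" and T0': "T0' = T0" for w T0'
  proof -
    obtain \<gamma> where \<gamma>: "\<gamma> 0 = w" "\<And>t. t \<in> {-T0<..<T0} \<Longrightarrow> \<gamma> t \<in> cball y (R / 2)"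
      "\<And>t. t \<in> {-T0<..<T0} \<Longrightarrow> (\<gamma> has_vector_derivative V (\<gamma> t)) (at t)"
      using pic[of w] w by auto
    have \<gamma>R: "\<gamma> t \<in> cball y R" if "t \<in> {-T0<..<T0}" for t using \<gamma>(2)[OF that] R by auto
    have d: "((\<lambda>t. \<phi> (\<gamma> t)) has_real_derivative g (\<gamma> t)) (at t) \<and> m \<le> g (\<gamma> t)" if "t \<in> {-(T0/2)..T0/2}" for t
    proof -
      have t: "t \<in> {-T0<..<T0}" using that T0 by auto
      have "(\<phi> has_derivative frechet_derivative \<phi> (at (\<gamma> t))) (at (\<gamma> t))"
        using Cinf_on_has_derivative[OF T \<phi>] RT \<gamma>R[OF t] by blast
      from vector_derivative_diff_chain_within[OF \<gamma>(3)[OF t] has_derivative_at_withinI[OF this]]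
      show ?thesis using y1(2)[OF \<gamma>R[OF t]] by (simp add: g_def o_def m_def has_real_derivative_iff_has_vector_derivative)
    qed
    have T02: "0 < T0 / 2" using T0 by simp
    obtain \<iota> where \<iota>: "\<And>s. s \<in> {\<phi> w - m * (T0 / 2)<..<\<phi> w + m * (T0 / 2)} \<Longrightarrow>
        \<iota> s \<in> {-(T0/2)..T0/2} \<and> \<phi> (\<gamma> (\<iota> s)) = s \<and> (\<iota> has_real_derivative inverse (g (\<gamma> (\<iota> s)))) (at s)"
      "\<And>s. s \<in> {\<phi> w - m * (T0 / 2)<..<\<phi> w + m * (T0 / 2)} \<Longrightarrow> s \<le> \<phi> w \<Longrightarrow> \<iota> s \<le> 0" "\<iota> (\<phi> w) = 0"
      using increasing_inverse_uniform[OF T02 m d, unfolded \<gamma>(1)] by blast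
    have "((\<lambda>s. \<gamma> (\<iota> s)) has_vector_derivative Y (\<gamma> (\<iota> s))) (at s)" "\<iota> s \<in> {-T0<..<T0}"
      if s: "s \<in> {\<phi> w - m * (T0 / 2)<..<\<phi> w + m * (T0 / 2)}" for s
    proof -
      show t: "\<iota> s \<in> {-T0<..<T0}" using \<iota>(1)[OF s] T0 by auto
      have "(\<iota> has_vector_derivative inverse (g (\<gamma> (\<iota> s)))) (at s)"
        using \<iota>(1)[OF s] by (simp add: has_real_derivative_iff_has_vector_derivative)
      from vector_diff_chain_at[OF this \<gamma>(3)[OF t]]
      show "((\<lambda>s. \<gamma> (\<iota> s)) has_vector_derivative Y (\<gamma> (\<iota> s))) (at s)" by (simp add: o_def Y_def)
    qed
    then show ?thesis
      using T0 T0' \<gamma> \<iota> by (intro exI[of _ \<gamma>] exI[of _ \<iota>] exI[of _ T0]) auto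
  qed
  show thesis
  proof (rule that[of R L1 "m * (T0 / 2)"])
    show "norm (Y a - Y b) \<le> L1 * norm (a - b)" if "a \<in> cball y R" "b \<in> cball y R" for a b
      using R1(4)[of a b] that R by auto
    fix w assume "w \<in> cball y (R / 4)"
    from loc[OF this refl] show "\<exists>\<gamma> \<iota> T0'. 0 < T0' \<and> \<gamma> 0 = w \<and>
       (\<forall>t\<in>{-T0'<..<T0'}. \<gamma> t \<in> cball y (R / 2) \<and> (\<gamma> has_vector_derivative V (\<gamma> t)) (at t)) \<and>
       (\<forall>s\<in>{\<phi> w - m * (T0 / 2)<..<\<phi> w + m * (T0 / 2)}. \<iota> s \<in> {-T0'<..<T0'} \<and> \<phi> (\<gamma> (\<iota> s)) = s \<and> (s \<le> \<phi> w \<longrightarrow> \<iota> s \<le> 0) \<and>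
          ((\<lambda>s. \<gamma> (\<iota> s)) has_vector_derivative Y (\<gamma> (\<iota> s))) (at s)) \<and> \<iota> (\<phi> w) = 0"
      by blast
  qed (use R RT R1 m T0 YC in auto)
qed

text \<open>The barrier of a tube: \<open>\<eta>\<close> is a trajectory of \<open>Y = V / V(\<phi>)\<close>, so the squared distance
  \<open>\<bar>y - \<eta>(\<phi> y)\<bar>\<^sup>2\<close> to its point of the same level shrinks along \<open>Y\<close> at most at the
  rate \<open>2 L\<close>, where \<open>L\<close> is a Lipschitz constant of \<open>Y\<close>; the factor \<open>exp (2 L \<phi>)\<close> compensates for it.\<close>

definition tube_barrier :: "('a::euclidean_space \<Rightarrow> real) \<Rightarrow> (real \<Rightarrow> 'a) \<Rightarrow> real \<Rightarrow> real \<Rightarrow> real \<Rightarrow> real \<Rightarrow> real \<Rightarrow> real \<Rightarrow> 'a \<Rightarrow> real"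
  where "tube_barrier \<phi> \<eta> L m e b s A y =
    m + e * exp (b * (\<phi> y - s)) + A * (exp (2 * L * \<phi> y) * ((y - \<eta> (\<phi> y)) \<bullet> (y - \<eta> (\<phi> y))))"

lemma tube_barrier:
  fixes V :: "'a::euclidean_space \<Rightarrow> 'a" and \<phi> :: "'a \<Rightarrow> real"
  assumes T: "open T" and \<phi>: "Cinf_on T \<phi>" and S: "open S" and \<eta>: "Cinf_on S \<eta>" and TS: "\<phi> ` T \<subseteq> S"
    and g_def: "\<And>y. g y = frechet_derivative \<phi> (at y) (V y)" and pos: "\<And>y. y \<in> T \<Longrightarrow> 0 < g y"
    and Y_def: "\<And>y. Y y = inverse (g y) *\<^sub>R V y"
    and ode: "\<And>s. s \<in> S \<Longrightarrow> (\<eta> has_vector_derivative Y (\<eta> s)) (at s)"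
    and lip: "\<And>y. y \<in> T \<Longrightarrow> norm (Y y - Y (\<eta> (\<phi> y))) \<le> L * norm (y - \<eta> (\<phi> y))"
    and coeffs: "0 < e" "0 < b" "0 \<le> A"
  shows "Cinf_on T (tube_barrier \<phi> \<eta> L m e b s A)"
    and "y \<in> T \<Longrightarrow> 0 < frechet_derivative (tube_barrier \<phi> \<eta> L m e b s A) (at y) (V y)"
proof -
  have \<eta>\<phi>: "Cinf_on T (\<lambda>y. \<eta> (\<phi> y))" by (rule Cinf_on_compose[OF T S TS \<phi> \<eta>])
  have ex: "Cinf_on T (\<lambda>y. exp (u y))" if "Cinf_on T u" for u :: "'a \<Rightarrow> real"
    by (rule Cinf_on_compose[OF T open_UNIV _ that Cinf_on_exp]) auto
  show "Cinf_on T (tube_barrier \<phi> \<eta> L m e b s A)"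
    unfolding tube_barrier_def
    by (intro T \<phi> \<eta>\<phi> ex Cinf_on_add Cinf_on_diff Cinf_on_mult Cinf_on_inner Cinf_on_const
        Cinf_on_linear bounded_linear_ident)
  assume y: "y \<in> T"
  define \<phi>' where "\<phi>' = frechet_derivative \<phi> (at y)"
  have d\<phi>: "(\<phi> has_derivative \<phi>') (at y)" using Cinf_on_has_derivative[OF T \<phi> y] by (simp add: \<phi>'_def)
  have "\<phi> y \<in> S" using TS y by auto
  then have "(\<eta> has_derivative (\<lambda>h. h *\<^sub>R Y (\<eta> (\<phi> y)))) (at (\<phi> y))"
    using ode by (simp add: has_vector_derivative_def)
  from has_derivative_compose[OF d\<phi> this]
  have d\<eta>: "((\<lambda>y. \<eta> (\<phi> y)) has_derivative (\<lambda>v. \<phi>' v *\<^sub>R Y (\<eta> (\<phi> y)))) (at y)" .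
  define q where "q y = (y - \<eta> (\<phi> y)) \<bullet> (y - \<eta> (\<phi> y))" for y
  define q' where "q' v = 2 * ((y - \<eta> (\<phi> y)) \<bullet> (v - \<phi>' v *\<^sub>R Y (\<eta> (\<phi> y))))" for v
  have "((\<lambda>y. y - \<eta> (\<phi> y)) has_derivative (\<lambda>v. v - \<phi>' v *\<^sub>R Y (\<eta> (\<phi> y)))) (at y)"
    by (intro has_derivative_diff has_derivative_ident d\<eta>)
  from has_derivative_inner[OF this this]
  have dq: "(q has_derivative q') (at y)"
    unfolding q_def[abs_def] by (rule has_derivative_eq_rhs) (simp add: q'_def inner_commute fun_eq_iff)
  let ?D = "\<lambda>v. e * (exp (b * (\<phi> y - s)) * (b * \<phi>' v)) +
     A * (exp (2 * L * \<phi> y) * q' v + exp (2 * L * \<phi> y) * (2 * L * \<phi>' v) * q y)"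
  have "((\<lambda>y. m + e * exp (b * (\<phi> y - s)) + A * (exp (2 * L * \<phi> y) * q y)) has_derivative ?D) (at y)"
    by (rule derivative_eq_intros d\<phi> dq refl)+ (simp add: fun_eq_iff algebra_simps)
  then have "(tube_barrier \<phi> \<eta> L m e b s A has_derivative ?D) (at y)"
    by (simp add: tube_barrier_def[abs_def] q_def)
  then have eq: "frechet_derivative (tube_barrier \<phi> \<eta> L m e b s A) (at y) = ?D"
    by (rule frechet_derivative_at[symmetric])
  have g: "\<phi>' (V y) = g y" "0 < g y" using g_def pos[OF y] by (auto simp: \<phi>'_def)
  have "V y - g y *\<^sub>R Y (\<eta> (\<phi> y)) = g y *\<^sub>R (Y y - Y (\<eta> (\<phi> y)))"
    using g(2) by (simp add: Y_def scaleR_diff_right)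
  then have "q' (V y) = 2 * g y * ((y - \<eta> (\<phi> y)) \<bullet> (Y y - Y (\<eta> (\<phi> y))))"
    by (simp add: q'_def g)
  moreover have "- (L * q y) \<le> (y - \<eta> (\<phi> y)) \<bullet> (Y y - Y (\<eta> (\<phi> y)))"
  proof -
    have "\<bar>(y - \<eta> (\<phi> y)) \<bullet> (Y y - Y (\<eta> (\<phi> y)))\<bar> \<le> norm (y - \<eta> (\<phi> y)) * norm (Y y - Y (\<eta> (\<phi> y)))"
      by (rule Cauchy_Schwarz_ineq2)
    also have "\<dots> \<le> norm (y - \<eta> (\<phi> y)) * (L * norm (y - \<eta> (\<phi> y)))"
      by (intro mult_left_mono lip[OF y]) auto
    also have "\<dots> = L * q y" by (simp add: q_def dot_square_norm power2_eq_square)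
    finally show ?thesis by linarith
  qed
  then have "2 * g y * - (L * q y) \<le> 2 * g y * ((y - \<eta> (\<phi> y)) \<bullet> (Y y - Y (\<eta> (\<phi> y))))"
    using g(2) by (intro mult_left_mono) auto
  ultimately have "0 \<le> q' (V y) + 2 * L * g y * q y" by (simp add: algebra_simps)
  then have "0 \<le> A * (exp (2 * L * \<phi> y) * (q' (V y) + 2 * L * g y * q y))"
    using coeffs by (intro mult_nonneg_nonneg) auto
  moreover have "0 < e * (exp (b * (\<phi> y - s)) * (b * g y))" using coeffs g by simp
  ultimately show "0 < frechet_derivative (tube_barrier \<phi> \<eta> L m e b s A) (at y) (V y)"
    by (simp add: eq g algebra_simps)
qed

lemma subspace_projection:
  fixes M :: "'a::euclidean_space set"
  assumes "subspace M"
  obtains \<pi> where "bounded_linear \<pi>" "\<And>y. \<pi> y \<in> M" "\<And>y. y \<in> M \<Longrightarrow> \<pi> y = y"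
proof -
  obtain B where B: "B \<subseteq> M" "pairwise orthogonal B" "\<And>x. x \<in> B \<Longrightarrow> norm x = 1" "independent B" "span B = M"
    using orthonormal_basis_subspace[OF assms] by metis
  have fin: "finite B" using B(4) by (rule independent_imp_finite)
  define \<pi> where "\<pi> y = (\<Sum>b\<in>B. (y \<bullet> b) *\<^sub>R b)" for y
  have "bounded_linear \<pi>"
    unfolding \<pi>_def by (intro bounded_linear_sum bounded_linear_scaleR_const bounded_linear_inner_left)
  moreover have "\<pi> y \<in> M" for y
    unfolding \<pi>_def using assms B(1) by (intro subspace_sum subspace_scale) auto
  moreover have "\<pi> y = y" if "y \<in> M" for y
  proof -
    have "y \<in> range (\<lambda>u. \<Sum>v\<in>B. u v *\<^sub>R v)" using that B(5) span_finite[OF fin] by simp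
    then obtain q where q: "y = (\<Sum>b\<in>B. q b *\<^sub>R b)" by blast
    have "y \<bullet> b = q b" if b: "b \<in> B" for b
    proof -
      have "y \<bullet> b = (\<Sum>b'\<in>B. q b' * (b' \<bullet> b))" by (simp add: q inner_sum_left)
      also have "\<dots> = (\<Sum>b'\<in>B. if b' = b then q b else 0)"
        using B(2,3) b by (intro sum.cong) (auto simp: pairwise_def orthogonal_def norm_eq_1)
      also have "\<dots> = q b" using fin b by simp
      finally show ?thesis .
    qed
    then show ?thesis unfolding \<pi>_def by (simp add: q cong: sum.cong)
  qed
  ultimately show thesis using that by blast
qed

lemma open_vimage_on: "open s \<Longrightarrow> continuous_on s h \<Longrightarrow> open B \<Longrightarrow> open (h -` B \<inter> s)"
  by (simp add: continuous_on_open_vimage)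

context manifold_field
begin

lemma integral_curve_in_chart:
  assumes \<kappa>: "is_chart \<kappa>" and tr: "\<And>\<kappa>'. \<kappa>' \<in> A \<Longrightarrow> smooth_transition \<kappa> \<kappa>'"
    and I: "open I" "is_interval I" "0 \<in> I"
    and \<gamma>: "\<And>t. t \<in> I \<Longrightarrow> \<gamma> t \<in> codomain \<kappa>" "\<And>t. t \<in> I \<Longrightarrow> \<zeta> t \<in> model \<kappa>"
    and d\<gamma>: "\<And>t. t \<in> I \<Longrightarrow> (\<gamma> has_vector_derivative \<zeta> t) (at t)"
    and Z: "\<And>t \<kappa>'. t \<in> I \<Longrightarrow> \<kappa>' \<in> A \<Longrightarrow> chart_inv \<kappa> (\<gamma> t) \<in> domain \<kappa>' \<Longrightarrow>
       dir_deriv (coord \<kappa>' \<circ> chart_inv \<kappa>) (\<gamma> t) (\<zeta> t) = Z (chart_inv \<kappa> (\<gamma> t)) \<kappa>'"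
  shows "integral_curve A Z (chart_inv \<kappa> (\<gamma> 0)) I (\<lambda>t. chart_inv \<kappa> (\<gamma> t))"
proof -
  have c\<gamma>: "continuous_on I \<gamma>"
    using d\<gamma> has_vector_derivative_continuous by (intro continuous_at_imp_continuous_on) blast
  have "continuous_on I (\<lambda>t. chart_inv \<kappa> (\<gamma> t))"
    by (rule continuous_on_compose2[OF is_chartD(5)[OF \<kappa>] c\<gamma>]) (use \<gamma> in auto)
  moreover have "((coord \<kappa>' \<circ> (\<lambda>t. chart_inv \<kappa> (\<gamma> t))) has_vector_derivative Z (chart_inv \<kappa> (\<gamma> t)) \<kappa>') (at t)"
    if t: "t \<in> I" and \<kappa>': "\<kappa>' \<in> A" "chart_inv \<kappa> (\<gamma> t) \<in> domain \<kappa>'" for t \<kappa>'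
  proof -
    define x where "x = chart_inv \<kappa> (\<gamma> t)"
    have x: "x \<in> domain \<kappa>" "coord \<kappa> x = \<gamma> t" using is_chartD(8,9)[OF \<kappa> \<gamma>(1)[OF t]] by (auto simp: x_def)
    obtain T \<tau> where \<tau>: "open T" "coord \<kappa> x \<in> T" "Cinf_on T \<tau>" "\<And>y. y \<in> codomain \<kappa> \<Longrightarrow> y \<in> T \<Longrightarrow> \<tau> y = coord \<kappa>' (chart_inv \<kappa> y)"
      using smooth_inE[OF smooth_in_coord[OF \<kappa> chart[OF \<kappa>'(1)] tr[OF \<kappa>'(1)] x(1)]] \<kappa>'(2) unfolding x_def by blast
    have eq: "frechet_derivative \<tau> (at (\<gamma> t)) (\<zeta> t) = Z x \<kappa>'"
      using has_dir_deriv(2)[OF \<kappa> x(1) \<gamma>(2)[OF t] \<tau>] Z[OF t \<kappa>'] x(2) by (simp add: x_def)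
    have "(\<tau> has_derivative frechet_derivative \<tau> (at (\<gamma> t))) (at (\<gamma> t))"
      using Cinf_on_has_derivative[OF \<tau>(1,3,2)] x(2) by simp
    from vector_derivative_diff_chain_within[OF d\<gamma>[OF t] has_derivative_at_withinI[OF this]]
    have der: "((\<tau> \<circ> \<gamma>) has_vector_derivative Z x \<kappa>') (at t)" by (simp add: eq)
    have o: "open (\<gamma> -` T \<inter> I)" by (rule open_vimage_on[OF I(1) c\<gamma> \<tau>(1)])
    have "((coord \<kappa>' \<circ> (\<lambda>t. chart_inv \<kappa> (\<gamma> t))) has_vector_derivative Z x \<kappa>') (at t)"
      by (rule has_vector_derivative_transform_within_open[OF der o]) (use t \<tau> \<gamma> x in auto)
    then show ?thesis by (simp add: x_def)
  qed
  ultimately show ?thesis using I by (simp add: integral_curve_def)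
qed

end

context morse
begin

lemma chart_pullback:
  assumes \<kappa>: "is_chart \<kappa>" and tr: "\<And>\<kappa>'. \<kappa>' \<in> A \<Longrightarrow> smooth_transition \<kappa> \<kappa>' \<and> smooth_transition \<kappa>' \<kappa>"
    and T: "open T" "Cinf_on T k" and x: "x \<in> domain \<kappa>" "coord \<kappa> x \<in> T" and \<kappa>': "\<kappa>' \<in> A" "x \<in> domain \<kappa>'"
  shows "smooth_in \<kappa>' (\<lambda>x. k (coord \<kappa> x)) x"
    and "\<zeta> \<in> model \<kappa> \<Longrightarrow> dir_deriv (coord \<kappa>' \<circ> chart_inv \<kappa>) (coord \<kappa> x) \<zeta> = Z x \<kappa>' \<Longrightarrow>
      chart_deriv \<kappa>' (\<lambda>x. k (coord \<kappa> x)) x (Z x \<kappa>') = frechet_derivative k (at (coord \<kappa> x)) \<zeta>"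
proof -
  have eq: "k y = k (coord \<kappa> (chart_inv \<kappa> y))" if "y \<in> codomain \<kappa>" for y
    using is_chartD(9)[OF \<kappa> that] by simp
  have "smooth_in \<kappa> (\<lambda>x. k (coord \<kappa> x)) x"
    unfolding smooth_in_def using T x eq by blast
  then show s: "smooth_in \<kappa>' (\<lambda>x. k (coord \<kappa> x)) x"
    using change_of_charts(1)[OF chart[OF \<kappa>'(1)] \<kappa>] tr \<kappa>' x(1) by blast
  assume \<zeta>: "\<zeta> \<in> model \<kappa>" "dir_deriv (coord \<kappa>' \<circ> chart_inv \<kappa>) (coord \<kappa> x) \<zeta> = Z x \<kappa>'"
  have "chart_deriv \<kappa>' (\<lambda>x. k (coord \<kappa> x)) x (Z x \<kappa>') = chart_deriv \<kappa> (\<lambda>x. k (coord \<kappa> x)) x \<zeta>"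
    by (rule Z_deriv_change[OF \<kappa> _ x(1) \<kappa>' s \<zeta>]) (use tr \<kappa>' in blast)
  also have "\<dots> = frechet_derivative k (at (coord \<kappa> x)) \<zeta>"
    unfolding chart_deriv_def by (rule has_dir_deriv(2)[OF \<kappa> x(1) \<zeta>(1) T(1) x(2) T(2)]) (rule eq)
  finally show "chart_deriv \<kappa>' (\<lambda>x. k (coord \<kappa> x)) x (Z x \<kappa>') = frechet_derivative k (at (coord \<kappa> x)) \<zeta>" .
qed

text \<open>Near a point that is not critical, going back along a trajectory from \<open>w\<close> to \<open>w\<^sub>1\<close> does not
  make it harder to lower \<open>f\<close>: whatever value can be reached at \<open>w\<^sub>1\<close> can be reached at \<open>w\<close>, up to an arbitrarily
  small loss. The barrier \<open>k\<close> is a thin tube around the trajectory from \<open>w\<^sub>1\<close> to \<open>w\<close>, almost constant along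
  it until \<open>w\<close> and then rising steeply; the large factor of the squared distance to the trajectory closes the tube on the
  sides, and \<open>h\<close> being below \<open>k\<close> near \<open>w\<^sub>1\<close> closes it at the lower end.\<close>

lemma tube:
  assumes U: "open U" and x0: "x\<^sub>0 \<in> U" "x\<^sub>0 \<notin> crit"
  obtains N \<tau> where "open N" "x\<^sub>0 \<in> N" "0 < \<tau>"
    "\<And>w a. w \<in> N \<Longrightarrow> f w - \<tau> \<le> a \<Longrightarrow> a < f w \<Longrightarrow>
      \<exists>w\<^sub>1. f w\<^sub>1 = a \<and> (\<forall>c. w \<in> nappe A Z c \<longrightarrow> w\<^sub>1 \<in> nappe A Z c) \<and>
        (\<forall>h \<mu>. lowering U h \<longrightarrow> h w\<^sub>1 < \<mu> \<longrightarrow> (\<exists>h'. lowering U h' \<and> h' w < \<mu>))"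
proof -
  obtain \<kappa> where \<kappa>: "\<kappa> \<in> A" "x\<^sub>0 \<in> domain \<kappa>" using chart_at by blast
  note ch = is_chartD[OF chart[OF \<kappa>(1)]]
  have trs: "\<And>\<kappa>'. \<kappa>' \<in> A \<Longrightarrow> smooth_transition \<kappa> \<kappa>' \<and> smooth_transition \<kappa>' \<kappa>" using transition \<kappa>(1) by blast
  define M where "M = model \<kappa>"
  define y0 where "y0 = coord \<kappa> x\<^sub>0"
  have y0: "y0 \<in> codomain \<kappa>" "y0 \<in> M" using ch(6)[OF \<kappa>(2)] ch(10) by (auto simp: y0_def M_def)
  obtain \<pi> where \<pi>: "bounded_linear \<pi>" "\<And>y. \<pi> y \<in> M" "\<And>y. y \<in> M \<Longrightarrow> \<pi> y = y"
    using subspace_projection[OF ch(2)] unfolding M_def by blast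
  obtain Tf fh where fh: "open Tf" "y0 \<in> Tf" "Cinf_on Tf fh" "\<And>y. y \<in> codomain \<kappa> \<Longrightarrow> y \<in> Tf \<Longrightarrow> fh y = f (chart_inv \<kappa> y)"
    using smooth_inE[OF smooth_in_f[OF \<kappa>]] unfolding y0_def by blast
  obtain Tz Zh where Zh: "open Tz" "y0 \<in> Tz" "Cinf_on Tz Zh" "\<And>y. y \<in> codomain \<kappa> \<Longrightarrow> y \<in> Tz \<Longrightarrow> Zh y = Z (chart_inv \<kappa> y) \<kappa>"
    using smooth_inE[OF smooth_in_Z[OF \<kappa>]] unfolding y0_def by blast
  obtain Tc where Tc: "open Tc" "codomain \<kappa> = M \<inter> Tc" using codomain_eq_model_Int[OF chart[OF \<kappa>(1)]] unfolding M_def by blast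
  obtain Tu where Tu: "open Tu" "\<And>y. y \<in> codomain \<kappa> \<Longrightarrow> y \<in> Tu \<longleftrightarrow> chart_inv \<kappa> y \<in> U"
    using chart_inv_preimage_open[OF chart[OF \<kappa>(1)] U] by blast
  \<comment> \<open>Precomposing with the projection onto the model space makes the extended field tangent to the model space.\<close>
  define T1 where "T1 = \<pi> -` (Tf \<inter> Tz \<inter> Tc \<inter> Tu)"
  have T1: "open T1"
    unfolding T1_def by (intro open_vimage open_Int fh Zh Tc Tu linear_continuous_on \<pi>)
  have T1_cod: "\<pi> y \<in> codomain \<kappa>" if "y \<in> T1" for y using that \<pi>(2) Tc(2) by (auto simp: T1_def)
  have T1_M: "y \<in> codomain \<kappa>" "\<pi> y = y" "chart_inv \<kappa> y \<in> U" if "y \<in> T1" "y \<in> M" for y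
    using that \<pi>(3) Tc(2) Tu(2)[of y] by (auto simp: T1_def)
  have y0T1: "y0 \<in> T1"
    using y0 fh Zh Tc Tu(2)[OF y0(1)] x0(1) ch(7)[OF \<kappa>(2)] \<pi>(3) by (auto simp: T1_def y0_def)
  define \<phi> where "\<phi> y = fh (\<pi> y)" for y
  define V where "V y = Zh (\<pi> y)" for y
  have \<pi>C: "Cinf_on T1 \<pi>" by (rule Cinf_on_linear[OF T1 \<pi>(1)])
  have \<phi>C: "Cinf_on T1 \<phi>" unfolding \<phi>_def by (rule Cinf_on_compose[OF T1 fh(1) _ \<pi>C fh(3)]) (auto simp: T1_def)
  have VC: "Cinf_on T1 V" unfolding V_def by (rule Cinf_on_compose[OF T1 Zh(1) _ \<pi>C Zh(3)]) (auto simp: T1_def)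
  have \<phi>f: "\<phi> y = f (chart_inv \<kappa> y)" and VZ: "V y = Z (chart_inv \<kappa> y) \<kappa>" if "y \<in> T1" "y \<in> M" for y
    using that T1_M[OF that] fh(4) Zh(4) by (auto simp: \<phi>_def V_def T1_def)
  have VM: "V y \<in> M" if "y \<in> T1" for y
  proof -
    have "V y = Z (chart_inv \<kappa> (\<pi> y)) \<kappa>" using Zh(4)[OF T1_cod[OF that]] that by (auto simp: V_def T1_def)
    then show ?thesis using Z_model[OF \<kappa>(1)] ch(8)[OF T1_cod[OF that]] by (simp add: M_def)
  qed
  define g where "g y = frechet_derivative \<phi> (at y) (V y)" for y
  define Y where "Y y = inverse (g y) *\<^sub>R V y" for y
  have gf: "g (coord \<kappa> x) = chart_deriv \<kappa> f x (Z x \<kappa>)" if "x \<in> domain \<kappa>" "coord \<kappa> x \<in> T1" for x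
  proof -
    have m: "coord \<kappa> x \<in> M" using ch(6)[OF that(1)] ch(10) by (auto simp: M_def)
    have "chart_deriv \<kappa> f x (Z x \<kappa>) = frechet_derivative \<phi> (at (coord \<kappa> x)) (Z x \<kappa>)"
      unfolding chart_deriv_def
      by (rule has_dir_deriv(2)[OF chart[OF \<kappa>(1)] that(1) Z_model[OF \<kappa>(1) that(1)] T1 that(2) \<phi>C])
         (use \<phi>f ch(10) M_def in blast)
    then show ?thesis using VZ[OF that(2) m] ch(7)[OF that(1)] by (simp add: g_def)
  qed
  have gC: "continuous_on T1 g"
    by (rule continuous_on_eq[OF Cinf_on_continuous_on[OF T1 Cinf_on_frechet_derivative_apply[OF T1 \<phi>C VC]] g_def[symmetric]])
  define T where "T = g -` {0<..} \<inter> T1"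
  have T: "open T" unfolding T_def by (rule open_vimage_on[OF T1 gC open_greaterThan])
  have TT1: "T \<subseteq> T1" by (auto simp: T_def)
  have posT: "0 < g y" if "y \<in> T" for y using that by (auto simp: T_def)
  have y0T: "y0 \<in> T"
    using y0T1 gf[OF \<kappa>(2)] Zf_pos[OF x0(2) \<kappa>] by (simp add: T_def y0_def)
  obtain R L \<tau> where R: "0 < R" "0 \<le> L" "0 < \<tau>" and RT: "cball y0 R \<subseteq> T" and YC: "Cinf_on T Y"
    and lip: "\<And>a b. a \<in> cball y0 R \<Longrightarrow> b \<in> cball y0 R \<Longrightarrow> norm (Y a - Y b) \<le> L * norm (a - b)"
    and traj: "\<And>w. w \<in> cball y0 (R / 4) \<Longrightarrow> \<exists>\<gamma> \<iota> T0. 0 < T0 \<and> \<gamma> 0 = w \<and>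
       (\<forall>t\<in>{-T0<..<T0}. \<gamma> t \<in> cball y0 (R / 2) \<and> (\<gamma> has_vector_derivative V (\<gamma> t)) (at t)) \<and>
       (\<forall>s\<in>{\<phi> w - \<tau><..<\<phi> w + \<tau>}. \<iota> s \<in> {-T0<..<T0} \<and> \<phi> (\<gamma> (\<iota> s)) = s \<and> (s \<le> \<phi> w \<longrightarrow> \<iota> s \<le> 0) \<and>
          ((\<lambda>s. \<gamma> (\<iota> s)) has_vector_derivative Y (\<gamma> (\<iota> s))) (at s)) \<and> \<iota> (\<phi> w) = 0"
    by (rule level_trajectories[OF T Cinf_on_subset[OF T1 \<phi>C T TT1] Cinf_on_subset[OF T1 VC T TT1] y0T g_def posT Y_def])
      (assumption, rule that[rotated -1], assumption+)
  have RT1: "y \<in> T1" if "y \<in> cball y0 R" for y using that RT TT1 by blast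
  define N where "N = {x \<in> domain \<kappa>. coord \<kappa> x \<in> ball y0 (R / 4)}"
  show thesis
  proof (rule that[of N "\<tau> / 2"])
    show "open N" unfolding N_def by (rule coord_preimage_open[OF chart[OF \<kappa>(1)] open_ball])
    show "x\<^sub>0 \<in> N" using \<kappa>(2) R by (simp add: N_def y0_def)
    show "0 < \<tau> / 2" using R by simp
    fix w a assume w: "w \<in> N" and a: "f w - \<tau> / 2 \<le> a" "a < f w"
    define yw where "yw = coord \<kappa> w"
    have wd: "w \<in> domain \<kappa>" and yw: "yw \<in> ball y0 (R / 4)" using w by (auto simp: N_def yw_def)
    have ywM: "yw \<in> M" using ch(6)[OF wd] ch(10) by (auto simp: yw_def M_def)
    have ywT1: "yw \<in> T1" using yw R by (intro RT1) auto
    have \<phi>w: "\<phi> yw = f w" using \<phi>f[OF ywT1 ywM] ch(7)[OF wd] by (simp add: yw_def)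
    have "yw \<in> cball y0 (R / 4)" using yw by auto
    from traj[OF this, unfolded \<phi>w] obtain \<gamma> \<iota> T0 where T0: "0 < T0" and \<gamma>0: "\<gamma> 0 = yw"
      and \<gamma>R: "\<And>t. t \<in> {-T0<..<T0} \<Longrightarrow> \<gamma> t \<in> cball y0 (R / 2)"
      and d\<gamma>: "\<And>t. t \<in> {-T0<..<T0} \<Longrightarrow> (\<gamma> has_vector_derivative V (\<gamma> t)) (at t)"
      and \<iota>: "\<And>s. s \<in> {f w - \<tau><..<f w + \<tau>} \<Longrightarrow> \<iota> s \<in> {-T0<..<T0}"
        "\<And>s. s \<in> {f w - \<tau><..<f w + \<tau>} \<Longrightarrow> \<phi> (\<gamma> (\<iota> s)) = s"
        "\<And>s. s \<in> {f w - \<tau><..<f w + \<tau>} \<Longrightarrow> s \<le> f w \<Longrightarrow> \<iota> s \<le> 0"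
      and d\<eta>: "\<And>s. s \<in> {f w - \<tau><..<f w + \<tau>} \<Longrightarrow> ((\<lambda>s. \<gamma> (\<iota> s)) has_vector_derivative Y (\<gamma> (\<iota> s))) (at s)"
      and \<iota>0: "\<iota> (f w) = 0"
      by blast
    define I where "I = {-T0<..<T0}"
    define S where "S = {f w - \<tau><..<f w + \<tau>}"
    have half: "cball y0 (R / 2) \<subseteq> cball y0 R" using R by auto
    have \<gamma>T: "\<gamma> t \<in> T1" if "t \<in> I" for t using \<gamma>R that half RT1 unfolding I_def by blast
    \<comment> \<open>The component of the curve transversal to the model space has derivative zero.\<close>
    have "\<exists>c. \<forall>t\<in>I. \<gamma> t - \<pi> (\<gamma> t) = c"
    proof (rule has_vector_derivative_zero_constant[of I "\<lambda>t. \<gamma> t - \<pi> (\<gamma> t)"])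
      show "convex I" by (simp add: I_def)
      fix t assume t: "t \<in> I"
      have "(\<gamma> has_vector_derivative V (\<gamma> t)) (at t within I)"
        using d\<gamma> t unfolding I_def by (blast intro: has_vector_derivative_at_within)
      from has_vector_derivative_diff[OF this bounded_linear.has_vector_derivative[OF \<pi>(1) this]]
      show "((\<lambda>t. \<gamma> t - \<pi> (\<gamma> t)) has_vector_derivative 0) (at t within I)"
        by (simp add: \<pi>(3)[OF VM[OF \<gamma>T[OF t]]])
    qed blast
    moreover have "0 \<in> I" using T0 by (simp add: I_def)
    ultimately have "\<gamma> t - \<pi> (\<gamma> t) = 0" if "t \<in> I" for t
      using that \<gamma>0 \<pi>(3)[OF ywM] by (metis diff_self)
    then have \<gamma>M: "\<gamma> t \<in> M" if "t \<in> I" for t using that \<pi>(2)[of "\<gamma> t"] by simp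
    have \<gamma>cod: "\<gamma> t \<in> codomain \<kappa>" if "t \<in> I" for t using T1_M(1)[OF \<gamma>T[OF that] \<gamma>M[OF that]] .
    have iw: "chart_inv \<kappa> yw = w" using ch(7)[OF wd] by (simp add: yw_def)
    have IC: "integral_curve A Z w I (\<lambda>t. chart_inv \<kappa> (\<gamma> t))"
    proof -
      have "integral_curve A Z (chart_inv \<kappa> (\<gamma> 0)) I (\<lambda>t. chart_inv \<kappa> (\<gamma> t))"
      proof (rule integral_curve_in_chart[where \<zeta> = "\<lambda>t. V (\<gamma> t)", OF chart[OF \<kappa>(1)]])
        fix t \<kappa>' assume t: "t \<in> I" and \<kappa>': "\<kappa>' \<in> A" "chart_inv \<kappa> (\<gamma> t) \<in> domain \<kappa>'"
        show "dir_deriv (coord \<kappa>' \<circ> chart_inv \<kappa>) (\<gamma> t) (V (\<gamma> t)) = Z (chart_inv \<kappa> (\<gamma> t)) \<kappa>'"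
          using Z_transition[OF \<kappa>(1) \<kappa>'(1) ch(8)[OF \<gamma>cod[OF t]] \<kappa>'(2)] ch(9)[OF \<gamma>cod[OF t]] VZ[OF \<gamma>T[OF t] \<gamma>M[OF t]] by simp
      next
        show "open I" "is_interval I" "0 \<in> I" using T0 by (simp_all add: I_def is_interval_oo)
        show "\<And>t. t \<in> I \<Longrightarrow> V (\<gamma> t) \<in> model \<kappa>" using VM \<gamma>T by (simp add: M_def)
      qed (use trs \<gamma>cod d\<gamma> in \<open>auto simp: I_def\<close>)
      then show ?thesis by (simp add: \<gamma>0 iw)
    qed
    define \<eta> where "\<eta> s = \<gamma> (\<iota> s)" for s
    have \<iota>I: "\<iota> s \<in> I" if "s \<in> S" for s using \<iota>(1) that by (simp add: S_def I_def)
    have \<eta>R: "\<eta> s \<in> cball y0 (R / 2)" and \<eta>M: "\<eta> s \<in> M" and \<phi>\<eta>: "\<phi> (\<eta> s) = s" if "s \<in> S" for s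
      using \<gamma>R \<iota>(1,2) \<gamma>M \<iota>I[OF that] that unfolding S_def I_def \<eta>_def by blast+
    have \<eta>T: "\<eta> s \<in> T" if "s \<in> S" for s using \<eta>R[OF that] half RT by blast
    have d\<eta>': "(\<eta> has_vector_derivative Y (\<eta> s)) (at s)" if "s \<in> S" for s
      using d\<eta> that unfolding S_def \<eta>_def by blast
    have S: "open S" by (simp add: S_def)
    have \<eta>C: "Cinf_on S \<eta>"
      by (rule Cinf_on_integral_curve[OF S T _ YC d\<eta>']) (use \<eta>T in auto)
    have aS: "a \<in> S" and wS: "f w \<in> S" using a R by (auto simp: S_def)
    have \<eta>w: "\<eta> (f w) = yw" using \<iota>0 \<gamma>0 by (simp add: \<eta>_def)
    define w1 where "w1 = chart_inv \<kappa> (\<eta> a)"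
    have fw1: "f w1 = a" using \<phi>f[of "\<eta> a"] \<eta>T[OF aS] TT1 \<eta>M[OF aS] \<phi>\<eta>[OF aS] by (auto simp: w1_def)
    have nap: "w1 \<in> nappe A Z c" if "w \<in> nappe A Z c" for c
    proof -
      have "integral_curve A Z w1 {t. t + \<iota> a \<in> I} (\<lambda>t. chart_inv \<kappa> (\<gamma> (t + \<iota> a)))"
        using integral_curve_shift[OF IC \<iota>I[OF aS]] by (simp add: w1_def \<eta>_def)
      from nappe_backward[OF this, of "- \<iota> a" c] show ?thesis
        using \<open>0 \<in> I\<close> \<iota>(3)[of a] aS a \<gamma>0 iw that by (simp add: S_def)
    qed
    have low: "\<exists>h'. lowering U h' \<and> h' w < \<mu>" if h: "lowering U h" and hw1: "h w1 < \<mu>" for h \<mu>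
    proof -
      have hs: "smooth_function A h" and hf: "\<And>x. h x \<le> f x" using h unfolding lowering_def by blast+
      obtain m where m: "h w1 < m" "m < \<mu>" using hw1 dense by blast
      define b where "b = f w + \<tau> / 2"
      have ab: "{a..b} \<subseteq> S" "f w < b" using a R by (auto simp: S_def b_def)
      have "open {x. h x < m}"
        using smooth_continuous[OF hs] by (intro open_Collect_less continuous_intros)
      then obtain S1 where S1: "open S1" "\<And>y. y \<in> codomain \<kappa> \<Longrightarrow> y \<in> S1 \<longleftrightarrow> h (chart_inv \<kappa> y) < m"
        using chart_inv_preimage_open[OF chart[OF \<kappa>(1)]] by (metis mem_Collect_eq)
      have \<eta>cod: "\<eta> a \<in> codomain \<kappa>" using T1_M(1) \<eta>T[OF aS] TT1 \<eta>M[OF aS] by blast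
      then have "\<eta> a \<in> S1" using S1(2) m by (simp add: w1_def)
      then obtain r1 where r1: "0 < r1" "ball (\<eta> a) r1 \<subseteq> S1" using S1(1) openE by blast
      define r where "r = min r1 (R / 4)"
      have r: "0 < r" "r \<le> r1" "r \<le> R / 4" using r1 R by (auto simp: r_def)
      define e where "e = (\<mu> - m) / 3"
      have e: "0 < e" using m by (simp add: e_def)
      \<comment> \<open>\<open>X\<close> bounds the excess of \<open>h\<close> over \<open>m\<close>. The slope \<open>B\<close> makes the barrier exceed it at the upper end \<open>f = b\<close>, and the
        factor \<open>Q\<close> at distance at least \<open>r\<close> from the trajectory.\<close>
      define X where "X = \<bar>b - m\<bar>"
      define B where "B = (X / e + 1) / (b - f w)"
      have X0: "0 \<le> X / e" using e by (simp add: X_def)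
      have B: "0 < B" "B * (b - f w) = X / e + 1"
        using ab X0 by (auto simp: B_def intro!: divide_pos_pos)
      define Q where "Q = (X + 1) / (exp (- \<bar>2 * L\<bar> * (\<bar>a\<bar> + \<bar>b\<bar>)) * r\<^sup>2)"
      have Q: "0 \<le> Q" unfolding Q_def X_def using r by auto
      define kh where "kh = tube_barrier \<phi> \<eta> L m e B (f w) Q"
      define Tk where "Tk = \<phi> -` S \<inter> ball y0 R"
      have c\<phi>: "continuous_on (cball y0 R) \<phi>"
        using continuous_on_subset[OF Cinf_on_continuous_on[OF T1 \<phi>C]] RT1 by blast
      have Tk: "open Tk" unfolding Tk_def
        by (rule open_vimage_on[OF open_ball continuous_on_subset[OF c\<phi> ball_subset_cball] S])
      have TkT1: "Tk \<subseteq> T1" using RT1 by (auto simp: Tk_def)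
      have lipk: "norm (Y y - Y (\<eta> (\<phi> y))) \<le> L * norm (y - \<eta> (\<phi> y))" if "y \<in> Tk" for y
      proof (rule lip)
        have "\<phi> y \<in> S" "y \<in> cball y0 R" using that by (auto simp: Tk_def)
        then show "y \<in> cball y0 R" "\<eta> (\<phi> y) \<in> cball y0 R" using \<eta>R half by blast+
      qed
      have TkS: "\<phi> ` Tk \<subseteq> S" by (auto simp: Tk_def)
      have posTk: "0 < g y" if "y \<in> Tk" for y
      proof -
        have "y \<in> cball y0 R" using that by (auto simp: Tk_def)
        then show ?thesis using RT posT by blast
      qed
      note tb = tube_barrier[OF Tk Cinf_on_subset[OF T1 \<phi>C Tk TkT1] S \<eta>C _ g_def _ Y_def d\<eta>' lipk e B(1) Q, where m = m and s = "f w"]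
      have khC: "Cinf_on Tk kh" unfolding kh_def by (rule tb(1)) (use TkS posTk in blast)+
      have khV: "0 < frechet_derivative kh (at y) (V y)" if "y \<in> Tk" for y
        unfolding kh_def by (rule tb(2)) (use TkS posTk that in blast)+
      define G where "G = {y \<in> ball y0 R. \<phi> y \<in> {a<..<b} \<and> norm (y - \<eta> (\<phi> y)) < R / 4}"
      define K where "K = {y \<in> M. y \<in> cball y0 (3 * R / 4) \<and> \<phi> y \<in> {a..b} \<and> norm (y - \<eta> (\<phi> y)) \<le> R / 4}"
      have c\<eta>: "continuous_on P (\<lambda>y. norm (y - \<eta> (\<phi> y)))" if "P \<subseteq> cball y0 R" "\<phi> ` P \<subseteq> S" for P
        by (intro continuous_intros continuous_on_compose2[OF Cinf_on_continuous_on[OF S \<eta>C] continuous_on_subset[OF c\<phi> that(1)] that(2)])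
      have G: "open G"
      proof -
        define P where "P = \<phi> -` {a<..<b} \<inter> ball y0 R"
        have P: "open P" unfolding P_def
          by (rule open_vimage_on[OF open_ball continuous_on_subset[OF c\<phi> ball_subset_cball] open_greaterThanLessThan])
        have "continuous_on P (\<lambda>y. norm (y - \<eta> (\<phi> y)))" by (rule c\<eta>) (use ab in \<open>auto simp: P_def\<close>)
        then have "open ((\<lambda>y. norm (y - \<eta> (\<phi> y))) -` {..<R / 4} \<inter> P)"
          by (rule open_vimage_on[OF P _ open_lessThan])
        moreover have "G = (\<lambda>y. norm (y - \<eta> (\<phi> y))) -` {..<R / 4} \<inter> P" by (auto simp: G_def P_def)
        ultimately show ?thesis by simp
      qed
      have sub34: "cball y0 (3 * R / 4) \<subseteq> ball y0 R" using R by auto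
      have K: "compact K"
      proof -
        define P where "P = (M \<inter> cball y0 (3 * R / 4)) \<inter> \<phi> -` {a..b}"
        have "closed M" using ch(2) by (simp add: M_def closed_subspace)
        then have cm: "closed (M \<inter> cball y0 (3 * R / 4))" by auto
        have sub: "M \<inter> cball y0 (3 * R / 4) \<subseteq> cball y0 R" using R by auto
        have "closed P" unfolding P_def
          by (rule continuous_closed_preimage[OF continuous_on_subset[OF c\<phi> sub] cm closed_atLeastAtMost])
        moreover have "continuous_on P (\<lambda>y. norm (y - \<eta> (\<phi> y)))" by (rule c\<eta>) (use ab sub in \<open>auto simp: P_def\<close>)
        ultimately have "closed (P \<inter> (\<lambda>y. norm (y - \<eta> (\<phi> y))) -` {..R / 4})"
          by (intro continuous_closed_preimage) auto
        moreover have "K = P \<inter> (\<lambda>y. norm (y - \<eta> (\<phi> y))) -` {..R / 4}" by (auto simp: K_def P_def)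
        moreover have "bounded K" by (rule bounded_subset[OF bounded_cball[of y0 "3 * R / 4"]]) (auto simp: K_def)
        ultimately show ?thesis by (simp add: compact_eq_bounded_closed)
      qed
      have KTk: "y \<in> Tk" "y \<in> M" if "y \<in> K" for y using that sub34 ab by (auto simp: K_def Tk_def)
      have Kcod: "y \<in> codomain \<kappa>" "chart_inv \<kappa> y \<in> U" if "y \<in> K" for y using T1_M KTk[OF that] TkT1 by blast+
      define Q' where "Q' = chart_inv \<kappa> ` K"
      define G' where "G' = {x \<in> domain \<kappa>. coord \<kappa> x \<in> G}"
      have Q'D: "x \<in> domain \<kappa>" "coord \<kappa> x \<in> K" if "x \<in> Q'" for x
        using that Kcod ch(8,9) by (auto simp: Q'_def)
      have "compact Q'" unfolding Q'_def
        by (rule compact_continuous_image[OF continuous_on_subset[OF ch(5)] K]) (use Kcod in auto)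
      then have clQ: "closed Q'" by (rule compact_imp_closed)
      have opG: "open G'" unfolding G'_def by (rule coord_preimage_open[OF chart[OF \<kappa>(1)] G])
      have GK: "y \<in> K" if "y \<in> G" "y \<in> M" for y
      proof -
        have "dist y0 y \<le> dist y0 (\<eta> (\<phi> y)) + dist y (\<eta> (\<phi> y))" by (rule dist_triangle2)
        moreover have "\<phi> y \<in> {a..b}" using that by (auto simp: G_def)
        then have "\<phi> y \<in> S" using ab(1) by blast
        then have "dist y0 (\<eta> (\<phi> y)) \<le> R / 2" using \<eta>R[of "\<phi> y"] by simp
        moreover have "dist y (\<eta> (\<phi> y)) < R / 4" using that by (auto simp: G_def dist_norm)
        ultimately show ?thesis using that by (auto simp: G_def K_def)
      qed
      have sub: "G' \<subseteq> Q'"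
      proof
        fix x assume "x \<in> G'"
        then have x: "x \<in> domain \<kappa>" "coord \<kappa> x \<in> G" by (auto simp: G'_def)
        then have "coord \<kappa> x \<in> K" using GK ch(6)[OF x(1)] ch(10) by (auto simp: M_def)
        then show "x \<in> Q'" using ch(7)[OF x(1)] unfolding Q'_def by (metis imageI)
      qed
      define k where "k x = kh (coord \<kappa> x)" for x
      have kn: "smooth_near Q' k"
        unfolding smooth_near_def k_def
        using chart_pullback(1)[OF chart[OF \<kappa>(1)] trs Tk khC] Q'D KTk by blast
      have kZ: "increasing_on G' k"
        unfolding increasing_on_def
      proof (intro ballI impI)
        fix x \<kappa>' assume "x \<in> G' - crit" and \<kappa>': "\<kappa>' \<in> A" "x \<in> domain \<kappa>'"
        then have x: "x \<in> domain \<kappa>" "coord \<kappa> x \<in> Tk" "coord \<kappa> x \<in> M" using sub Q'D KTk by blast+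
        have "V (coord \<kappa> x) = Z x \<kappa>" using VZ[of "coord \<kappa> x"] TkT1 x ch(7)[OF x(1)] by auto
        then show "0 < chart_deriv \<kappa>' k x (Z x \<kappa>')"
          using chart_pullback(2)[OF chart[OF \<kappa>(1)] trs Tk khC x(1,2) \<kappa>' Z_model[OF \<kappa>(1) x(1)] Z_transition[OF \<kappa>(1) \<kappa>'(1) x(1) \<kappa>'(2), symmetric]]
            khV[OF x(2)] by (simp add: k_def[abs_def])
      qed
      have Qcrit: "Q' \<inter> crit = {}"
      proof (rule ccontr)
        assume "Q' \<inter> crit \<noteq> {}"
        then obtain x where x: "x \<in> Q'" "x \<in> crit" by blast
        have y: "coord \<kappa> x \<in> Tk" using KTk(1)[OF Q'D(2)[OF x(1)]] .
        then have "coord \<kappa> x \<in> T1" using TkT1 by blast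
        from gf[OF Q'D(1)[OF x(1)] this] posTk[OF y] crit_chart_deriv[OF x(2) \<kappa>(1) Q'D(1)[OF x(1)], of f]
        show False by simp
      qed
      have QU: "Q' \<subseteq> U" using Kcod by (auto simp: Q'_def)
      have bd: "h x < k x" if x: "x \<in> Q' - G'" for x
      proof -
        define y where "y = coord \<kappa> x"
        have yK: "y \<in> K" and xd: "x \<in> domain \<kappa>" using x Q'D by (auto simp: y_def)
        have yM: "y \<in> M" and yT1: "y \<in> T1" using KTk[OF yK] TkT1 by blast+
        have fx: "\<phi> y = f x" using \<phi>f[OF yT1 yM] ch(7)[OF xd] by (simp add: y_def)
        have fxab: "a \<le> f x" "f x \<le> b" using yK fx by (auto simp: K_def)
        have yG: "y \<notin> G" using x xd by (auto simp: G'_def y_def)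
        define q where "q = (y - \<eta> (f x)) \<bullet> (y - \<eta> (f x))"
        have q: "q = (norm (y - \<eta> (f x)))\<^sup>2" by (simp add: q_def dot_square_norm)
        have kx: "k x = m + e * exp (B * (f x - f w)) + Q * (exp (2 * L * f x) * q)"
          by (simp add: k_def kh_def tube_barrier_def y_def[symmetric] fx q_def)
        have e1: "0 < e * exp (B * (f x - f w))" using e by simp
        have q0: "0 \<le> Q * (exp (2 * L * f x) * q)" using Q by (simp add: q)
        have hb: "h x \<le> m + X" using hf[of x] fxab by (auto simp: X_def)
        have far: "h x < k x" if "r \<le> norm (y - \<eta> (f x))"
        proof -
          have "\<bar>f x\<bar> \<le> \<bar>a\<bar> + \<bar>b\<bar>" using fxab by linarith
          then have "\<bar>2 * L\<bar> * \<bar>f x\<bar> \<le> \<bar>2 * L\<bar> * (\<bar>a\<bar> + \<bar>b\<bar>)" by (intro mult_left_mono) auto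
          then have "- \<bar>2 * L\<bar> * (\<bar>a\<bar> + \<bar>b\<bar>) \<le> 2 * L * f x"
            using abs_ge_minus_self[of "2 * L * f x"] by (simp add: abs_mult)
          then have "exp (- \<bar>2 * L\<bar> * (\<bar>a\<bar> + \<bar>b\<bar>)) * r\<^sup>2 \<le> exp (2 * L * f x) * q"
            unfolding q using that r by (intro mult_mono power_mono) auto
          then have "Q * (exp (- \<bar>2 * L\<bar> * (\<bar>a\<bar> + \<bar>b\<bar>)) * r\<^sup>2) \<le> Q * (exp (2 * L * f x) * q)"
            using Q by (intro mult_left_mono) auto
          moreover have "Q * (exp (- \<bar>2 * L\<bar> * (\<bar>a\<bar> + \<bar>b\<bar>)) * r\<^sup>2) = X + 1"
            using r by (simp add: Q_def)
          ultimately show ?thesis using hb e1 kx by linarith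
        qed
        consider "f x = b" | "f x = a" | "R / 4 \<le> norm (y - \<eta> (f x))"
          using yG yK sub34 fxab by (auto simp: G_def K_def fx)
        then show ?thesis
        proof cases
          case 1
          have "X / e + 1 + 1 \<le> exp (X / e + 1)" using exp_ge_add_one_self[of "X / e + 1"] by simp
          then have "e * (X / e) < e * exp (X / e + 1)" using e by (intro mult_strict_left_mono) auto
          then have "X < e * exp (B * (f x - f w))" using e B(2) 1 by simp
          then show ?thesis using hb q0 kx by linarith
        next
          case 2
          show ?thesis
          proof (cases "r \<le> norm (y - \<eta> (f x))")
            case False
            then have "y \<in> S1" using 2 r r1 by (auto simp: dist_norm norm_minus_commute)
            then have "h x < m" using S1(2)[of y] T1_M(1)[OF yT1 yM] ch(7)[OF xd] by (simp add: y_def)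
            then show ?thesis using kx e1 q0 by linarith
          qed (rule far)
        next
          case 3
          then show ?thesis using far r by linarith
        qed
      qed
      have "lowering U (lower_on e G' k h)"
        by (rule lowering_lower_on[OF h opG clQ QU Qcrit sub kn bd kZ e])
      moreover have "lower_on e G' k h w < \<mu>"
      proof -
        have "w \<in> G'" using wd yw \<phi>w \<eta>w a ab R by (auto simp: G'_def G_def yw_def[symmetric])
        then have "lower_on e G' k h w \<le> k w + e"
          unfolding lower_on_def using smin_le_right[OF e] by simp
        also have "k w = m + e" by (simp add: k_def kh_def tube_barrier_def yw_def[symmetric] \<phi>w \<eta>w)
        also have "m + e + e < \<mu>" using m by (simp add: e_def field_simps)
        finally show ?thesis .
      qed
      ultimately show ?thesis by blast
    qed
    show "\<exists>w\<^sub>1. f w\<^sub>1 = a \<and> (\<forall>c. w \<in> nappe A Z c \<longrightarrow> w\<^sub>1 \<in> nappe A Z c) \<and>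
        (\<forall>h \<mu>. lowering U h \<longrightarrow> h w\<^sub>1 < \<mu> \<longrightarrow> (\<exists>h'. lowering U h' \<and> h' w < \<mu>))"
      using fw1 nap low by blast
  qed
qed

end

section \<open>Morse charts and modifications of Morse data\<close>

lemma direct_sum_projections:
  fixes N P :: "'a::euclidean_space set"
  assumes N: "subspace N" and P: "subspace P" and NP: "N \<inter> P = {0}"
  obtains pn pp where "bounded_linear pn" "bounded_linear pp"
    "\<And>n p. n \<in> N \<Longrightarrow> p \<in> P \<Longrightarrow> pn (n + p) = n \<and> pp (n + p) = p"
proof -
  have lin: "linear (\<lambda>x::'a \<times> 'a. fst x + snd x)"
    by (auto intro!: linearI simp: scaleR_add_right)
  have inj: "inj_on (\<lambda>x::'a \<times> 'a. fst x + snd x) (N \<times> P)"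
  proof (rule inj_onI, clarsimp)
    fix a b c d assume "a \<in> N" "b \<in> P" "c \<in> N" "d \<in> P" and eq: "a + b = c + d"
    then have "a - c \<in> N" "d - b \<in> P" using N P by (auto intro: subspace_diff)
    moreover have "a - c = d - b" using eq by (simp add: algebra_simps)
    ultimately have "a - c \<in> N \<inter> P" by simp
    then have "a - c = 0" using NP by blast
    then show "a = c \<and> b = d" using eq by simp
  qed
  obtain g :: "'a \<Rightarrow> 'a \<times> 'a" where g: "linear g" "\<And>v. v \<in> N \<times> P \<Longrightarrow> g (fst v + snd v) = v"
    using linear_exists_left_inverse_on[OF lin subspace_Times[OF N P] inj] by blast
  have bl: "bounded_linear g" using g(1) by (simp add: linear_conv_bounded_linear)
  show thesis
  proof (rule that[of "\<lambda>y. fst (g y)" "\<lambda>y. snd (g y)"])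
    show "bounded_linear (\<lambda>y. fst (g y))" "bounded_linear (\<lambda>y. snd (g y))"
      using bl by (auto intro: bounded_linear_fst_comp bounded_linear_snd_comp)
    show "fst (g (n + p)) = n \<and> snd (g (n + p)) = p" if "n \<in> N" "p \<in> P" for n p
      using g(2)[of "(n, p)"] that by simp
  qed
qed

lemma smooth_on_subset_cong:
  assumes "smooth_on S h" "S' \<subseteq> S" "\<And>x. x \<in> S' \<Longrightarrow> h x = h' x"
  shows "smooth_on S' h'"
  unfolding smooth_on_def
proof
  fix x assume "x \<in> S'"
  then have "x \<in> S" using assms(2) by blast
  from assms(1)[unfolded smooth_on_def, THEN bspec, OF this]
  obtain T g where g: "open T" "x \<in> T" "\<forall>k. Ck_on k T g" "\<forall>y\<in>S \<inter> T. g y = h y"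
    by (elim exE conjE) (rule that)
  have "g y = h' y" if "y \<in> S' \<inter> T" for y
    using g(4) that assms(2) assms(3)[of y] by auto
  then show "\<exists>T g. open T \<and> x \<in> T \<and> (\<forall>k. Ck_on k T g) \<and> (\<forall>y\<in>S' \<inter> T. g y = h' y)"
    using g(1-3) by (intro exI[of _ T] exI[of _ g] conjI ballI)
qed

lemma compatible_chart_restrict:
  fixes \<kappa> \<kappa>' :: "('v::topological_space, 'e::euclidean_space) chart"
  assumes c: "compatible_chart A \<kappa>" and ch: "\<And>\<kappa>. \<kappa> \<in> A \<Longrightarrow> is_chart \<kappa>" and D: "open (domain \<kappa>')" "domain \<kappa>' \<subseteq> domain \<kappa>"
    and M: "model \<kappa>' = model \<kappa>" and co: "\<And>x. x \<in> domain \<kappa>' \<Longrightarrow> coord \<kappa>' x = coord \<kappa> x"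
  shows "compatible_chart A \<kappa>'"
proof -
  have \<kappa>: "is_chart \<kappa>" using c by (simp add: compatible_chart_def)
  note k = is_chartD[OF \<kappa>]
  have cod: "codomain \<kappa>' = coord \<kappa> ` domain \<kappa>'" using co by (auto simp: codomain_def)
  have cod_sub: "codomain \<kappa>' \<subseteq> codomain \<kappa>" using cod D(2) by (auto simp: codomain_def)
  have inj: "inj_on (coord \<kappa>) (domain \<kappa>)" using k(7) by (metis inj_onI)
  have inv: "chart_inv \<kappa>' y = chart_inv \<kappa> y" "chart_inv \<kappa> y \<in> domain \<kappa>'" if y: "y \<in> codomain \<kappa>'" for y
  proof -
    have a: "inv_into (domain \<kappa>') (coord \<kappa>') y \<in> domain \<kappa>'" "coord \<kappa>' (inv_into (domain \<kappa>') (coord \<kappa>') y) = y"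
      using y by (auto simp: codomain_def inv_into_into f_inv_into_f)
    then have "coord \<kappa> (chart_inv \<kappa>' y) = y" using co by (simp add: chart_inv_def)
    then have "chart_inv \<kappa> y = chart_inv \<kappa>' y" using a(1) D(2) k(7)[of "chart_inv \<kappa>' y"] by (auto simp: chart_inv_def[of \<kappa>'])
    then show "chart_inv \<kappa>' y = chart_inv \<kappa> y" "chart_inv \<kappa> y \<in> domain \<kappa>'" using a(1) by (simp_all add: chart_inv_def[of \<kappa>'])
  qed
  have cod_iff: "y \<in> codomain \<kappa>' \<longleftrightarrow> y \<in> codomain \<kappa> \<and> chart_inv \<kappa> y \<in> domain \<kappa>'" for y
    using inv(2)[of y] cod_sub k(9)[of y] by (metis cod imageI subsetD)
  obtain T where T: "open T" "\<And>y. y \<in> codomain \<kappa> \<Longrightarrow> y \<in> T \<longleftrightarrow> chart_inv \<kappa> y \<in> domain \<kappa>'"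
    using chart_inv_preimage_open[OF \<kappa> D(1)] by blast
  have "codomain \<kappa>' = codomain \<kappa> \<inter> T" using cod_iff T(2) by blast
  then have op: "openin (top_of_set (model \<kappa>')) (codomain \<kappa>')" using k(3) T(1) M by (simp add: openin_Int_open)
  have hom: "homeomorphism (domain \<kappa>') (codomain \<kappa>') (coord \<kappa>') (chart_inv \<kappa>')"
    unfolding homeomorphism_def
  proof (intro conjI ballI)
    show "continuous_on (domain \<kappa>') (coord \<kappa>')"
      by (subst continuous_on_cong[OF refl co]) (auto intro: continuous_on_subset[OF k(4) D(2)])
    show "continuous_on (codomain \<kappa>') (chart_inv \<kappa>')"
      by (subst continuous_on_cong[OF refl inv(1)]) (auto intro: continuous_on_subset[OF k(5) cod_sub])
    show "chart_inv \<kappa>' (coord \<kappa>' x) = x" if "x \<in> domain \<kappa>'" for x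
    proof -
      have "coord \<kappa>' x \<in> codomain \<kappa>'" using that by (simp add: codomain_def)
      then show ?thesis using inv(1) co[OF that] k(7)[of x] that D(2) by auto
    qed
    then show "chart_inv \<kappa>' ` codomain \<kappa>' = domain \<kappa>'" by (force simp: codomain_def)
    show "coord \<kappa>' ` domain \<kappa>' = codomain \<kappa>'" by (simp add: codomain_def)
    show "coord \<kappa>' (chart_inv \<kappa>' y) = y" if "y \<in> codomain \<kappa>'" for y
      using inv[OF that] co k(9) cod_sub that by auto
  qed
  have is': "is_chart \<kappa>'" unfolding is_chart_def using D(1) k(2) M op hom by simp
  moreover have "smooth_transition \<kappa>' \<kappa>''" "smooth_transition \<kappa>'' \<kappa>'" if "\<kappa>'' \<in> A" for \<kappa>''
  proof -
    have s: "smooth_on (coord \<kappa> ` (domain \<kappa> \<inter> domain \<kappa>'')) (coord \<kappa>'' \<circ> chart_inv \<kappa>)"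
      "smooth_on (coord \<kappa>'' ` (domain \<kappa>'' \<inter> domain \<kappa>)) (coord \<kappa> \<circ> chart_inv \<kappa>'')"
      using c that by (auto simp: compatible_chart_def smooth_transition_def)
    show "smooth_transition \<kappa>' \<kappa>''"
      unfolding smooth_transition_def
    proof (rule smooth_on_subset_cong[OF s(1)])
      show "coord \<kappa>' ` (domain \<kappa>' \<inter> domain \<kappa>'') \<subseteq> coord \<kappa> ` (domain \<kappa> \<inter> domain \<kappa>'')"
        using co D(2) by force
      fix y assume "y \<in> coord \<kappa>' ` (domain \<kappa>' \<inter> domain \<kappa>'')"
      then have "y \<in> codomain \<kappa>'" by (auto simp: codomain_def)
      then show "(coord \<kappa>'' \<circ> chart_inv \<kappa>) y = (coord \<kappa>'' \<circ> chart_inv \<kappa>') y" by (simp add: inv)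
    qed
    show "smooth_transition \<kappa>'' \<kappa>'"
      unfolding smooth_transition_def
    proof (rule smooth_on_subset_cong[OF s(2)])
      show "coord \<kappa>'' ` (domain \<kappa>'' \<inter> domain \<kappa>') \<subseteq> coord \<kappa>'' ` (domain \<kappa>'' \<inter> domain \<kappa>)"
        using D(2) by blast
      fix y assume "y \<in> coord \<kappa>'' ` (domain \<kappa>'' \<inter> domain \<kappa>')"
      then have "chart_inv \<kappa>'' y \<in> domain \<kappa>'" using is_chartD(7)[OF ch[OF that]] by auto
      then show "(coord \<kappa> \<circ> chart_inv \<kappa>'') y = (coord \<kappa>' \<circ> chart_inv \<kappa>'') y" by (simp add: co)
    qed
  qed
  ultimately show ?thesis by (simp add: compatible_chart_def)
qed

context morse
begin

text \<open>The adapted parametrization is used through the chart \<open>\<kappa>\<close> that it defines, so that the rules for the change of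
  charts apply; \<open>pn\<close> and \<open>pp\<close> are the projections to the negative and the positive space, and the
  last two facts describe the stable disc \<open>pp y = 0\<close>.\<close>

lemma morse_chart:
  assumes c: "c \<in> crit"
  obtains \<kappa> pn pp where "is_chart \<kappa>" "\<And>\<kappa>'. \<kappa>' \<in> A \<Longrightarrow> smooth_transition \<kappa> \<kappa>' \<and> smooth_transition \<kappa>' \<kappa>"
    "c \<in> domain \<kappa>" "coord \<kappa> c = 0" "bounded_linear pn" "bounded_linear pp"
    "\<And>y. y \<in> model \<kappa> \<Longrightarrow> pn y + pp y = y \<and> pn y \<in> model \<kappa> \<and> pp y \<in> model \<kappa> \<and> pn (pn y) = pn y \<and> pp (pn y) = 0 \<and> pn (pp y) = 0 \<and> pp (pp y) = pp y"
    "\<And>y \<kappa>'. y \<in> codomain \<kappa> \<Longrightarrow> \<kappa>' \<in> A \<Longrightarrow> chart_inv \<kappa> y \<in> domain \<kappa>' \<Longrightarrow>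
      dir_deriv (coord \<kappa>' \<circ> chart_inv \<kappa>) y (- pn y + pp y) = Z (chart_inv \<kappa> y) \<kappa>'"
    "\<And>y s. y \<in> codomain \<kappa> \<Longrightarrow> pp y = 0 \<Longrightarrow> 0 \<le> s \<Longrightarrow> s \<le> 1 \<Longrightarrow> s *\<^sub>R y \<in> codomain \<kappa>"
    "\<And>y. y \<in> codomain \<kappa> \<Longrightarrow> pp y = 0 \<Longrightarrow> y \<noteq> 0 \<Longrightarrow> f (chart_inv \<kappa> y) < f c"
proof -
  obtain \<kappa>0 N P WN WP \<psi> where ad: "adapted_parametrization A f Z c \<kappa>0 N P WN WP \<psi>"
    using datum c unfolding morse_datum_def pseudo_gradient_def by blast
  define U where "U = {n + p |n p. n \<in> WN \<and> p \<in> WP}"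
  define \<kappa> where "\<kappa> = \<lparr>domain = \<psi> ` U, model = model \<kappa>0, coord = inv_into U \<psi>\<rparr>"
  have N: "subspace N" and P: "subspace P" and NP: "N \<inter> P = {0}" and NPM: "{n + p |n p. n \<in> N \<and> p \<in> P} = model \<kappa>0"
    and neg: "\<And>n. n \<in> N - {0} \<Longrightarrow> hessian_form \<kappa>0 f c n < 0"
    and WN: "star_shaped_nhd_0 N WN" and WP: "star_shaped_nhd_0 P WP"
    and par: "smooth_parametrization A (model \<kappa>0) U \<psi>" and \<psi>0: "\<psi> 0 = c"
    and f\<psi>: "\<And>n p. n \<in> WN \<Longrightarrow> p \<in> WP \<Longrightarrow> f (\<psi> (n + p)) - f c = hessian_form \<kappa>0 f c (n + p)"
    and Z\<psi>: "\<And>n p \<kappa>'. n \<in> WN \<Longrightarrow> p \<in> WP \<Longrightarrow> \<kappa>' \<in> A \<Longrightarrow> \<psi> (n + p) \<in> domain \<kappa>' \<Longrightarrow>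
        dir_deriv (coord \<kappa>' \<circ> \<psi>) (n + p) (- n + p) = Z (\<psi> (n + p)) \<kappa>'"
    using ad unfolding adapted_parametrization_def U_def by blast+
  have inj: "inj_on \<psi> U" and comp: "compatible_chart A \<kappa>"
    using par unfolding smooth_parametrization_def \<kappa>_def by blast+
  have \<kappa>: "is_chart \<kappa>" and tr: "\<And>\<kappa>'. \<kappa>' \<in> A \<Longrightarrow> smooth_transition \<kappa> \<kappa>' \<and> smooth_transition \<kappa>' \<kappa>"
    using comp unfolding compatible_chart_def by blast+
  note k = is_chartD[OF \<kappa>]
  have mod: "model \<kappa> = model \<kappa>0" and dom: "domain \<kappa> = \<psi> ` U" by (simp_all add: \<kappa>_def)
  have co: "coord \<kappa> (\<psi> y) = y" if "y \<in> U" for y using inj that by (simp add: \<kappa>_def inv_into_f_f)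
  have cod: "codomain \<kappa> = U" using co by (force simp: codomain_def dom)
  have ci: "chart_inv \<kappa> y = \<psi> y" if "y \<in> U" for y using k(7)[of "\<psi> y"] co[OF that] that dom by simp
  have sub: "WN \<subseteq> N" "WP \<subseteq> P" and z: "0 \<in> WN" "0 \<in> WP"
    using WN WP openin_imp_subset unfolding star_shaped_nhd_0_def by blast+
  have U0: "0 \<in> U" using z by (force simp: U_def)
  obtain pn pp where pr: "bounded_linear pn" "bounded_linear pp"
    and d: "\<And>n p. n \<in> N \<Longrightarrow> p \<in> P \<Longrightarrow> pn (n + p) = n \<and> pp (n + p) = p"
    using direct_sum_projections[OF N P NP] by blast
  have N0: "0 \<in> N" "0 \<in> P" using N P by (auto intro: subspace_0)
  have dN: "pn n = n \<and> pp n = 0" if "n \<in> N" for n using d[OF that N0(2)] by simp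
  have dP: "pn p = 0 \<and> pp p = p" if "p \<in> P" for p using d[OF N0(1) that] by simp
  have inM: "n \<in> model \<kappa>0" if "n \<in> N \<or> n \<in> P" for n
  proof -
    have "n = n + 0" "n = 0 + n" by simp_all
    then show ?thesis using that N0 unfolding NPM[symmetric] by blast
  qed
  have cd: "c \<in> domain \<kappa>" using U0 \<psi>0 dom by auto
  have c0: "coord \<kappa> c = 0" using co[OF U0] unfolding \<psi>0 .
  have proj: "pn y + pp y = y \<and> pn y \<in> model \<kappa> \<and> pp y \<in> model \<kappa> \<and> pn (pn y) = pn y \<and> pp (pn y) = 0 \<and> pn (pp y) = 0 \<and> pp (pp y) = pp y"
    if "y \<in> model \<kappa>" for y
  proof -
    have "y \<in> {n + p |n p. n \<in> N \<and> p \<in> P}" using that unfolding mod NPM .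
    then obtain n p where np: "n \<in> N" "p \<in> P" "y = n + p" by blast
    then show ?thesis using d[OF np(1,2)] dN[OF np(1)] dP[OF np(2)] inM mod by auto
  qed
  have Zc: "dir_deriv (coord \<kappa>' \<circ> chart_inv \<kappa>) y (- pn y + pp y) = Z (chart_inv \<kappa> y) \<kappa>'"
    if y: "y \<in> codomain \<kappa>" and \<kappa>': "\<kappa>' \<in> A" "chart_inv \<kappa> y \<in> domain \<kappa>'" for y \<kappa>'
  proof -
    obtain n p where np: "n \<in> WN" "p \<in> WP" "y = n + p" using y cod by (auto simp: U_def)
    have pnp: "pn y = n" "pp y = p" using d np sub by auto
    have X: "- pn y + pp y \<in> model \<kappa>"
      unfolding pnp mod using inM np sub k(2) mod by (intro subspace_add subspace_neg) auto
    have yx: "coord \<kappa> (chart_inv \<kappa> y) = y" "chart_inv \<kappa> y \<in> domain \<kappa>" using k(8,9) y by auto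
    have "\<forall>\<^sub>F t in nhds (0::real). y + t *\<^sub>R (- pn y + pp y) \<in> codomain \<kappa> \<inter> UNIV"
      using line_eventually_in_codomain[OF \<kappa> yx(2) X open_UNIV] yx(1) by simp
    then have "\<forall>\<^sub>F t in nhds (0::real). (coord \<kappa>' \<circ> chart_inv \<kappa>) (y + t *\<^sub>R (- pn y + pp y)) = (coord \<kappa>' \<circ> \<psi>) (y + t *\<^sub>R (- pn y + pp y))"
      by (rule eventually_mono) (simp add: ci cod)
    then have "dir_deriv (coord \<kappa>' \<circ> chart_inv \<kappa>) y (- pn y + pp y) = dir_deriv (coord \<kappa>' \<circ> \<psi>) y (- pn y + pp y)"
      unfolding dir_deriv_def by (intro vector_derivative_cong_eq) auto
    also have "\<dots> = Z (\<psi> y) \<kappa>'"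
      using Z\<psi>[OF np(1,2) \<kappa>'(1)] \<kappa>'(2) ci y cod pnp np(3) by simp
    finally show ?thesis using ci y cod by simp
  qed
  have st: "s *\<^sub>R y \<in> codomain \<kappa>" if y: "y \<in> codomain \<kappa>" "pp y = 0" and s: "0 \<le> s" "s \<le> 1" for y s
  proof -
    obtain n p where np: "n \<in> WN" "p \<in> WP" "y = n + p" using y cod by (auto simp: U_def)
    then have "y = n" using d[of n p] sub y by auto
    moreover have "s *\<^sub>R n \<in> closed_segment 0 n" using s by (auto simp: closed_segment_def)
    then have "s *\<^sub>R n \<in> WN" using WN np(1) unfolding star_shaped_nhd_0_def by blast
    then have "s *\<^sub>R n + 0 \<in> U" using z(2) unfolding U_def by blast
    ultimately show ?thesis using cod by simp
  qed
  have bel: "f (chart_inv \<kappa> y) < f c" if y: "y \<in> codomain \<kappa>" "pp y = 0" "y \<noteq> 0" for y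
  proof -
    obtain n p where np: "n \<in> WN" "p \<in> WP" "y = n + p" using y cod by (auto simp: U_def)
    have "y = n" using d[of n p] sub y np by auto
    then have "hessian_form \<kappa>0 f c y < 0" using neg y(3) np(1) sub by auto
    then show ?thesis using f\<psi>[OF np(1,2)] np(3) ci y(1) cod by simp
  qed
  show thesis
    by (rule that[of \<kappa> pn pp], rule \<kappa>, erule tr, rule cd, rule c0, rule pr(1), rule pr(2), erule proj,
        (rule Zc; assumption), (rule st; assumption), (rule bel; assumption))
qed

text \<open>On the stable disc the field is \<open>- y\<close>, with trajectories \<open>exp (- t) y\<close>; star-shapedness keeps them in the
  chart for all positive times.\<close>

lemma stable_disc_nappe:
  assumes \<kappa>: "is_chart \<kappa>" and tr: "\<And>\<kappa>'. \<kappa>' \<in> A \<Longrightarrow> smooth_transition \<kappa> \<kappa>'" and c: "c \<in> domain \<kappa>" "coord \<kappa> c = 0"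
    and Zy: "\<And>y \<kappa>'. y \<in> codomain \<kappa> \<Longrightarrow> pp y = 0 \<Longrightarrow> \<kappa>' \<in> A \<Longrightarrow> chart_inv \<kappa> y \<in> domain \<kappa>' \<Longrightarrow>
      dir_deriv (coord \<kappa>' \<circ> chart_inv \<kappa>) y (- y) = Z (chart_inv \<kappa> y) \<kappa>'"
    and pp: "linear pp"
    and star: "\<And>y s. y \<in> codomain \<kappa> \<Longrightarrow> pp y = 0 \<Longrightarrow> 0 \<le> s \<Longrightarrow> s \<le> 1 \<Longrightarrow> s *\<^sub>R y \<in> codomain \<kappa>"
    and y: "y \<in> codomain \<kappa>" "pp y = 0"
  shows "chart_inv \<kappa> y \<in> nappe A Z c"
proof -
  note k = is_chartD[OF \<kappa>]
  define I where "I = {t. exp (- t) *\<^sub>R y \<in> codomain \<kappa>}"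
  have pp0: "pp (s *\<^sub>R y) = 0" for s using y(2) linear_scale[OF pp] by simp
  obtain T where T: "open T" "codomain \<kappa> = model \<kappa> \<inter> T" using codomain_eq_model_Int[OF \<kappa>] by blast
  have yM: "s *\<^sub>R y \<in> model \<kappa>" for s using y(1) k(2,10) by (intro subspace_scale) auto
  have "I = (\<lambda>t. exp (- t) *\<^sub>R y) -` T" using T(2) yM by (auto simp: I_def)
  then have "open I" using T(1) by (simp add: open_vimage continuous_intros)
  have down: "t \<in> I" if "s \<in> I" "s \<le> t" for s t
  proof -
    have "exp (- (t - s)) *\<^sub>R (exp (- s) *\<^sub>R y) \<in> codomain \<kappa>"
      by (rule star) (use that pp0 in \<open>auto simp: I_def\<close>)
    then show ?thesis by (simp add: I_def mult_exp_exp)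
  qed
  have I0: "0 \<in> I" using y by (simp add: I_def)
  have int: "is_interval I" unfolding is_interval_1 using down by blast
  have "integral_curve A Z (chart_inv \<kappa> (exp (- 0) *\<^sub>R y)) I (\<lambda>t. chart_inv \<kappa> (exp (- t) *\<^sub>R y))"
  proof (rule integral_curve_in_chart[OF \<kappa> tr \<open>open I\<close> int I0, where \<zeta> = "\<lambda>t. - (exp (- t) *\<^sub>R y)"])
    show "((\<lambda>t. exp (- t) *\<^sub>R y) has_vector_derivative - (exp (- t) *\<^sub>R y)) (at t)" for t
      by (auto intro!: derivative_eq_intros)
    show "- (exp (- t) *\<^sub>R y) \<in> model \<kappa>" for t using yM k(2) by (intro subspace_neg) auto
  qed (use Zy pp0 in \<open>auto simp: I_def\<close>)
  then have ic: "integral_curve A Z (chart_inv \<kappa> y) I (\<lambda>t. chart_inv \<kappa> (exp (- t) *\<^sub>R y))" by simp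
  show ?thesis
  proof (rule nappe_forwardI[OF ic])
    show sub: "{0..} \<subseteq> I" using down[OF I0] by auto
    have "((\<lambda>t::real. exp (- t)) \<longlongrightarrow> 0) at_top"
      by (rule filterlim_compose[OF exp_at_bot filterlim_uminus_at_bot_at_top])
    then have "((\<lambda>t::real. exp (- t) *\<^sub>R y) \<longlongrightarrow> 0 *\<^sub>R y) at_top" by (intro tendsto_intros)
    moreover have "\<forall>\<^sub>F t::real in at_top. exp (- t) *\<^sub>R y \<in> codomain \<kappa>"
      using eventually_ge_at_top[of 0] by (rule eventually_mono) (use sub in \<open>auto simp: I_def\<close>)
    moreover have "0 \<in> codomain \<kappa>" using k(6)[OF c(1)] c(2) by simp
    ultimately have "((\<lambda>t::real. chart_inv \<kappa> (exp (- t) *\<^sub>R y)) \<longlongrightarrow> chart_inv \<kappa> 0) at_top"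
      using continuous_on_tendsto_compose[OF k(5)] by simp
    then show "((\<lambda>t. chart_inv \<kappa> (exp (- t) *\<^sub>R y)) \<longlongrightarrow> c) at_top" using k(7)[OF c(1)] c(2) by simp
  qed
qed

text \<open>Positivity along \<open>Z\<close> excludes new critical points. At the old ones the derivatives of \<open>F\<close> and \<open>f\<close> coincide, and a
  parametrization adapted to \<open>f\<close> is adapted to \<open>F\<close> once its domain is shrunk to where \<open>f - F\<close> is constant.\<close>

lemma morse_datum_modification:
  assumes F: "smooth_function A F" and inc: "increasing_on UNIV F"
    and loc: "\<And>x. x \<in> crit \<Longrightarrow> \<exists>G a. open G \<and> x \<in> G \<and> (\<forall>y\<in>G. F y = f y - a)"
  shows "morse_datum A F Z"
proof -
  have D: "\<exists>G. open G \<and> c \<in> G \<and> (\<forall>x\<in>G. \<forall>\<kappa>\<in>A. x \<in> domain \<kappa> \<longrightarrow> (\<forall>X\<in>model \<kappa>. chart_deriv \<kappa> F x X = chart_deriv \<kappa> f x X))"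
    if c0: "c \<in> crit" for c
  proof -
    obtain G a where G: "open G" "c \<in> G" "\<And>y. y \<in> G \<Longrightarrow> F y = f y - a" using loc[OF c0] by blast
    have "chart_deriv \<kappa> F x X = chart_deriv \<kappa> f x X" if x: "x \<in> G" "\<kappa> \<in> A" "x \<in> domain \<kappa>" "X \<in> model \<kappa>" for x \<kappa> X
    proof -
      note c = chart[OF x(2)]
      have "chart_deriv \<kappa> F x X = chart_deriv \<kappa> (\<lambda>x. f x - a) x X"
        by (rule chart_deriv_cong[OF c x(3,4) G(1) x(1) G(3)])
      also have "\<dots> = 1 * chart_deriv \<kappa> f x X"
        by (rule chart_deriv_compose[OF c x(3,4) smooth_in_f[OF x(2,3)]]) (auto intro!: derivative_eq_intros)
      finally show ?thesis by simp
    qed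
    then show ?thesis using G(1,2) by blast
  qed
  have H: "hessian \<kappa> F c X Y = hessian \<kappa> f c X Y" if c: "c \<in> crit" "\<kappa> \<in> A" "c \<in> domain \<kappa>" "X \<in> model \<kappa>" "Y \<in> model \<kappa>" for c \<kappa> X Y
  proof -
    obtain G where G: "open G" "c \<in> G" "\<forall>x\<in>G. \<forall>\<kappa>\<in>A. x \<in> domain \<kappa> \<longrightarrow> (\<forall>X\<in>model \<kappa>. chart_deriv \<kappa> F x X = chart_deriv \<kappa> f x X)"
      using D[OF c(1)] by blast
    have ch: "is_chart \<kappa>" using chart c(2) .
    show ?thesis unfolding hessian_def
      by (rule chart_deriv_cong[OF ch c(3,4), of "G \<inter> domain \<kappa>"])
         (use G c is_chartD(1)[OF ch] in auto)
  qed
  have crit_F: "critical_set A F = crit"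
  proof
    show "critical_set A F \<subseteq> crit"
    proof
      fix x assume x: "x \<in> critical_set A F"
      obtain \<kappa> where \<kappa>: "\<kappa> \<in> A" "x \<in> domain \<kappa>" using chart_at by blast
      have "chart_deriv \<kappa> F x (Z x \<kappa>) = 0" using x \<kappa> Z_model[OF \<kappa>] unfolding critical_set_def by blast
      then show "x \<in> crit" using inc \<kappa> unfolding increasing_on_def by force
    qed
    show "crit \<subseteq> critical_set A F"
    proof
      fix x assume x: "x \<in> crit"
      have "chart_deriv \<kappa> F x X = 0" if "\<kappa> \<in> A" "x \<in> domain \<kappa>" "X \<in> model \<kappa>" for \<kappa> X
      proof -
        have "chart_deriv \<kappa> F x X = chart_deriv \<kappa> f x X" using D[OF x] that by blast
        then show ?thesis using x that unfolding critical_set_def by simp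
      qed
      then show "x \<in> critical_set A F" unfolding critical_set_def by blast
    qed
  qed
  have nd: "nondegenerate_at A F c" if c: "c \<in> crit" for c
  proof -
    have "nondegenerate_at A f c" using datum c unfolding morse_datum_def morse_function_def by blast
    then show ?thesis unfolding nondegenerate_at_def using H[OF c] by simp
  qed
  have par: "\<exists>\<kappa>\<in>A. c \<in> domain \<kappa> \<and> (\<exists>N P WN WP \<psi>. adapted_parametrization A F Z c \<kappa> N P WN WP \<psi>)" if c: "c \<in> crit" for c
  proof -
    obtain \<kappa>0 N P WN WP \<psi> where \<kappa>0: "\<kappa>0 \<in> A" "c \<in> domain \<kappa>0" and ad: "adapted_parametrization A f Z c \<kappa>0 N P WN WP \<psi>"
      using datum c unfolding morse_datum_def pseudo_gradient_def by blast
    define U where "U = {n + p |n p. n \<in> WN \<and> p \<in> WP}"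
    define \<kappa> where "\<kappa> = \<lparr>domain = \<psi> ` U, model = model \<kappa>0, coord = inv_into U \<psi>\<rparr>"
    have N: "subspace N" and P: "subspace P" and NP: "N \<inter> P = {0}" and NPM: "{n + p |n p. n \<in> N \<and> p \<in> P} = model \<kappa>0"
      and hess: "\<And>n p. n \<in> N \<Longrightarrow> p \<in> P \<Longrightarrow> hessian \<kappa>0 f c n p = 0"
      and neg: "\<And>n. n \<in> N - {0} \<Longrightarrow> hessian_form \<kappa>0 f c n < 0"
      and pos: "\<And>n. n \<in> P - {0} \<Longrightarrow> hessian_form \<kappa>0 f c n > 0"
      and WN: "star_shaped_nhd_0 N WN" and WP: "star_shaped_nhd_0 P WP"
      and par: "smooth_parametrization A (model \<kappa>0) U \<psi>" and \<psi>0: "\<psi> 0 = c"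
      and d\<psi>: "\<And>X. X \<in> model \<kappa>0 \<Longrightarrow> dir_deriv (coord \<kappa>0 \<circ> \<psi>) 0 X = X"
      and f\<psi>: "\<And>n p. n \<in> WN \<Longrightarrow> p \<in> WP \<Longrightarrow> f (\<psi> (n + p)) - f c = hessian_form \<kappa>0 f c (n + p)"
      and Z\<psi>: "\<And>n p \<kappa>'. n \<in> WN \<Longrightarrow> p \<in> WP \<Longrightarrow> \<kappa>' \<in> A \<Longrightarrow> \<psi> (n + p) \<in> domain \<kappa>' \<Longrightarrow>
          dir_deriv (coord \<kappa>' \<circ> \<psi>) (n + p) (- n + p) = Z (\<psi> (n + p)) \<kappa>'"
      using ad unfolding adapted_parametrization_def U_def by blast+
    have inj: "inj_on \<psi> U" and comp: "compatible_chart A \<kappa>"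
      using par unfolding smooth_parametrization_def \<kappa>_def by blast+
    have \<kappa>: "is_chart \<kappa>" using comp unfolding compatible_chart_def by blast
    note k = is_chartD[OF \<kappa>]
    have co: "coord \<kappa> (\<psi> y) = y" if "y \<in> U" for y using inj that by (simp add: \<kappa>_def inv_into_f_f)
    have dom: "domain \<kappa> = \<psi> ` U" by (simp add: \<kappa>_def)
    have cod: "codomain \<kappa> = U" using co by (force simp: codomain_def dom)
    have ci: "chart_inv \<kappa> y = \<psi> y" if "y \<in> U" for y using k(7)[of "\<psi> y"] co[OF that] that dom by simp
    have sub: "WN \<subseteq> N" "WP \<subseteq> P" and z: "0 \<in> WN" "0 \<in> WP"
      using WN WP openin_imp_subset unfolding star_shaped_nhd_0_def by blast+
    have U0: "0 \<in> U" using z by (force simp: U_def)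
    obtain pn pp where pr: "bounded_linear pn" "bounded_linear pp"
      and d: "\<And>n p. n \<in> N \<Longrightarrow> p \<in> P \<Longrightarrow> pn (n + p) = n \<and> pp (n + p) = p"
      using direct_sum_projections[OF N P NP] by blast
    obtain G a where G: "open G" "c \<in> G" "\<And>y. y \<in> G \<Longrightarrow> F y = f y - a" using loc[OF c] by blast
    obtain T where T: "open T" "\<And>y. y \<in> codomain \<kappa> \<Longrightarrow> y \<in> T \<longleftrightarrow> chart_inv \<kappa> y \<in> G"
      using chart_inv_preimage_open[OF \<kappa> G(1)] by blast
    have "0 \<in> T" using T(2)[of 0] cod U0 ci \<psi>0 G(2) by simp
    then obtain r where r: "0 < r" "ball 0 r \<subseteq> T" using T(1) openE by blast
    define WN' where "WN' = WN \<inter> ball 0 (r / 2)"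
    define WP' where "WP' = WP \<inter> ball 0 (r / 2)"
    define U' where "U' = {n + p |n p. n \<in> WN' \<and> p \<in> WP'}"
    have U'U: "U' \<subseteq> U" by (auto simp: U'_def U_def WN'_def WP'_def)
    have U'G: "\<psi> y \<in> G" if "y \<in> U'" for y
    proof -
      obtain n p where np: "n \<in> WN'" "p \<in> WP'" "y = n + p" using \<open>y \<in> U'\<close> U'_def by blast
      then have "norm y < r" using norm_triangle_ineq[of n p] by (auto simp: WN'_def WP'_def)
      then have "y \<in> ball 0 r" by simp
      then have "y \<in> T" using r(2) by blast
      moreover have yU: "y \<in> U" using that U'U by blast
      ultimately show ?thesis using T(2)[of y] ci[OF yU] cod by simp
    qed
    have star: "star_shaped_nhd_0 E (W \<inter> ball 0 (r / 2))" if "star_shaped_nhd_0 E W" for E W :: "'e set"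
    proof -
      have "closed_segment 0 x \<subseteq> ball 0 (r / 2)" if "x \<in> ball 0 (r / 2)" for x :: 'e
        using that r by (intro closed_segment_subset convex_ball) auto
      then show ?thesis using that r unfolding star_shaped_nhd_0_def by (auto simp: openin_Int_open)
    qed
    define \<kappa>' where "\<kappa>' = \<lparr>domain = \<psi> ` U', model = model \<kappa>0, coord = inv_into U' \<psi>\<rparr>"
    have comp': "compatible_chart A \<kappa>'"
    proof (rule compatible_chart_restrict[OF comp chart])
      define Q where "Q = pn -` ball 0 (r / 2) \<inter> pp -` ball 0 (r / 2)"
      have Q: "open Q" unfolding Q_def by (intro open_Int open_vimage linear_continuous_on pr open_ball)
      have "U' = U \<inter> Q"
      proof
        show "U' \<subseteq> U \<inter> Q"
        proof
          fix y assume y: "y \<in> U'"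
          then obtain n p where np: "n \<in> WN'" "p \<in> WP'" "y = n + p" by (auto simp: U'_def)
          then have "n \<in> N" "p \<in> P" using sub by (auto simp: WN'_def WP'_def)
          then have "pn y = n" "pp y = p" using d np(3) by auto
          then have "y \<in> Q" using np(1,2) by (simp add: Q_def WN'_def WP'_def)
          then show "y \<in> U \<inter> Q" using y U'U by blast
        qed
        show "U \<inter> Q \<subseteq> U'"
        proof
          fix y assume y: "y \<in> U \<inter> Q"
          then obtain n p where np: "n \<in> WN" "p \<in> WP" "y = n + p" by (auto simp: U_def)
          then have "n \<in> N" "p \<in> P" using sub by auto
          then have "pn y = n" "pp y = p" using d np(3) by auto
          then have "n \<in> WN'" "p \<in> WP'" using y np by (auto simp: WN'_def WP'_def Q_def)
          then show "y \<in> U'" using np(3) U'_def by blast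
        qed
      qed
      then have "domain \<kappa>' = {x \<in> domain \<kappa>. coord \<kappa> x \<in> Q}" using co by (auto simp: \<kappa>'_def dom)
      then show "open (domain \<kappa>')" using coord_preimage_open[OF \<kappa> Q] by simp
      show "domain \<kappa>' \<subseteq> domain \<kappa>" using U'U by (auto simp: \<kappa>'_def dom)
      show "model \<kappa>' = model \<kappa>" by (simp add: \<kappa>'_def \<kappa>_def)
      fix x assume "x \<in> domain \<kappa>'"
      then obtain y where "y \<in> U'" "x = \<psi> y" by (auto simp: \<kappa>'_def)
      then show "coord \<kappa>' x = coord \<kappa> x" using co U'U inj_on_subset[OF inj U'U] by (auto simp: \<kappa>'_def inv_into_f_f)
    qed
    have N0: "0 \<in> N" "0 \<in> P" using N P by (auto intro: subspace_0)
    have inM: "n + p \<in> model \<kappa>0" if "n \<in> N" "p \<in> P" for n p using that unfolding NPM[symmetric] by blast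
    have inM': "n \<in> model \<kappa>0" if "n \<in> N \<or> n \<in> P" for n
      using inM[of n 0] inM[of 0 n] N0 that by auto
    have hf: "hessian_form \<kappa>0 F c X = hessian_form \<kappa>0 f c X" if "X \<in> model \<kappa>0" for X
      unfolding hessian_form_def using H[OF c \<kappa>0 that that] by simp
    have "adapted_parametrization A F Z c \<kappa>0 N P WN' WP' \<psi>"
      unfolding adapted_parametrization_def U'_def[symmetric]
    proof (intro conjI ballI impI)
      show "smooth_parametrization A (model \<kappa>0) U' \<psi>"
        unfolding smooth_parametrization_def using comp' inj_on_subset[OF inj U'U] by (simp add: \<kappa>'_def)
      show "star_shaped_nhd_0 N WN'" "star_shaped_nhd_0 P WP'" unfolding WN'_def WP'_def by (intro star WN WP)+
      show "hessian \<kappa>0 F c n p = 0" if "n \<in> N" "p \<in> P" for n p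
        using H[OF c \<kappa>0] hess that inM' by simp
      show "hessian_form \<kappa>0 F c n < 0" if "n \<in> N - {0}" for n using hf neg that inM' by simp
      show "hessian_form \<kappa>0 F c n > 0" if "n \<in> P - {0}" for n using hf pos that inM' by simp
      show "F (\<psi> (n + p)) - F c = hessian_form \<kappa>0 F c (n + p)" if np: "n \<in> WN'" "p \<in> WP'" for n p
      proof -
        have "n + p \<in> U'" using np U'_def by blast
        then have "F (\<psi> (n + p)) = f (\<psi> (n + p)) - a" using G(3) U'G by blast
        moreover have "n \<in> WN" "p \<in> WP" using np by (auto simp: WN'_def WP'_def)
        moreover from this have "n + p \<in> model \<kappa>0" using sub by (intro inM) auto
        ultimately show ?thesis using f\<psi>[of n p] G(3)[OF G(2)] hf by simp
      qed
      show "dir_deriv (coord \<kappa>'' \<circ> \<psi>) (n + p) (- n + p) = Z (\<psi> (n + p)) \<kappa>''"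
        if "n \<in> WN'" "p \<in> WP'" "\<kappa>'' \<in> A" "\<psi> (n + p) \<in> domain \<kappa>''" for n p \<kappa>''
        by (rule Z\<psi>) (use that in \<open>auto simp: WN'_def WP'_def\<close>)
    qed (use N P NP NPM \<psi>0 d\<psi> in auto)
    then show ?thesis using \<kappa>0 by blast
  qed
  have "morse_function A F" unfolding morse_function_def crit_F using F nd by blast
  moreover have "pseudo_gradient A F Z"
    unfolding pseudo_gradient_def crit_F using field inc par by (auto simp: increasing_on_def)
  ultimately show ?thesis unfolding morse_datum_def by blast
qed

end

section \<open>Lowering along the nappe\<close>

lemma proper_above_slab_compact:
  fixes f :: "'v::t2_space \<Rightarrow> real"
  assumes "proper_above W f u'" "u' < v"
  shows "compact {x \<in> W. v \<le> f x \<and> f x \<le> s}"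
proof -
  let ?W = "W \<inter> f -` {u'<..}"
  have "compactin (top_of_set {u'<..}) {v..s}"
    using assms(2) by (auto simp: compactin_subtopology)
  moreover have "proper_map (top_of_set ?W) (top_of_set {u'<..}) f"
    using assms(1) by (simp add: proper_above_def)
  ultimately have "compactin (top_of_set ?W) {x \<in> topspace (top_of_set ?W). f x \<in> {v..s}}"
    by (rule compactin_proper_map_preimage[rotated])
  moreover have "{x \<in> topspace (top_of_set ?W). f x \<in> {v..s}} = {x \<in> W. v \<le> f x \<and> f x \<le> s}"
    using assms(2) by auto
  ultimately show ?thesis by (simp add: compactin_subtopology)
qed

text \<open>Compactness gives room below the level \<open>u\<close>.\<close>

lemma proper_above_room:
  fixes f :: "'v::t2_space \<Rightarrow> real"
  assumes pr: "proper_above W f u'" and u: "u' < u" and U: "open U" "{x \<in> W. u \<le> f x} \<subseteq> U" and f: "continuous_on UNIV f"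
  obtains v where "u' < v" "v < u" "{x \<in> W. v \<le> f x} \<subseteq> U"
proof -
  define u1 where "u1 = (u' + u) / 2"
  have u1: "u' < u1" "u1 < u" using u by (auto simp: u1_def)
  define K where "K = {x \<in> W. u1 \<le> f x \<and> f x \<le> u} - U"
  have K: "compact K" unfolding K_def
    using compact_diff[OF proper_above_slab_compact[OF pr u1(1)] U(1)] .
  have lt: "f x < u" if "x \<in> K" for x using that U(2) by (force simp: K_def)
  obtain m where m: "m < u" "\<And>x. x \<in> K \<Longrightarrow> f x \<le> m"
  proof (cases "K = {}")
    case True
    then show thesis using that[of u1] u1 by auto
  next
    case False
    obtain x where "x \<in> K" "\<And>y. y \<in> K \<Longrightarrow> f y \<le> f x"
      using continuous_attains_sup[OF K False continuous_on_subset[OF f]] by auto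
    then show thesis using that[of "f x"] lt by auto
  qed
  define v where "v = max u1 ((m + u) / 2)"
  show thesis
  proof (rule that[of v])
    show "{x \<in> W. v \<le> f x} \<subseteq> U"
    proof clarify
      fix x assume x: "x \<in> W" "v \<le> f x"
      show "x \<in> U"
      proof (rule ccontr)
        assume n: "x \<notin> U"
        then have "f x < u" using x U(2) by force
        then have "x \<in> K" using x n by (auto simp: K_def v_def)
        then have "f x \<le> m" by (rule m)
        then show False using x(2) m(1) by (simp add: v_def)
      qed
    qed
  qed (use u1 m in \<open>auto simp: v_def\<close>)
qed

context morse
begin

text \<open>Below the critical level the slab of the nappe is compact and free of critical points, so tubes have a uniform
  length there; finitely many of them lead from any point down to the level \<open>v\<close>, where \<open>f\<close> itself is low.\<close>

lemma lowering_on_nappe: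
  assumes pr: "proper_above (nappe A Z c) f u'" and v: "u' < v" and U: "open U" "{x \<in> nappe A Z c. v \<le> f x} \<subseteq> U"
    and s: "s < f c" and w: "w \<in> nappe A Z c" "v \<le> f w" "f w \<le> s" and \<mu>: "v < \<mu>"
  obtains h where "lowering U h" "h w < \<mu>"
proof -
  define K where "K = {x \<in> nappe A Z c. v \<le> f x \<and> f x \<le> s}"
  have K: "compact K" unfolding K_def by (rule proper_above_slab_compact[OF pr v])
  have KU: "x \<in> U" "x \<notin> crit" if "x \<in> K" for x
  proof -
    show "x \<in> U" using that U by (auto simp: K_def)
    show "x \<notin> crit"
    proof
      assume "x \<in> crit"
      then have "x = c" using nappe_zero[of x c] crit_zero that by (auto simp: K_def)
      then show False using that s by (auto simp: K_def)
    qed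
  qed
  define good where "good N \<tau> \<longleftrightarrow> open N \<and> 0 < \<tau> \<and> (\<forall>w\<in>N. \<forall>a. f w - \<tau> \<le> a \<longrightarrow> a < f w \<longrightarrow>
      (\<exists>w\<^sub>1. f w\<^sub>1 = a \<and> (\<forall>c. w \<in> nappe A Z c \<longrightarrow> w\<^sub>1 \<in> nappe A Z c) \<and>
        (\<forall>h \<mu>. lowering U h \<longrightarrow> h w\<^sub>1 < \<mu> \<longrightarrow> (\<exists>h'. lowering U h' \<and> h' w < \<mu>))))" for N \<tau>
  have "\<exists>N \<tau>. x \<in> N \<and> good N \<tau>" if "x \<in> K" for x
    using tube[OF U(1) KU[OF that]] unfolding good_def by metis
  then obtain N \<tau> where N: "\<And>x. x \<in> K \<Longrightarrow> x \<in> N x \<and> good (N x) (\<tau> x)" by metis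
  have op: "open (N x)" if "x \<in> K" for x using N[OF that] by (simp add: good_def)
  obtain D where D: "D \<subseteq> K" "finite D" "K \<subseteq> (\<Union>x\<in>D. N x)"
  proof (rule compactE_image[OF K, of K N])
    show "K \<subseteq> (\<Union>x\<in>K. N x)" using N by blast
  qed (use op that in auto)
  define t where "t = Min (insert 1 (\<tau> ` D))"
  have t: "0 < t" unfolding t_def using D N by (subst Min_gr_iff) (auto simp: good_def)
  have tle: "t \<le> \<tau> x" if "x \<in> D" for x unfolding t_def using D that by (intro Min_le) auto
  have step: "\<exists>h. lowering U h \<and> h w < \<mu>" if "w \<in> K" "f w \<le> v + real n * t" for w n
    using that
  proof (induction n arbitrary: w)
    case 0
    then show ?case using lowering_f \<mu> by (intro exI[of _ f]) auto
  next
    case (Suc n)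
    show ?case
    proof (cases "f w \<le> v + real n * t")
      case True
      then show ?thesis using Suc by blast
    next
      case False
      define a where "a = max v (f w - t)"
      have nt: "0 \<le> real n * t" using t by simp
      have "v < f w" using False nt by linarith
      then have a: "v \<le> a" "f w - t \<le> a" "a < f w" using t by (auto simp: a_def)
      have an: "a \<le> v + real n * t" using Suc.prems(2) nt by (auto simp: a_def algebra_simps)
      obtain x where x: "x \<in> D" "w \<in> N x" using D Suc.prems(1) by blast
      have "good (N x) (\<tau> x)" using N x D by blast
      moreover have "f w - \<tau> x \<le> a" using a tle[OF x(1)] by linarith
      ultimately obtain w1 where w1: "f w1 = a" "w \<in> nappe A Z c \<longrightarrow> w1 \<in> nappe A Z c"
        "\<And>h \<mu>. lowering U h \<Longrightarrow> h w1 < \<mu> \<Longrightarrow> \<exists>h'. lowering U h' \<and> h' w < \<mu>"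
        using x(2) a(3) unfolding good_def by meson
      have "w1 \<in> K" using w1 a Suc.prems(1) by (auto simp: K_def)
      then obtain h where "lowering U h" "h w1 < \<mu>" using Suc.IH w1(1) an by blast
      then show ?thesis by (rule w1(3))
    qed
  qed
  obtain n where "(f w - v) / t \<le> real n" using real_arch_simple by blast
  then have "f w \<le> v + real n * t" using t by (simp add: pos_divide_le_eq algebra_simps)
  moreover have "w \<in> K" using w by (simp add: K_def)
  ultimately show thesis using step that by blast
qed

lemma lowering_finite_min:
  assumes "finite \<H>" "\<And>h. h \<in> \<H> \<Longrightarrow> lowering U h" "0 < e"
  shows "\<exists>h. lowering U h \<and> (\<forall>k\<in>\<H>. \<forall>x. h x \<le> k x + e)"
  using assms
proof (induction \<H> arbitrary: e rule: finite_induct)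
  case empty
  then show ?case using lowering_f by blast
next
  case (insert k \<H>)
  have "\<exists>h. lowering U h \<and> (\<forall>k\<in>\<H>. \<forall>x. h x \<le> k x + e)" using insert by simp
  then obtain h where h: "lowering U h" "\<And>k x. k \<in> \<H> \<Longrightarrow> h x \<le> k x + e" by blast
  have "lowering U (\<lambda>x. smin e (h x) (k x))" using insert h by (intro lowering_smin) auto
  moreover have "smin e (h x) (k' x) \<le> k' x + e" for k' x using smin_le_right insert.prems(2) .
  moreover have "smin e (h x) (k x) \<le> k' x + e" if "k' \<in> \<H>" for k' x
    using smin_le_left[OF insert.prems(2), of "h x" "k x"] h(2)[OF that, of x] by linarith
  ultimately show ?case by (intro exI[of _ "\<lambda>x. smin e (h x) (k x)"]) auto
qed

text \<open>The strict gap \<open>H - H'\<close> absorbs the error of the smooth minimum of the finitely many functions that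
  cover \<open>S\<close>.\<close>

lemma lowering_on_compact:
  assumes pr: "proper_above (nappe A Z c) f u'" and v: "u' < v" and U: "open U" "{x \<in> nappe A Z c. v \<le> f x} \<subseteq> U"
    and S: "compact S" "S \<subseteq> nappe A Z c" "\<And>x. x \<in> S \<Longrightarrow> v + H < f x" "\<And>x. x \<in> S \<Longrightarrow> f x < f c"
    and H: "0 \<le> H'" "H' < H"
  obtains h where "lowering U h" "\<And>x. x \<in> S \<Longrightarrow> h x < f x - H'"
proof (cases "S = {}")
  case True
  then show thesis using that lowering_f by blast
next
  case False
  have cf: "continuous_on T f" for T using continuous_on_subset[OF smooth_continuous[OF smooth_f]] by blast
  obtain m where m: "m \<in> S" "\<And>x. x \<in> S \<Longrightarrow> f x \<le> f m"
    using continuous_attains_sup[OF S(1) False cf] by auto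
  have "\<exists>h. lowering U h \<and> h x < f x - H" if x: "x \<in> S" for x
  proof -
    have "v < f x - H" using S(3)[OF x] by simp
    moreover have "v \<le> f x" using S(3)[OF x] H by simp
    ultimately show ?thesis
      using lowering_on_nappe[OF pr v U S(4)[OF m(1)] _ _ m(2)[OF x]] S(2) x by blast
  qed
  then obtain k where k: "\<And>x. x \<in> S \<Longrightarrow> lowering U (k x)" "\<And>x. x \<in> S \<Longrightarrow> k x x < f x - H" by metis
  have op: "open {y. k x y < f y - H}" if "x \<in> S" for x
    using k(1)[OF that] smooth_continuous[of "k x"] cf[of UNIV]
    by (intro open_Collect_less continuous_intros) (auto simp: lowering_def)
  obtain D where D: "D \<subseteq> S" "finite D" "S \<subseteq> (\<Union>x\<in>D. {y. k x y < f y - H})"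
  proof (rule compactE_image[OF S(1), of S "\<lambda>x. {y. k x y < f y - H}"])
    show "S \<subseteq> (\<Union>x\<in>S. {y. k x y < f y - H})" using k(2) by blast
  qed (use op that in auto)
  have "\<exists>h. lowering U h \<and> (\<forall>k'\<in>k ` D. \<forall>x. h x \<le> k' x + (H - H'))"
    by (rule lowering_finite_min) (use D k H in auto)
  then obtain h where h: "lowering U h" "\<And>d x. d \<in> D \<Longrightarrow> h x \<le> k d x + (H - H')" by blast
  have "h x < f x - H'" if x: "x \<in> S" for x
  proof -
    obtain d where "d \<in> D" "k d x < f x - H" using D(3) x by blast
    then show ?thesis using h(2)[of d x] by linarith
  qed
  then show thesis using that h(1) by blast
qed

section \<open>Moving the critical value\<close>

text \<open>In the Morse chart the function \<open>f - H1\<close>, with a penalty \<open>p\<close> for leaving the stable disc, takes over from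
  a lowering \<open>h\<close> of \<open>f\<close> which is smaller than \<open>f - H1\<close> on the sphere bounding the disc. At \<open>c\<close> the function \<open>h\<close> is
  still \<open>f\<close>, so there the smooth minimum is a constant shift of \<open>f\<close>. The drop \<open>H1\<close> is slightly larger than the required
  drop \<open>H\<close>, to which the parameter of the smooth minimum brings it back.\<close>

lemma lowered_function:
  assumes c: "c \<in> crit" and u: "u' < u" "u < f c" and pr: "proper_above (nappe A Z c) f u'"
    and U: "open U" "{x \<in> nappe A Z c. u \<le> f x} \<subseteq> U"
  obtains h G C where "smooth_function A h" "increasing_on UNIV h" "\<And>x. h x \<le> f x"
    "closed C" "C \<subseteq> U" "\<And>x. x \<notin> C \<Longrightarrow> h x = f x" "C \<inter> crit \<subseteq> {c}"
    "open G" "c \<in> G" "\<And>x. x \<in> G \<Longrightarrow> h x = f x - f c + u"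
proof -
  have cf: "continuous_on T f" for T using continuous_on_subset[OF smooth_continuous[OF smooth_f]] by blast
  obtain v where v: "u' < v" "v < u" "{x \<in> nappe A Z c. v \<le> f x} \<subseteq> U"
    using proper_above_room[OF pr u(1) U cf] by blast
  \<comment> \<open>\<open>H\<close> is the required drop; \<open>H1 > H\<close> is needed for tuning the last smooth minimum, and \<open>H2 > H1\<close> for the finite
    smooth minimum on the sphere. The value \<open>f c - H2\<close> is still above \<open>v\<close>.\<close>
  define H where "H = f c - u"
  define H1 where "H1 = H + (u - v) / 3"
  define H2 where "H2 = H + (u - v) * 2 / 3"
  have H: "0 < H" "H < H1" "H1 < H2" "v + H2 < f c" using u v by (auto simp: H_def H1_def H2_def field_simps)
  obtain \<kappa> pn pp where \<kappa>: "is_chart \<kappa>" and tr: "\<And>\<kappa>'. \<kappa>' \<in> A \<Longrightarrow> smooth_transition \<kappa> \<kappa>' \<and> smooth_transition \<kappa>' \<kappa>"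
    and cd: "c \<in> domain \<kappa>" "coord \<kappa> c = 0" and bl: "bounded_linear pn" "bounded_linear pp"
    and proj: "\<And>y. y \<in> model \<kappa> \<Longrightarrow> pn y + pp y = y \<and> pn y \<in> model \<kappa> \<and> pp y \<in> model \<kappa> \<and> pn (pn y) = pn y \<and> pp (pn y) = 0 \<and> pn (pp y) = 0 \<and> pp (pp y) = pp y"
    and Zy: "\<And>y \<kappa>'. y \<in> codomain \<kappa> \<Longrightarrow> \<kappa>' \<in> A \<Longrightarrow> chart_inv \<kappa> y \<in> domain \<kappa>' \<Longrightarrow>
      dir_deriv (coord \<kappa>' \<circ> chart_inv \<kappa>) y (- pn y + pp y) = Z (chart_inv \<kappa> y) \<kappa>'"
    and star: "\<And>y s. y \<in> codomain \<kappa> \<Longrightarrow> pp y = 0 \<Longrightarrow> 0 \<le> s \<Longrightarrow> s \<le> 1 \<Longrightarrow> s *\<^sub>R y \<in> codomain \<kappa>"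
    and below: "\<And>y. y \<in> codomain \<kappa> \<Longrightarrow> pp y = 0 \<Longrightarrow> y \<noteq> 0 \<Longrightarrow> f (chart_inv \<kappa> y) < f c"
    by (rule morse_chart[OF c]) (rule that[rotated 6], assumption+)
  note k = is_chartD[OF \<kappa>]
  have lin: "linear pn" "linear pp" using bl by (auto simp: linear_conv_bounded_linear)
  have disc: "chart_inv \<kappa> y \<in> nappe A Z c" if y: "y \<in> codomain \<kappa>" "pp y = 0" for y
  proof (rule stable_disc_nappe[OF \<kappa> _ cd _ lin(2) star y])
    fix y \<kappa>' assume *: "y \<in> codomain \<kappa>" "pp y = 0" "\<kappa>' \<in> A" "chart_inv \<kappa> y \<in> domain \<kappa>'"
    have "pn y = y" using proj[of y] k(10) * by auto
    then show "dir_deriv (coord \<kappa>' \<circ> chart_inv \<kappa>) y (- y) = Z (chart_inv \<kappa> y) \<kappa>'" using Zy[OF *(1,3,4)] *(2) by simp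
  qed (use tr in auto)
  have z: "0 \<in> codomain \<kappa>" "chart_inv \<kappa> 0 = c" using k(6,7)[OF cd(1)] cd(2) by auto
  have cW: "c \<in> nappe A Z c" using disc[OF z(1)] linear_0[OF lin(2)] z(2) by simp
  define M where "M = model \<kappa>"
  have Z_chart: "- pn (coord \<kappa> x) + pp (coord \<kappa> x) \<in> M"
      "\<And>\<kappa>'. \<kappa>' \<in> A \<Longrightarrow> x \<in> domain \<kappa>' \<Longrightarrow> dir_deriv (coord \<kappa>' \<circ> chart_inv \<kappa>) (coord \<kappa> x) (- pn (coord \<kappa> x) + pp (coord \<kappa> x)) = Z x \<kappa>'"
    if x: "x \<in> domain \<kappa>" for x
  proof -
    have "coord \<kappa> x \<in> model \<kappa>" using k(6)[OF x] k(10) by blast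
    then show "- pn (coord \<kappa> x) + pp (coord \<kappa> x) \<in> M"
      unfolding M_def using proj k(2) by (intro subspace_add subspace_neg) auto
    show "dir_deriv (coord \<kappa>' \<circ> chart_inv \<kappa>) (coord \<kappa> x) (- pn (coord \<kappa> x) + pp (coord \<kappa> x)) = Z x \<kappa>'"
      if "\<kappa>' \<in> A" "x \<in> domain \<kappa>'" for \<kappa>'
      using Zy[OF k(6)[OF x] that(1)] k(7)[OF x] that(2) by simp
  qed
  have qC: "Cinf_on UNIV (\<lambda>y. l y \<bullet> l y)" if "bounded_linear l" for l :: "'e \<Rightarrow> 'e"
    using that by (intro Cinf_on_inner Cinf_on_linear open_UNIV)
  have qD: "((\<lambda>y. l y \<bullet> l y) has_derivative (\<lambda>w. 2 * (l y \<bullet> l w))) (at y)" if "bounded_linear l" for l :: "'e \<Rightarrow> 'e" and y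
  proof -
    have "(l has_derivative l) (at y)" using that by (rule bounded_linear_imp_has_derivative)
    from has_derivative_inner[OF this this] show ?thesis
      by (rule has_derivative_eq_rhs) (simp add: inner_commute fun_eq_iff)
  qed
  have pZ: "pp (- pn y + pp y) = pp y" "pn (- pn y + pp y) = - pn y" if "y \<in> M" for y
    using proj[of y] that by (simp_all add: M_def linear_add[OF lin(1)] linear_add[OF lin(2)] linear_diff[OF lin(1)] linear_diff[OF lin(2)])
  have dM: "coord \<kappa> x \<in> M" if "x \<in> domain \<kappa>" for x using k(6)[OF that] k(10) by (auto simp: M_def)
  \<comment> \<open>The squared norms of the two components change along \<open>Z\<close> except at \<open>c\<close>, hence \<open>Z\<close> has no other zero in the chart.\<close>
  have only_c: "x = c" if x: "x \<in> domain \<kappa>" "x \<in> crit" for x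
  proof -
    obtain \<kappa>' where \<kappa>': "\<kappa>' \<in> A" "x \<in> domain \<kappa>'" using chart_at by blast
    let ?y = "coord \<kappa> x"
    have "frechet_derivative (\<lambda>y. l y \<bullet> l y) (at ?y) (- pn ?y + pp ?y) = 0" if "bounded_linear l" for l :: "'e \<Rightarrow> 'e"
      using chart_pullback(2)[OF \<kappa> tr open_UNIV qC[OF that] x(1) UNIV_I \<kappa>' Z_chart(1)[OF x(1), unfolded M_def] Z_chart(2)[OF x(1) \<kappa>']]
        crit_chart_deriv[OF x(2) \<kappa>'] by simp
    then have "l ?y \<bullet> l (- pn ?y + pp ?y) = 0" if "bounded_linear l" for l :: "'e \<Rightarrow> 'e"
      using frechet_derivative_at[OF qD[OF that, of ?y]] that by (metis mult_eq_0_iff zero_neq_numeral)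
    from this[OF bl(1)] this[OF bl(2)] have "pn ?y = 0" "pp ?y = 0" using pZ[OF dM[OF x(1)]] by auto
    then have "?y = 0" using proj[of ?y] dM[OF x(1)] by (simp add: M_def)
    then show ?thesis using k(7)[OF x(1)] z(2) by simp
  qed
  obtain T1 where T1: "open T1" "codomain \<kappa> = M \<inter> T1" using codomain_eq_model_Int[OF \<kappa>] unfolding M_def by blast
  obtain T2 where T2: "open T2" "\<And>y. y \<in> codomain \<kappa> \<Longrightarrow> y \<in> T2 \<longleftrightarrow> chart_inv \<kappa> y \<in> U \<inter> {x. v + H2 < f x}"
  proof -
    have "open (U \<inter> {x. v + H2 < f x})" using cf[of UNIV] by (intro open_Int U open_Collect_less continuous_intros)
    then show thesis using chart_inv_preimage_open[OF \<kappa>] that by blast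
  qed
  have "c \<in> U \<inter> {x. v + H2 < f x}" using cW U u H by auto
  then have "0 \<in> T1 \<inter> T2" using T2(2)[OF z(1)] z T1 by auto
  then obtain R where R: "0 < R" "ball 0 R \<subseteq> T1 \<inter> T2" using T1 T2 open_Int openE by metis
  define \<rho> where "\<rho> = R / 3"
  have \<rho>: "0 < \<rho>" using R by (simp add: \<rho>_def)
  define K where "K = {y \<in> M. norm (pn y) \<le> \<rho> \<and> norm (pp y) \<le> \<rho>}"
  have cpn: "continuous_on T pn" and cpp: "continuous_on T pp" for T
    using bl by (auto intro: linear_continuous_on)
  have Mcl: "closed M" unfolding M_def using k(2) by (rule closed_subspace)
  have Kn: "norm y \<le> 2 * \<rho>" if "y \<in> K" for y
    using that proj[of y] norm_triangle_ineq[of "pn y" "pp y"] by (auto simp: K_def M_def)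
  have Kcod: "y \<in> codomain \<kappa>" "chart_inv \<kappa> y \<in> U" "v + H2 < f (chart_inv \<kappa> y)" if "y \<in> K" for y
  proof -
    have "y \<in> ball 0 R" using Kn[OF that] R by (simp add: \<rho>_def)
    then have "y \<in> T1 \<inter> T2" using R by blast
    moreover have "y \<in> M" using that by (simp add: K_def)
    ultimately show "y \<in> codomain \<kappa>" using T1 by blast
    then show "chart_inv \<kappa> y \<in> U" "v + H2 < f (chart_inv \<kappa> y)" using T2(2) \<open>y \<in> T1 \<inter> T2\<close> by auto
  qed
  have "closed K"
  proof -
    have "closed (M \<inter> ({y. norm (pn y) \<le> \<rho>} \<inter> {y. norm (pp y) \<le> \<rho>}))"
      by (intro closed_Int Mcl closed_Collect_le continuous_intros cpn cpp)
    moreover have "K = M \<inter> ({y. norm (pn y) \<le> \<rho>} \<inter> {y. norm (pp y) \<le> \<rho>})" by (auto simp: K_def)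
    ultimately show ?thesis by simp
  qed
  moreover have "bounded K" using Kn by (auto simp: bounded_iff)
  ultimately have K: "compact K" by (simp add: compact_eq_bounded_closed)
  have cinv: "continuous_on P (chart_inv \<kappa>)" if "P \<subseteq> K" for P
    by (rule continuous_on_subset[OF k(5)]) (use that Kcod in blast)
  define Sn where "Sn = K \<inter> {y. norm (pn y) = \<rho> \<and> pp y = 0}"
  have Sn: "compact Sn"
  proof -
    have "closed ({y. norm (pn y) = \<rho>} \<inter> {y. pp y = 0})"
      by (intro closed_Int closed_Collect_eq continuous_intros cpn cpp)
    moreover have "Sn = K \<inter> ({y. norm (pn y) = \<rho>} \<inter> {y. pp y = 0})" by (auto simp: Sn_def)
    ultimately show ?thesis using compact_Int_closed[OF K] by simp
  qed
  obtain h where h: "lowering U h" "\<And>x. x \<in> chart_inv \<kappa> ` Sn \<Longrightarrow> h x < f x - H1"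
  proof (rule lowering_on_compact[OF pr v(1) U(1) v(3), of "chart_inv \<kappa> ` Sn" H2 H1])
    show "compact (chart_inv \<kappa> ` Sn)" by (rule compact_continuous_image[OF cinv Sn]) (auto simp: Sn_def)
    show "chart_inv \<kappa> ` Sn \<subseteq> nappe A Z c" using disc Kcod by (auto simp: Sn_def)
    show "v + H2 < f x" if "x \<in> chart_inv \<kappa> ` Sn" for x using that Kcod by (auto simp: Sn_def)
    show "f x < f c" if x: "x \<in> chart_inv \<kappa> ` Sn" for x
    proof -
      obtain y where y: "y \<in> Sn" "x = chart_inv \<kappa> y" using x by blast
      then have "y \<noteq> 0" using \<rho> linear_0[OF lin(1)] by (auto simp: Sn_def)
      then show ?thesis using below[of y] y Kcod by (auto simp: Sn_def)
    qed
  qed (use H that in auto)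
  have hs: "smooth_function A h" and hi: "increasing_on UNIV h" and hf: "\<And>x. h x \<le> f x"
    using h(1) unfolding lowering_def by blast+
  obtain C where C: "closed C" "C \<subseteq> U" "C \<inter> crit = {}" "\<And>x. x \<notin> C \<Longrightarrow> h x = f x"
    using h(1) unfolding lowering_def by blast
  have ch: "continuous_on T h" for T using continuous_on_subset[OF smooth_continuous[OF hs]] by blast
  \<comment> \<open>On the side \<open>\<bar>pn y\<bar> = \<rho>\<close> of the box, \<open>h\<close> can only reach \<open>f - H1\<close> at some distance from the stable disc.\<close>
  obtain t where t: "0 < t" "t \<le> \<rho>\<^sup>2"
    "\<And>y. y \<in> K \<Longrightarrow> norm (pn y) = \<rho> \<Longrightarrow> f (chart_inv \<kappa> y) - H1 \<le> h (chart_inv \<kappa> y) \<Longrightarrow> t \<le> pp y \<bullet> pp y"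
  proof -
    define F where "F = K \<inter> {y. norm (pn y) = \<rho>}"
    have F: "compact F" unfolding F_def by (intro compact_Int_closed[OF K] closed_Collect_eq continuous_intros cpn)
    define d where "d y = h (chart_inv \<kappa> y) - (f (chart_inv \<kappa> y) - H1)" for y
    have cd: "continuous_on F d" unfolding d_def
      by (intro continuous_intros continuous_on_compose2[OF ch[of UNIV] cinv] continuous_on_compose2[OF cf[of UNIV] cinv]) (auto simp: F_def)
    define B where "B = F \<inter> d -` {0..}"
    have B: "compact B"
    proof -
      have "closed B" unfolding B_def by (rule continuous_closed_preimage[OF cd compact_imp_closed[OF F] closed_atLeast])
      then have "compact (F \<inter> B)" by (rule compact_Int_closed[OF F])
      moreover have "F \<inter> B = B" by (auto simp: B_def)
      ultimately show ?thesis by simp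
    qed
    have pos: "0 < pp y \<bullet> pp y" if "y \<in> B" for y
    proof (rule ccontr)
      assume "\<not> 0 < pp y \<bullet> pp y"
      then have "pp y = 0" by simp
      then have "y \<in> Sn" using that by (auto simp: B_def F_def Sn_def)
      then have "d y < 0" using h(2) by (auto simp: d_def)
      then show False using that by (simp add: B_def)
    qed
    obtain m where m: "0 < m" "\<And>y. y \<in> B \<Longrightarrow> m \<le> pp y \<bullet> pp y"
    proof (cases "B = {}")
      case True
      then show thesis using that[of 1] by simp
    next
      case False
      have "continuous_on B (\<lambda>y. pp y \<bullet> pp y)" by (intro continuous_intros cpp)
      then obtain y where "y \<in> B" "\<And>z. z \<in> B \<Longrightarrow> pp y \<bullet> pp y \<le> pp z \<bullet> pp z"
        using continuous_attains_inf[OF B False] by blast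
      then show thesis using that[of "pp y \<bullet> pp y"] pos by blast
    qed
    show thesis
    proof (rule that[of "min m (\<rho>\<^sup>2)"])
      fix y assume "y \<in> K" "norm (pn y) = \<rho>" "f (chart_inv \<kappa> y) - H1 \<le> h (chart_inv \<kappa> y)"
      then have "y \<in> B" by (auto simp: B_def F_def d_def)
      then show "min m (\<rho>\<^sup>2) \<le> pp y \<bullet> pp y" using m(2) by fastforce
    qed (use m \<rho> in auto)
  qed
  define Q where "Q = (H1 + 1) / ramp (t / 2)"
  have Q: "0 < Q" "Q * ramp (t / 2) = H1 + 1" using ramp_pos[of "t / 2"] t H by (auto simp: Q_def)
  define p where "p y = Q * ramp (pp y \<bullet> pp y - t / 2)" for y
  have pC: "Cinf_on UNIV p"
    unfolding p_def
    by (intro Cinf_on_mult Cinf_on_const open_UNIV Cinf_on_compose[OF _ _ _ _ Cinf_on_ramp] Cinf_on_diff qC bl) auto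
  have p0: "0 \<le> p y" for y using Q ramp_nonneg by (simp add: p_def)
  have p1: "H1 + 1 \<le> p y" if "t \<le> pp y \<bullet> pp y" for y
    using mult_left_mono[OF ramp_mono[of "t / 2" "pp y \<bullet> pp y - t / 2"], of Q] that Q by (simp add: p_def)
  have pV: "0 \<le> frechet_derivative p (at y) (- pn y + pp y)" if "y \<in> M" for y
  proof -
    have "((\<lambda>y. pp y \<bullet> pp y - t / 2) has_derivative (\<lambda>w. 2 * (pp y \<bullet> pp w))) (at y)"
      using has_derivative_diff[OF qD[OF bl(2)] has_derivative_const] by simp
    from has_derivative_compose[OF this ramp_deriv[unfolded has_field_derivative_def]]
    have "(p has_derivative (\<lambda>w. Q * (ramp_slope (pp y \<bullet> pp y - t / 2) * (2 * (pp y \<bullet> pp w))))) (at y)"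
      unfolding p_def[abs_def] by (intro has_derivative_mult_right)
    from frechet_derivative_at[OF this, symmetric] show ?thesis
      using pZ[OF that] Q ramp_slope_bounds(1) by simp
  qed
  define k where "k x = f x - H1 + p (coord \<kappa> x)" for x
  define Q' where "Q' = chart_inv \<kappa> ` K"
  define G where "G = {x \<in> domain \<kappa>. coord \<kappa> x \<in> {y. norm (pn y) < \<rho>} \<inter> {y. norm (pp y) < \<rho>}}"
  have opG: "open G" unfolding G_def
    by (intro coord_preimage_open[OF \<kappa>] open_Int open_Collect_less continuous_intros cpn cpp)
  have clQ: "closed Q'" unfolding Q'_def by (intro compact_imp_closed compact_continuous_image[OF cinv K]) auto
  have Q'D: "x \<in> domain \<kappa>" "coord \<kappa> x \<in> K" "x \<in> U" if "x \<in> Q'" for x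
    using that Kcod \<open>\<And>y. y \<in> codomain \<kappa> \<Longrightarrow> coord \<kappa> (chart_inv \<kappa> y) = y\<close> \<open>\<And>y. y \<in> codomain \<kappa> \<Longrightarrow> chart_inv \<kappa> y \<in> domain \<kappa>\<close>
    by (auto simp: Q'_def)
  have GQ: "G \<subseteq> Q'"
  proof
    fix x assume "x \<in> G"
    then have "x \<in> domain \<kappa>" "coord \<kappa> x \<in> K" using dM by (auto simp: G_def K_def)
    then show "x \<in> Q'" unfolding Q'_def using is_chartD(7)[OF \<kappa>] by (metis imageI)
  qed
  have sk: "smooth_in \<kappa>' k x" and sp: "smooth_in \<kappa>' (\<lambda>x. p (coord \<kappa> x)) x"
    if "x \<in> domain \<kappa>" "\<kappa>' \<in> A" "x \<in> domain \<kappa>'" for x \<kappa>'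
  proof -
    show sp: "smooth_in \<kappa>' (\<lambda>x. p (coord \<kappa> x)) x"
      using chart_pullback(1)[OF \<kappa> tr open_UNIV pC that(1) UNIV_I that(2,3)] .
    show "smooth_in \<kappa>' k x" unfolding k_def
      by (intro smooth_in_arith(1,3) smooth_in_f smooth_in_const sp chart that)
  qed
  have kn: "smooth_near Q' k" unfolding smooth_near_def using sk Q'D(1) by blast
  have kZ: "increasing_on G k"
    unfolding increasing_on_def
  proof (intro ballI impI)
    fix x \<kappa>' assume x: "x \<in> G - crit" and \<kappa>': "\<kappa>' \<in> A" "x \<in> domain \<kappa>'"
    have xd: "x \<in> domain \<kappa>" using x by (simp add: G_def)
    note s = smooth_in_f[OF \<kappa>'] smooth_in_const
    note cx = chart[OF \<kappa>'(1)] and X = Z_model[OF \<kappa>']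
    have s1: "smooth_in \<kappa>' (\<lambda>x. f x - H1) x" by (rule smooth_in_arith(3)[OF s \<kappa>'(2) cx])
    have "chart_deriv \<kappa>' (\<lambda>x. f x - H1) x (Z x \<kappa>') = 1 * chart_deriv \<kappa>' f x (Z x \<kappa>')"
      by (rule chart_deriv_compose[OF cx \<kappa>'(2) X s(1)]) (auto intro!: derivative_eq_intros)
    moreover have "chart_deriv \<kappa>' k x (Z x \<kappa>') = chart_deriv \<kappa>' (\<lambda>x. f x - H1) x (Z x \<kappa>') + chart_deriv \<kappa>' (\<lambda>x. p (coord \<kappa> x)) x (Z x \<kappa>')"
      unfolding k_def[abs_def] by (rule chart_deriv_arith(1)[OF cx \<kappa>'(2) X s1 sp[OF xd \<kappa>']])
    moreover have "chart_deriv \<kappa>' (\<lambda>x. p (coord \<kappa> x)) x (Z x \<kappa>') = frechet_derivative p (at (coord \<kappa> x)) (- pn (coord \<kappa> x) + pp (coord \<kappa> x))"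
      using chart_pullback(2)[OF \<kappa> tr open_UNIV pC xd UNIV_I \<kappa>' Z_chart(1)[OF xd, unfolded M_def] Z_chart(2)[OF xd \<kappa>']] .
    ultimately show "0 < chart_deriv \<kappa>' k x (Z x \<kappa>')"
      using pV[OF dM[OF xd]] Zf_pos[OF _ \<kappa>'] x by simp
  qed
  have bd: "h x < k x" if x: "x \<in> Q' - G" for x
  proof -
    let ?y = "coord \<kappa> x"
    have xQ: "x \<in> domain \<kappa>" "?y \<in> K" using x Q'D by auto
    have ci: "chart_inv \<kappa> ?y = x" by (rule is_chartD(7)[OF \<kappa> xQ(1)])
    have far: "h x < k x" if "t \<le> pp ?y \<bullet> pp ?y"
      using p1[of ?y] that hf[of x] by (simp add: k_def)
    consider "norm (pp ?y) = \<rho>" | "norm (pn ?y) = \<rho>" using x xQ by (auto simp: G_def K_def)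
    then show ?thesis
    proof cases
      case 1
      then have "pp ?y \<bullet> pp ?y = \<rho>\<^sup>2" by (simp add: dot_square_norm)
      then show ?thesis using far t(2) by simp
    next
      case 2
      show ?thesis
      proof (cases "f x - H1 \<le> h x")
        case True
        then show ?thesis using far t(3)[OF xQ(2) 2] ci by simp
      next
        case False
        then show ?thesis using p0[of ?y] by (simp add: k_def)
      qed
    qed
  qed
  define d where "d = H1 * ln (H1 / H)"
  have d: "0 < d" "\<And>a. smin d a (a - H1) = a - H" using smin_shift[OF H(1,2)] by (auto simp: d_def)
  define hh where "hh = lower_on d G k h"
  note l = lower_on[OF hs opG clQ GQ kn bd hi kZ d(1)]
  define G1 where "G1 = G \<inter> {x \<in> domain \<kappa>. coord \<kappa> x \<in> {y. pp y \<bullet> pp y < t / 2}} \<inter> - C"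
  show thesis
  proof (rule that[of hh "C \<union> Q'" G1])
    show "smooth_function A hh" "increasing_on UNIV hh" using l(1,2) by (simp_all add: hh_def)
    show "hh x \<le> f x" for x using l(3)[of x] hf[of x] by (simp add: hh_def)
    show "closed (C \<union> Q')" using C clQ by auto
    show "C \<union> Q' \<subseteq> U" using C Q'D by auto
    show "hh x = f x" if "x \<notin> C \<union> Q'" for x
    proof -
      have "x \<notin> G" "x \<notin> C" using that GQ by auto
      then show ?thesis using l(4) C(4) by (simp add: hh_def)
    qed
    show "(C \<union> Q') \<inter> crit \<subseteq> {c}" using C only_c Q'D by blast
    show "open G1" unfolding G1_def using C
      by (intro open_Int opG coord_preimage_open[OF \<kappa>] open_Collect_less continuous_intros cpp) auto
    show "c \<in> G1" using cd c C(3) t \<rho> linear_0[OF lin(1)] linear_0[OF lin(2)] by (auto simp: G1_def G_def)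
    show "hh x = f x - f c + u" if "x \<in> G1" for x
    proof -
      have "x \<in> G" "h x = f x" "p (coord \<kappa> x) = 0" using that C(4) by (auto simp: G1_def p_def ramp_eq_0)
      then have "hh x = smin d (f x) (f x - H1)" by (simp add: hh_def lower_on_def k_def)
      then show ?thesis using d(2) by (simp add: H_def)
    qed
  qed
qed

text \<open>The path is the segment from \<open>f\<close> to the lowered function; positivity along \<open>Z\<close> is a convex condition.\<close>

lemma segment_path:
  assumes h: "smooth_function A h" "increasing_on UNIV h" and loc: "\<And>x. x \<in> crit \<Longrightarrow> \<exists>G a. open G \<and> x \<in> G \<and> (\<forall>y\<in>G. h y = f y - a)"
  defines "F \<equiv> \<lambda>\<sigma> x. f x - smooth_step \<sigma> * (f x - h x)"
  shows "path_of_functions A F 0 1" and "morse_datum A (F \<sigma>) Z"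
proof -
  have hs: "smooth_in \<kappa> h x" if "\<kappa> \<in> A" "x \<in> domain \<kappa>" for \<kappa> x using h that smooth_function_iff by blast
  show "path_of_functions A F 0 1"
    unfolding path_of_functions_def
  proof (intro conjI ballI allI impI)
    show "F \<sigma> = F 0" if "\<sigma> \<le> 0" for \<sigma> using that by (simp add: F_def smooth_step_eq_0)
    show "F \<sigma> = F 1" if "1 \<le> \<sigma>" for \<sigma> using that by (simp add: F_def smooth_step_eq_1)
    fix \<kappa> assume \<kappa>: "\<kappa> \<in> A"
    note k = is_chartD[OF chart[OF \<kappa>]]
    show "smooth_on (UNIV \<times> codomain \<kappa>) (\<lambda>(\<sigma>, y). F \<sigma> (chart_inv \<kappa> y))"
      unfolding smooth_on_def
    proof
      fix z :: "real \<times> 'e" assume "z \<in> UNIV \<times> codomain \<kappa>"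
      then obtain \<sigma> y where z: "z = (\<sigma>, y)" "y \<in> codomain \<kappa>" by auto
      define x where "x = chart_inv \<kappa> y"
      have x: "x \<in> domain \<kappa>" "coord \<kappa> x = y" using k(8,9) z by (auto simp: x_def)
      obtain T g where g: "open T" "y \<in> T" "Cinf_on T g" "\<And>y. y \<in> codomain \<kappa> \<Longrightarrow> y \<in> T \<Longrightarrow> g y = f (chart_inv \<kappa> y)"
        using smooth_inE[OF smooth_in_f[OF \<kappa> x(1)]] x(2) by metis
      obtain T' g' where g': "open T'" "y \<in> T'" "Cinf_on T' g'" "\<And>y. y \<in> codomain \<kappa> \<Longrightarrow> y \<in> T' \<Longrightarrow> g' y = h (chart_inv \<kappa> y)"
        using smooth_inE[OF hs[OF \<kappa> x(1)]] x(2) by metis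
      define S where "S = (UNIV :: real set) \<times> (T \<inter> T')"
      have S: "open S" unfolding S_def using g g' by (intro open_Times) auto
      have cs: "Cinf_on S (\<lambda>z. smooth_step (fst z))"
        by (rule Cinf_on_compose[OF S open_UNIV _ Cinf_on_fst[OF S] Cinf_on_smooth_step]) auto
      have cg: "Cinf_on S (\<lambda>z. g (snd z))"
        by (rule Cinf_on_compose[OF S g(1) _ Cinf_on_snd[OF S] g(3)]) (auto simp: S_def)
      have cg': "Cinf_on S (\<lambda>z. g' (snd z))"
        by (rule Cinf_on_compose[OF S g'(1) _ Cinf_on_snd[OF S] g'(3)]) (auto simp: S_def)
      have "Cinf_on S (\<lambda>z. g (snd z) - smooth_step (fst z) * (g (snd z) - g' (snd z)))"
        by (intro Cinf_on_diff Cinf_on_mult S cs cg cg')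
      then show "\<exists>T g. open T \<and> z \<in> T \<and> (\<forall>k. Ck_on k T g) \<and>
          (\<forall>y\<in>UNIV \<times> codomain \<kappa> \<inter> T. g y = (case y of (\<sigma>, y) \<Rightarrow> F \<sigma> (chart_inv \<kappa> y)))"
        unfolding Cinf_on_def
        by (intro exI[of _ S] exI[of _ "\<lambda>z. g (snd z) - smooth_step (fst z) * (g (snd z) - g' (snd z))"])
           (use S z g g' in \<open>auto simp: S_def F_def\<close>)
    qed
  qed simp
  show "morse_datum A (F \<sigma>) Z"
  proof (rule morse_datum_modification)
    let ?r = "smooth_step \<sigma>"
    have eq: "F \<sigma> = (\<lambda>x. f x - ?r * (f x - h x))" by (simp add: F_def)
    have s: "smooth_in \<kappa> (\<lambda>x. ?r * (f x - h x)) x" if "\<kappa> \<in> A" "x \<in> domain \<kappa>" for \<kappa> x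
      using that by (intro smooth_in_arith(2,3) smooth_in_f hs smooth_in_const chart)
    show "smooth_function A (F \<sigma>)"
      unfolding smooth_function_iff eq
      by (intro ballI smooth_in_arith(3) smooth_in_f s chart)
    show "increasing_on UNIV (F \<sigma>)"
      unfolding increasing_on_def
    proof (intro ballI impI)
      fix x \<kappa> assume x: "x \<in> UNIV - crit" and \<kappa>: "\<kappa> \<in> A" "x \<in> domain \<kappa>"
      note c = chart[OF \<kappa>(1)] and X = Z_model[OF \<kappa>]
      define a where "a = chart_deriv \<kappa> f x (Z x \<kappa>)"
      define b where "b = chart_deriv \<kappa> h x (Z x \<kappa>)"
      have ab: "0 < a" "0 < b" using x \<kappa> h(2) Zf_pos by (auto simp: a_def b_def increasing_on_def)
      have sd: "smooth_in \<kappa> (\<lambda>x. f x - h x) x" by (intro smooth_in_arith(3) smooth_in_f hs c \<kappa>)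
      have "chart_deriv \<kappa> (\<lambda>x. ?r * (f x - h x)) x (Z x \<kappa>) = ?r * chart_deriv \<kappa> (\<lambda>x. f x - h x) x (Z x \<kappa>)"
        by (rule chart_deriv_compose[OF c \<kappa>(2) X sd]) (auto intro!: derivative_eq_intros)
      then have "chart_deriv \<kappa> (F \<sigma>) x (Z x \<kappa>) = a - ?r * (a - b)"
        unfolding eq using chart_deriv_arith(2)[OF c \<kappa>(2) X smooth_in_f[OF \<kappa>] s[OF \<kappa>]]
          chart_deriv_arith(2)[OF c \<kappa>(2) X smooth_in_f[OF \<kappa>] hs[OF \<kappa>]] by (simp add: a_def b_def)
      also have "\<dots> = (1 - ?r) * a + ?r * b" by (simp add: algebra_simps)
      also have "0 < \<dots>"
      proof (cases "?r = 0")
        case False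
        then have "0 < ?r * b" "0 \<le> (1 - ?r) * a" using ab smooth_step_bounds[of \<sigma>] by auto
        then show ?thesis by linarith
      qed (use ab in simp)
      finally show "0 < chart_deriv \<kappa> (F \<sigma>) x (Z x \<kappa>)" .
    qed
    fix x assume "x \<in> crit"
    then obtain G a where "open G" "x \<in> G" "\<forall>y\<in>G. h y = f y - a" using loc by blast
    then show "\<exists>G a. open G \<and> x \<in> G \<and> (\<forall>y\<in>G. F \<sigma> y = f y - a)"
      by (intro exI[of _ G] exI[of _ "?r * a"]) (auto simp: F_def)
  qed
qed

end

theorem mainTheorem7:
  fixes A :: "('v::t2_space, 'e::euclidean_space) chart set"
    and f :: "'v \<Rightarrow> real"
    and Z :: "'v \<Rightarrow> ('v, 'e) chart \<Rightarrow> 'e"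
    and c :: 'v
    and u u' :: real
    and \<U> :: "'v set"
  assumes "smooth_manifold A"
    and "morse_datum A f Z"
    and "c \<in> critical_set A f"
    and "u' < u" and "u < f c"
    and "proper_above (nappe A Z c) f u'"
    and "{x \<in> nappe A Z c. f x \<ge> u} \<subseteq> interior \<U>"
  shows "\<exists>(F :: real \<Rightarrow> 'v \<Rightarrow> real) a b C.
           path_of_functions A F a b \<and> F a = f \<and> path_support F a \<subseteq> \<U> \<and>
           c \<in> interior C \<and>
           F 0 = f \<and>
           (\<forall>\<sigma> \<sigma>' x. 0 \<le> \<sigma> \<and> \<sigma> \<le> \<sigma>' \<longrightarrow>
              F b x \<le> F \<sigma>' x \<and> F \<sigma>' x \<le> F \<sigma> x \<and> F \<sigma> x \<le> f x) \<and>
           (\<forall>x\<in>C. F b x = f x - f c + u) \<and>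
           (\<forall>\<sigma>. morse_datum A (F \<sigma>) Z)"
proof -
  interpret morse A f Z using assms(1,2) by unfold_locales
  obtain h G K where h: "smooth_function A h" "increasing_on UNIV h" "\<And>x. h x \<le> f x"
    and K: "closed K" "K \<subseteq> interior \<U>" "\<And>x. x \<notin> K \<Longrightarrow> h x = f x" "K \<inter> crit \<subseteq> {c}"
    and G: "open G" "c \<in> G" "\<And>x. x \<in> G \<Longrightarrow> h x = f x - f c + u"
    by (rule lowered_function[OF assms(3-6) open_interior assms(7)]) (rule that, assumption+)
  define F where "F = (\<lambda>\<sigma> x. f x - smooth_step \<sigma> * (f x - h x))"
  have loc: "\<exists>G a. open G \<and> x \<in> G \<and> (\<forall>y\<in>G. h y = f y - a)" if "x \<in> crit" for x
  proof (cases "x = c")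
    case True
    then show ?thesis using G by (intro exI[of _ G] exI[of _ "f c - u"]) auto
  next
    case False
    then show ?thesis using K that by (intro exI[of _ "- K"] exI[of _ 0]) auto
  qed
  have F0: "F 0 = f" and F1: "F 1 = h" by (simp_all add: F_def smooth_step_eq_0 smooth_step_eq_1)
  have mono: "F \<sigma>' x \<le> F \<sigma> x" if "\<sigma> \<le> \<sigma>'" for \<sigma> \<sigma>' x
    using mult_right_mono[OF smooth_step_mono[OF that], of "f x - h x"] h(3)[of x] by (simp add: F_def)
  have low: "h x \<le> F \<sigma> x" "F \<sigma> x \<le> f x" for \<sigma> x
    using mult_right_mono[OF smooth_step_bounds(2)[of \<sigma>], of "f x - h x"]
      mult_nonneg_nonneg[OF smooth_step_bounds(1)[of \<sigma>], of "f x - h x"] h(3)[of x] by (simp_all add: F_def)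
  have "path_support F 0 \<subseteq> K"
    unfolding path_support_def
  proof (rule closure_minimal[OF _ K(1)], rule subsetI, rule ccontr)
    fix x assume "x \<in> {x. \<exists>\<sigma>. F \<sigma> x \<noteq> F 0 x}" "x \<notin> K"
    then show False using K(3)[of x] by (auto simp: F_def)
  qed
  then have supp: "path_support F 0 \<subseteq> \<U>" using K(2) interior_subset by (metis order_trans)
  show ?thesis
  proof (rule exI[of _ F], rule exI[of _ 0], rule exI[of _ 1], rule exI[of _ G], intro conjI allI impI ballI)
    show "path_of_functions A F 0 1" unfolding F_def by (rule segment_path(1)[OF h(1,2) loc])
    show "morse_datum A (F \<sigma>) Z" for \<sigma> unfolding F_def by (rule segment_path(2)[OF h(1,2) loc])
    show "c \<in> interior G" using G(2) interior_open[OF G(1)] by simp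
    show "F 1 x = f x - f c + u" if "x \<in> G" for x using G(3)[OF that] F1 by simp
    fix \<sigma> \<sigma>' :: real and x assume "0 \<le> \<sigma> \<and> \<sigma> \<le> \<sigma>'"
    then show "F \<sigma>' x \<le> F \<sigma> x" using mono by blast
    show "F 1 x \<le> F \<sigma>' x" "F \<sigma> x \<le> f x" using low F1 by auto
  qed (use F0 supp in auto)
qed

end
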